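(* Let $N\ge 2$ and $5\le d\le 7$ be integers. Let $f_m, H_m$, $\varepsilon_m\ge 0$ ($1\le m\le N$), $\varepsilon=\max_{1\le m\le N}\varepsilon_m$, $H$, $Q$, $u_0$, $c_e$, $I$, $M>0$ and $g=(g_1,\dots,g_N)$ be as in the context; in particular $f_m,H_m\in L^1(\mathbb{R}^d)\cap L^2(\mathbb{R}^d)$, $f_m$ is nontrivial for some $m$, $H^2>0$, $Q^2>0$, and each $g_m:\mathbb{R}^N\to\mathbb{R}$ satisfies $g_m(0)=0$, $\nabla g_m(0)=0$, with $g\in C^2(I,\mathbb{R}^N)$, $\|g\|_{C^2(I,\mathbb{R}^N)}\le M$ and $g$ not identically zero on $I$. Then for every $\rho\in(0,1]$ and all $$0<\varepsilon\le \frac{\rho}{M(\|u_0\|_{H^4(\mathbb{R}^d,\mathbb{R}^N)}+1)^2}\Bigg[H^2\big(\|u_0\|_{H^4(\mathbb{R}^d,\mathbb{R}^N)}+1\big)^{\frac{8}{d}-2}\Big(\frac{|S^d|}{4}\Big)^{\frac4d}\frac{d}{(d-4)(2\pi)^4}+Q^2\Bigg]^{-\frac12},$$ the system $$[-\Delta+\Delta^2]u_m(x)=\varepsilon_m\int_{\mathbb{R}^d}H_m(x-y)\,g_m(u_0(y)+v(y))\,dy,\qquad 1\le m\le N,$$ defines a map $T_g:B_\rho\to B_\rho$, $T_gv=u$ (that is, for each $v\in B_\rho$ there is exactly one solution $u\in B_\rho$), and $T_g$ is a strict contraction with respect to the norm of $H^4(\mathbb{R}^d,\mathbb{R}^N)$.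 The unique fixed point $u_p$ of $T_g$ is the only solution in $B_\rho$ of the system $$[-\Delta+\Delta^2]u_{p,m}(x)=\varepsilon_m\int_{\mathbb{R}^d}H_m(x-y)\,g_m(u_0(y)+u_p(y))\,dy,\qquad 1\le m\le N.$$
   Context: Functions are real-valued. $H^4(\mathbb{R}^d)=\{\phi:\mathbb{R}^d\to\mathbb{R}\mid \phi\in L^2(\mathbb{R}^d),\ \Delta^2\phi\in L^2(\mathbb{R}^d)\}$ with norm $\|\phi\|_{H^4(\mathbb{R}^d)}^2=\|\phi\|_{L^2(\mathbb{R}^d)}^2+\|\Delta^2\phi\|_{L^2(\mathbb{R}^d)}^2$. For vector functions $u=(u_1,\dots,u_N)^T$, $\|u\|_{H^4(\mathbb{R}^d,\mathbb{R}^N)}^2=\sum_{m=1}^N\|u_m\|_{H^4(\mathbb{R}^d)}^2$. For $d\le 7$, $c_e>0$ denotes a fixed constant of the Sobolev embedding $\|\phi\|_{L^\infty(\mathbb{R}^d)}\le c_e\|\phi\|_{H^4(\mathbb{R}^d)}$. Assumptions on $f$ and the kernels: for $1\le m\le N$, $f_m:\mathbb{R}^d\to\mathbb{R}$ and $H_m:\mathbb{R}^d\to\mathbb{R}$ belong to $L^1(\mathbb{R}^d)\cap L^2(\mathbb{R}^d)$; $f_m$ is nontrivial for some $m$; and $H^2:=\sum_{m=1}^N\|H_m\|_{L^1(\mathbb{R}^d)}^2>0$, $Q^2:=\sum_{m=1}^N\|H_m\|_{L^2(\mathbb{R}^d)}^2>0$ (with $H,Q>0$). The parameters $\varepsilon_m\ge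 0$ are real numbers and $\varepsilon:=\max_{1\le m\le N}\varepsilon_m$. $u_0=(u_{0,1},\dots,u_{0,N})^T\in H^4(\mathbb{R}^d,\mathbb{R}^N)$, where $u_{0,m}\in H^4(\mathbb{R}^d)$ is the unique solution of $[-\Delta+\Delta^2]u_{0,m}=f_m$ on $\mathbb{R}^d$ (such a solution exists and is unique for $5\le d\le7$). $B_\rho:=\{u\in H^4(\mathbb{R}^d,\mathbb{R}^N)\mid \|u\|_{H^4(\mathbb{R}^d,\mathbb{R}^N)}\le\rho\}$. $I:=\{z\in\mathbb{R}^N\mid |z|_{\mathbb{R}^N}\le c_e\|u_0\|_{H^4(\mathbb{R}^d,\mathbb{R}^N)}+c_e\}$, where $|\cdot|_{\mathbb{R}^N}$ is the Euclidean length. The norms are $\|g\|_{C^2(I,\mathbb{R}^N)}:=\sum_{m=1}^N\|g_m\|_{C^2(I)}$ and $$\|g_m\|_{C^2(I)}:=\|g_m\|_{C(I)}+\sum_{n=1}^N\Big\|\frac{\partial g_m}{\partial z_n}\Big\|_{C(I)}+\sum_{n,l=1}^N\Big\|\frac{\partial^2g_m}{\partial z_n\partial z_l}\Big\|_{C(I)},\qquad \|h\|_{C(I)}:=\max_{z\in I}|h(z)|.$$ Assumptions on $g$: each $g_m:\mathbb{R}^N\to\mathbb{R}$ satisfies $g_m(0)=0$, $\nabla g_m(0)=0$; $g\in C^2(I,\mathbb{R}^N)$ with $\|g\|_{C^2(I,\mathbb{R}^N)}\le M$, where $M>0$ is a given constant; and $g$ does not vanish identically on $I$. $S^d$ denotes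 the unit sphere in $\mathbb{R}^d$ centered at the origin and $|S^d|$ its Lebesgue (surface) measure. *)

theory Defs
  imports "HOL-Analysis.Analysis" "HOL-Probability.Essential_Supremum"
begin

text \<open>
  Functions on \<open>\<real>^d\<close> are represented by arbitrary representatives \<open>real^'d \<Rightarrow> real\<close>; elements of
  \<open>L^1\<close>, \<open>L^2\<close>, \<open>H^4\<close> are identified when they agree almost everywhere. The measure is
  \<open>lebesgue\<close> (the completion), not \<open>lborel\<close>: the nonlinearity below is only known to be regular
  on a ball that contains the values of its argument almost everywhere, so measurability of the
  composition needs completeness.
\<close>

definition L1_space :: "(real^'d \<Rightarrow> real) set" where
  "L1_space = {\<phi>. integrable lebesgue \<phi>}"

definition L1_norm :: "(real^'d \<Rightarrow> real) \<Rightarrow> real" where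
  "L1_norm \<phi> = (LINT x|lebesgue. \<bar>\<phi> x\<bar>)"

definition L2_space :: "(real^'d \<Rightarrow> real) set" where
  "L2_space = {\<phi> \<in> borel_measurable lebesgue. integrable lebesgue (\<lambda>x. (\<phi> x)\<^sup>2)}"

definition L2_norm :: "(real^'d \<Rightarrow> real) \<Rightarrow> real" where
  "L2_norm \<phi> = sqrt (LINT x|lebesgue. (\<phi> x)\<^sup>2)"

definition locally_integrable :: "(real^'d \<Rightarrow> real) \<Rightarrow> bool" where
  "locally_integrable F \<longleftrightarrow> (\<forall>K. compact K \<longrightarrow> set_integrable lebesgue K F)"


text \<open>
  Derivatives are taken within \<open>S\<close>. Only \<open>S = UNIV\<close> and closed balls of positive radius are used;
  there the derivative within \<open>S\<close> is unique, also at boundary points, and \<open>Ck_on k S\<close> is the usual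
  space of functions whose partial derivatives up to order \<open>k\<close> extend continuously to \<open>S\<close>.
\<close>

definition partial_deriv_on :: "(real^'k) set \<Rightarrow> 'k \<Rightarrow> (real^'k \<Rightarrow> real) \<Rightarrow> real^'k \<Rightarrow> real" where
  "partial_deriv_on S i f z = frechet_derivative f (at z within S) (axis i 1)"

fun Ck_on :: "nat \<Rightarrow> (real^'k) set \<Rightarrow> (real^'k \<Rightarrow> real) \<Rightarrow> bool" where
  "Ck_on 0 S f \<longleftrightarrow> continuous_on S f"
| "Ck_on (Suc k) S f \<longleftrightarrow> f differentiable_on S \<and> (\<forall>i. Ck_on k S (partial_deriv_on S i f))"

text \<open>For continuous \<open>h\<close> on a nonempty compact set the supremum is the maximum.\<close>

definition C_norm :: "(real^'k) set \<Rightarrow> (real^'k \<Rightarrow> real) \<Rightarrow> real" where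
  "C_norm S h = (SUP z\<in>S. \<bar>h z\<bar>)"

definition C2_norm :: "(real^'k) set \<Rightarrow> (real^'k \<Rightarrow> real) \<Rightarrow> real" where
  "C2_norm S h = C_norm S h
     + (\<Sum>n\<in>UNIV. C_norm S (partial_deriv_on S n h))
     + (\<Sum>n\<in>UNIV. \<Sum>l\<in>UNIV. C_norm S (partial_deriv_on S n (partial_deriv_on S l h)))"

definition C2_vec_norm :: "(real^'k) set \<Rightarrow> (real^'k \<Rightarrow> real^'n) \<Rightarrow> real" where
  "C2_vec_norm S g = (\<Sum>m\<in>UNIV. C2_norm S (\<lambda>z. g z $ m))"


definition test_function :: "(real^'d \<Rightarrow> real) \<Rightarrow> bool" where
  "test_function \<psi> \<longleftrightarrow> (\<forall>k. Ck_on k UNIV \<psi>) \<and> compact (closure {x. \<psi> x \<noteq> 0})"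

definition laplacian :: "(real^'d \<Rightarrow> real) \<Rightarrow> real^'d \<Rightarrow> real" where
  "laplacian \<psi> x = (\<Sum>i\<in>UNIV. partial_deriv_on UNIV i (partial_deriv_on UNIV i \<psi>) x)"

text \<open>\<open>\<Delta>\<^sup>2 \<phi> = w\<close> in the sense of distributions.\<close>

definition has_weak_bilaplacian :: "(real^'d \<Rightarrow> real) \<Rightarrow> (real^'d \<Rightarrow> real) \<Rightarrow> bool" where
  "has_weak_bilaplacian \<phi> w \<longleftrightarrow>
     (\<forall>\<psi>. test_function \<psi> \<longrightarrow>
        (LINT x|lebesgue. \<phi> x * laplacian (laplacian \<psi>) x) = (LINT x|lebesgue. w x * \<psi> x))"

definition H4_space :: "(real^'d \<Rightarrow> real) set" where
  "H4_space = {\<phi> \<in> L2_space. \<exists>w\<in>L2_space. has_weak_bilaplacian \<phi> w}"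

text \<open>The choice below is unique up to null sets, so the norm does not depend on it.\<close>

definition weak_bilaplacian :: "(real^'d \<Rightarrow> real) \<Rightarrow> real^'d \<Rightarrow> real" where
  "weak_bilaplacian \<phi> = (SOME w. w \<in> L2_space \<and> has_weak_bilaplacian \<phi> w)"

definition H4_norm :: "(real^'d \<Rightarrow> real) \<Rightarrow> real" where
  "H4_norm \<phi> = sqrt ((L2_norm \<phi>)\<^sup>2 + (L2_norm (weak_bilaplacian \<phi>))\<^sup>2)"

definition H4_vec_space :: "(real^'d \<Rightarrow> real^'n) set" where
  "H4_vec_space = {u. \<forall>m. (\<lambda>x. u x $ m) \<in> H4_space}"

definition H4_vec_norm :: "(real^'d \<Rightarrow> real^'n) \<Rightarrow> real" where
  "H4_vec_norm u = sqrt (\<Sum>m\<in>UNIV. (H4_norm (\<lambda>x. u x $ m))\<^sup>2)"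

definition H4_ball :: "real \<Rightarrow> (real^'d \<Rightarrow> real^'n) set" where
  "H4_ball \<rho> = {u \<in> H4_vec_space. H4_vec_norm u \<le> \<rho>}"

text \<open>\<open>c\<close> is an admissible constant in the embedding \<open>\<parallel>\<phi>\<parallel>\<^sub>\<infinity> \<le> c \<parallel>\<phi>\<parallel>\<close> of \<open>H^4\<close> into \<open>L^\<infinity>\<close>;
  the phantom argument fixes the dimension.\<close>

definition sobolev_constant :: "'d::finite itself \<Rightarrow> real \<Rightarrow> bool" where
  "sobolev_constant _ c \<longleftrightarrow> c > 0 \<and>
     (\<forall>\<phi>\<in>(H4_space :: (real^'d \<Rightarrow> real) set).
        esssup lebesgue (\<lambda>x. ereal \<bar>\<phi> x\<bar>) \<le> ereal (c * H4_norm \<phi>))"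

text \<open>\<open>[-\<Delta> + \<Delta>\<^sup>2] u = F\<close> on \<open>\<real>^d\<close> in the sense of distributions.\<close>

definition solves_PDE :: "(real^'d \<Rightarrow> real) \<Rightarrow> (real^'d \<Rightarrow> real) \<Rightarrow> bool" where
  "solves_PDE u F \<longleftrightarrow> locally_integrable F \<and>
     (\<forall>\<psi>. test_function \<psi> \<longrightarrow>
        (LINT x|lebesgue. u x * (- laplacian \<psi> x + laplacian (laplacian \<psi>) x))
          = (LINT x|lebesgue. F x * \<psi> x))"

text \<open>\<open>u\<close> solves the system with the nonlinearity evaluated at \<open>u\<^sub>0 + v\<close>.\<close>

definition solves_system ::
    "('n::finite \<Rightarrow> real) \<Rightarrow> ('n \<Rightarrow> real^'d \<Rightarrow> real) \<Rightarrow> (real^'n \<Rightarrow> real^'n)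
      \<Rightarrow> (real^'d \<Rightarrow> real^'n) \<Rightarrow> (real^'d \<Rightarrow> real^'n) \<Rightarrow> (real^'d \<Rightarrow> real^'n) \<Rightarrow> bool" where
  "solves_system \<epsilon> H g u0 v u \<longleftrightarrow>
     (\<forall>m. solves_PDE (\<lambda>x. u x $ m)
            (\<lambda>x. \<epsilon> m * (LINT y|lebesgue. H m (x - y) * (g (u0 y + v y) $ m))))"

abbreviation ae_eq :: "(real^'d \<Rightarrow> 'b) \<Rightarrow> (real^'d \<Rightarrow> 'b) \<Rightarrow> bool" where
  "ae_eq u v \<equiv> (AE x in lebesgue. u x = v x)"


text \<open>
  Surface measure on the unit sphere, in its standard polar-coordinate definition:
  \<open>\<sigma>(A) = d \<lambda>({r\<omega> | 0 < r \<le> 1, \<omega> \<in> A})\<close>.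
\<close>

definition sphere_measure :: "(real^'d) set \<Rightarrow> real" where
  "sphere_measure A =
     real CARD('d) * measure lebesgue {r *\<^sub>R \<omega> | r \<omega>. 0 < r \<and> r \<le> 1 \<and> \<omega> \<in> A}"

end

theory Submission
  imports Defs "HOL-Computational_Algebra.Polynomial" "HOL-Computational_Algebra.Fundamental_Theorem_Algebra"
    "HOL-Probability.Distributions"
begin

text \<open>
  In Fourier variables the equation \<open>-\<Delta>u + \<Delta>\<^sup>2u = F\<close> is solved by the multiplier
  \<open>1/(|p|\<^sup>2 + |p|\<^sup>4) = 1/|p|\<^sup>2 - 1/(1 + |p|\<^sup>2)\<close>.  In position space this is a difference of two
  resolvents of the Laplacian, \<open>u = R\<^sub>0 F - R\<^sub>1 F\<close> with
  \<open>R\<^sub>l = (l - \<Delta>)\<^sup>-\<^sup>1 = \<integral>\<^sub>0\<^sup>\<infinity> e\<^sup>-\<^sup>l\<^sup>t e\<^sup>t\<^sup>\<Delta> dt\<close>, and the bilaplacian of \<open>u\<close> is \<open>F - R\<^sub>1 F\<close>.  Both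
  kernels are positive averages of Gaussians, so all estimates below are made with the heat kernel and
  Tonelli's theorem instead of the Fourier transform.

  Linear theory.  The quadratic form \<open>q(t) = \<langle>|F|, e\<^sup>t\<^sup>\<Delta> |F|\<rangle>\<close> is at most \<open>\<parallel>F\<parallel>\<^sub>2\<^sup>2\<close>, and at most
  \<open>(4\<pi>t)\<^sup>-\<^sup>d\<^sup>/\<^sup>2 \<parallel>F\<parallel>\<^sub>1\<^sup>2\<close>.  The semigroup law turns the square of the norm of \<open>R\<^sub>0 |F|\<close> into
  \<open>\<integral>\<^sub>0\<^sup>\<infinity> t q(t) dt\<close>, which converges at infinity because \<open>d > 4\<close>; splitting the integral at a time \<open>T\<close>
  gives \<open>nconv_nres_0_L2_bound\<close>.  That the bilaplacian does not exceed \<open>F\<close> in norm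
  (\<open>rconv_res_1_complement_L2_le\<close>) follows since \<open>R\<^sub>1\<close> is an average of the positive contractions
  \<open>e\<^sup>t\<^sup>\<Delta>\<close>.  The kernels really are fundamental solutions (\<open>rconv_res_test_function\<close>): along a ray, the
  function \<open>t \<mapsto> e\<^sup>-\<^sup>l\<^sup>t \<psi>(y + \<surd>(2t) w)\<close> runs from \<open>\<psi>(y)\<close> to \<open>0\<close>, and averaging its derivative over a
  standard Gaussian \<open>w\<close> produces \<open>-e\<^sup>-\<^sup>l\<^sup>t e\<^sup>t\<^sup>\<Delta>(l\<psi> - \<Delta>\<psi>)(y)\<close> after one integration by parts.
  Transposing this identity gives existence of weak solutions, and also uniqueness in \<open>L\<^sup>2\<close>, because
  the operator commutes with translations.  The result is \<open>solution_estimate\<close>.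

  Nonlinear part.  On the ball \<open>I\<close> a component of \<open>g\<close> satisfies
  \<open>|g(a) - g(b)| \<le> A\<^sub>1 |a - b|\<close> and \<open>|g(a) - g(b)| \<le> A\<^sub>2 |a - b| (|a| + |b|)/2\<close>, where \<open>A\<^sub>1\<close> and \<open>A\<^sub>2\<close>
  are the first and second order parts of the \<open>C\<^sup>2\<close> norm, so that \<open>A\<^sub>1 + A\<^sub>2 \<le> M\<close>.  The first bound controls
  \<open>L\<^sup>2\<close> norms and the second \<open>L\<^sup>1\<close> norms, and Young's inequality carries both through the convolution with
  \<open>H\<close>.  The heat kernel bound has a slightly larger constant than the one obtained from Plancherel's
  theorem, but \<open>A\<^sub>1\<close> and \<open>A\<^sub>2\<close> cannot both be close to \<open>M\<close>: with the time \<open>T = X\<^sup>4\<^sup>/\<^sup>d/(4\<pi>)\<close>, \<open>X = \<parallel>u\<^sub>0\<parallel> + 1\<close>,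
  only \<open>A\<^sub>1\<^sup>2 + A\<^sub>2\<^sup>2 \<le> M\<^sup>2\<close> and the numerical fact \<open>2\<pi>\<^sup>2 \<le> d (|S\<^sup>d|/4)\<^sup>4\<^sup>/\<^sup>d\<close> (\<open>unit_sphere_area_bound\<close>)
  are needed to reach the stated constant.  The solution map is then Lipschitz from \<open>L\<^sup>2\<close> to \<open>H\<^sup>4\<close> with
  constant \<open>\<rho>/X\<close>, which is less than \<open>1\<close> because a nontrivial \<open>f\<close> forces \<open>u\<^sub>0 \<noteq> 0\<close>.  The iteration
  converges almost everywhere by the Sobolev embedding, and its limit is the fixed point
  (\<open>contraction_fixed_point\<close>).
\<close>

section \<open>The fundamental lemma of the calculus of variations\<close>

text \<open>
  The \<open>C\<^sup>\<infinity>\<close> bump \<open>exp (-c/w)\<close> on \<open>(a, b)\<close>, with \<open>w = (x - a)(b - x)\<close>, together with all functions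
  that can occur as its derivatives: a rational prefactor \<open>p/w\<^sup>k\<close> is all that differentiation adds.
\<close>

definition bump :: "real \<Rightarrow> real \<Rightarrow> real \<Rightarrow> real poly \<Rightarrow> nat \<Rightarrow> real \<Rightarrow> real" where
  "bump a b c p k x =
     (if a < x \<and> x < b
      then poly p x / ((x - a) * (b - x)) ^ k * exp (- c / ((x - a) * (b - x))) else 0)"

lemma power_div_fact_le_exp:
  fixes y :: real
  assumes "y \<ge> 0"
  shows "y ^ n / fact n \<le> exp y"
proof -
  have "(\<Sum>i\<in>{n}. y ^ i /\<^sub>R fact i) \<le> (\<Sum>i. y ^ i /\<^sub>R fact i)"
    using assms by (intro sum_le_suminf summable_exp_generic) auto
  then show ?thesis
    by (simp add: exp_def divide_inverse mult.commute)
qed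

lemma exp_neg_inverse_le:
  fixes w c :: real
  assumes "w > 0" "c > 0"
  shows "exp (- c / w) \<le> fact n * (w / c) ^ n"
proof -
  have "(c / w) ^ n / fact n \<le> exp (c / w)"
    using assms by (intro power_div_fact_le_exp) auto
  moreover have "(c / w) ^ n > 0" using assms by simp
  ultimately have "inverse (exp (c / w)) \<le> inverse ((c / w) ^ n / fact n)"
    by (intro le_imp_inverse_le) auto
  then show ?thesis
    by (simp add: exp_minus power_divide mult.commute)
qed

text \<open>
  The exponential beats every power of \<open>1/w\<close>, so a bump vanishes to second order at both end points;
  this is why it is differentiable there.
\<close>

lemma bump_le_square:
  assumes "c > 0"
  obtains K where "\<And>x. \<bar>bump a b c p k x\<bar> \<le> K * (x - a)\<^sup>2" "\<And>x. \<bar>bump a b c p k x\<bar> \<le> K * (x - b)\<^sup>2"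
proof -
  obtain m where m: "m > 0" "\<And>z. norm z \<le> \<bar>a\<bar> + \<bar>b\<bar> \<Longrightarrow> norm (poly p z) \<le> m"
    using poly_bound_exists[of "\<bar>a\<bar> + \<bar>b\<bar>" p] by blast
  define L where "L = m * fact (k + 2) / c ^ (k + 2)"
  have L: "L \<ge> 0" using m assms by (simp add: L_def)
  have *: "\<bar>bump a b c p k x\<bar> \<le> L * ((x - a) * (b - x))\<^sup>2" if x: "a < x" "x < b" for x
  proof -
    define w where "w = (x - a) * (b - x)"
    have w: "w > 0" using x by (simp add: w_def)
    have "\<bar>bump a b c p k x\<bar> = \<bar>poly p x\<bar> / w ^ k * exp (- c / w)"
      using x w by (simp add: bump_def w_def abs_mult)
    also have "\<dots> \<le> m / w ^ k * (fact (k + 2) * (w / c) ^ (k + 2))"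
      using m(2)[of x] x w m(1) exp_neg_inverse_le[OF w assms, of "k + 2"]
      by (intro mult_mono divide_right_mono) auto
    also have "\<dots> = L * w\<^sup>2"
      using w assms by (simp add: L_def field_simps power_add power2_eq_square power_divide)
    finally show ?thesis by (simp add: w_def)
  qed
  have fin: "L * ((x - a) * (b - x))\<^sup>2 \<le> L * (b - a)\<^sup>2 * (x - a)\<^sup>2"
    "L * ((x - a) * (b - x))\<^sup>2 \<le> L * (b - a)\<^sup>2 * (x - b)\<^sup>2" if x: "a < x" "x < b" for x
  proof -
    have "(x - a)\<^sup>2 \<le> (b - a)\<^sup>2" "(b - x)\<^sup>2 \<le> (b - a)\<^sup>2"
      using x by (intro power_mono; simp)+
    then show "L * ((x - a) * (b - x))\<^sup>2 \<le> L * (b - a)\<^sup>2 * (x - a)\<^sup>2"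
      "L * ((x - a) * (b - x))\<^sup>2 \<le> L * (b - a)\<^sup>2 * (x - b)\<^sup>2"
      using mult_left_mono[of "(b - x)\<^sup>2" "(b - a)\<^sup>2" "L * (x - a)\<^sup>2"]
        mult_left_mono[of "(x - a)\<^sup>2" "(b - a)\<^sup>2" "L * (b - x)\<^sup>2"] L
      by (simp_all add: power_mult_distrib mult_ac power2_commute[of x b])
  qed
  show thesis
  proof
    fix x
    show "\<bar>bump a b c p k x\<bar> \<le> L * (b - a)\<^sup>2 * (x - a)\<^sup>2"
    proof (cases "a < x \<and> x < b")
      case True
      then show ?thesis using *[of x] fin(1)[of x] by linarith
    qed (use L in \<open>auto simp: bump_def\<close>)
    show "\<bar>bump a b c p k x\<bar> \<le> L * (b - a)\<^sup>2 * (x - b)\<^sup>2"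
    proof (cases "a < x \<and> x < b")
      case True
      then show ?thesis using *[of x] fin(2)[of x] by linarith
    qed (use L in \<open>auto simp: bump_def\<close>)
  qed
qed

lemma DERIV_0_if_le_square:
  fixes f :: "real \<Rightarrow> real"
  assumes "\<And>x. \<bar>f x\<bar> \<le> K * (x - a)\<^sup>2"
  shows "(f has_real_derivative 0) (at a)"
proof -
  have f0: "f a = 0" using assms[of a] by simp
  have "((\<lambda>h. (f (a + h) - f a) / h) \<longlongrightarrow> 0) (at 0)"
  proof (rule Lim_null_comparison)
    show "\<forall>\<^sub>F h in at 0. norm ((f (a + h) - f a) / h) \<le> K * \<bar>h\<bar>"
    proof (rule eventually_at_topological[THEN iffD2], intro exI[of _ UNIV] conjI ballI impI)
      fix h :: real assume "h \<noteq> 0"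
      then show "norm ((f (a + h) - f a) / h) \<le> K * \<bar>h\<bar>"
        using assms[of "a + h"] f0
        by (simp add: divide_simps power2_eq_square mult.assoc)
    qed auto
    show "((\<lambda>h. K * \<bar>h\<bar>) \<longlongrightarrow> 0) (at 0)"
      by (auto intro!: tendsto_eq_intros)
  qed
  then show ?thesis
    by (simp add: DERIV_def)
qed

text \<open>
  The numerator over \<open>w\<^sup>k\<^sup>+\<^sup>2\<close> that the quotient and chain rules give.
\<close>

definition bump_deriv_poly :: "real \<Rightarrow> real \<Rightarrow> real \<Rightarrow> real poly \<Rightarrow> nat \<Rightarrow> real poly" where
  "bump_deriv_poly a b c p k =
     (let w = [:-a, 1:] * [:b, -1:] in pderiv p * w\<^sup>2 - of_nat k * p * pderiv w * w + smult c (p * pderiv w))"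

lemma DERIV_bump:
  assumes "c > 0"
  shows "(bump a b c p k has_real_derivative bump a b c (bump_deriv_poly a b c p k) (k + 2) x) (at x)"
proof -
  consider "a < x \<and> x < b" | "x = a \<or> x = b" | "x < a \<or> x > b" by linarith
  then show ?thesis
  proof cases
    case 1
    define w where "w x = (x - a) * (b - x)" for x :: real
    define W where "W = [:-a, 1:] * [:b, -1:]"
    have W: "poly W = w" by (auto simp: W_def w_def fun_eq_iff algebra_simps)
    have w0: "w x > 0" using 1 by (simp add: w_def)
    have dw: "(w has_real_derivative poly (pderiv W) x) (at x)"
      using poly_DERIV[of W x] by (simp add: W)
    have *: "((\<lambda>x. poly p x / w x ^ k * exp (- c / w x)) has_real_derivative
       ((poly (pderiv p) x * w x ^ k - poly p x * (real k * (w x ^ (k - 1) * poly (pderiv W) x))) / (w x ^ k * w x ^ k)) * exp (- c / w x)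
        + (exp (- c / w x) * (c * poly (pderiv W) x / (w x * w x))) * (poly p x / w x ^ k)) (at x)"
      by (rule derivative_eq_intros dw poly_DERIV refl | use w0 in \<open>simp add: mult_ac\<close>)+
    have eq: "((poly (pderiv p) x * w x ^ k - poly p x * (real k * (w x ^ (k - 1) * poly (pderiv W) x))) / (w x ^ k * w x ^ k)) * exp (- c / w x)
        + (exp (- c / w x) * (c * poly (pderiv W) x / (w x * w x))) * (poly p x / w x ^ k)
        = bump a b c (bump_deriv_poly a b c p k) (k + 2) x"
    proof -
      have b: "bump a b c (bump_deriv_poly a b c p k) (k + 2) x
        = (poly (pderiv p) x * (w x)\<^sup>2 - real k * poly p x * poly (pderiv W) x * w x + c * (poly p x * poly (pderiv W) x)) / w x ^ (k + 2) * exp (- c / w x)"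
        using 1 unfolding bump_def bump_deriv_poly_def Let_def W_def[symmetric]
        by (simp add: W) (simp add: w_def)
      have pk: "real k * w x ^ (k - 1) = real k * w x ^ k / w x"
        using w0 by (cases k) (auto simp: field_simps)
      have "poly p x * (real k * (w x ^ (k - 1) * poly (pderiv W) x)) = poly p x * (real k * w x ^ (k - 1)) * poly (pderiv W) x"
        by simp
      then have "(poly (pderiv p) x * w x ^ k - poly p x * (real k * (w x ^ (k - 1) * poly (pderiv W) x)))
         = w x ^ k * (poly (pderiv p) x - poly p x * (real k / w x * poly (pderiv W) x))"
        unfolding pk by (simp add: algebra_simps)
      then show ?thesis
        unfolding b using w0 by (simp add: field_simps power2_eq_square)
    qed
    show ?thesis
    proof (rule has_field_derivative_transform_within_open[of _ _ _ "{a<..<b}"])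
      show "((\<lambda>x. poly p x / w x ^ k * exp (- c / w x)) has_real_derivative bump a b c (bump_deriv_poly a b c p k) (k + 2) x) (at x)"
        using * eq by simp
    qed (use 1 in \<open>auto simp: bump_def w_def\<close>)
  next
    case 2
    obtain K where "\<And>x. \<bar>bump a b c p k x\<bar> \<le> K * (x - a)\<^sup>2" "\<And>x. \<bar>bump a b c p k x\<bar> \<le> K * (x - b)\<^sup>2"
      using bump_le_square[OF assms] by metis
    with 2 have "(bump a b c p k has_real_derivative 0) (at x)"
      using DERIV_0_if_le_square[of "bump a b c p k"] by blast
    then show ?thesis using 2 by (auto simp: bump_def)
  next
    case 3
    have "((\<lambda>_. 0) has_real_derivative 0) (at x)" by simp
    then have "(bump a b c p k has_real_derivative 0) (at x)"
      by (rule has_field_derivative_transform_within_open[of _ _ _ "{..<a} \<union> {b<..}"])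
        (use 3 in \<open>auto simp: bump_def\<close>)
    then show ?thesis using 3 by (auto simp: bump_def)
  qed
qed

lemma partial_deriv_on_UNIV:
  assumes "(f has_derivative D) (at x)"
  shows "partial_deriv_on UNIV i f x = D (axis i 1)"
  using frechet_derivative_at[OF assms] by (simp add: partial_deriv_on_def)

text \<open>
  Products over the coordinates, with independent prefactors in each coordinate so that the family is
  closed under partial derivatives.
\<close>

definition box_bump :: "(real^'d) \<Rightarrow> real^'d \<Rightarrow> real \<Rightarrow> ('d \<Rightarrow> real poly) \<Rightarrow> ('d \<Rightarrow> nat) \<Rightarrow> real^'d \<Rightarrow> real" where
  "box_bump a b c p k x = (\<Prod>i\<in>UNIV. bump (a $ i) (b $ i) c (p i) (k i) (x $ i))"

lemma box_bump_deriv: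
  assumes "c > 0"
  shows "box_bump a b c p k differentiable at x"
    "partial_deriv_on UNIV i (box_bump a b c p k) x =
       box_bump a b c (p(i := bump_deriv_poly (a $ i) (b $ i) c (p i) (k i))) (k(i := k i + 2)) x"
proof -
  let ?q = "\<lambda>i. bump_deriv_poly (a $ i) (b $ i) c (p i) (k i)"
  let ?h = "\<lambda>i. bump (a $ i) (b $ i) c (p i) (k i)"
  let ?h' = "\<lambda>i. bump (a $ i) (b $ i) c (?q i) (k i + 2)"
  have "((\<lambda>x. ?h i (x $ i)) has_derivative (\<lambda>y. ?h' i (x $ i) * (y $ i))) (at x)" for i
  proof -
    have "(?h i has_derivative (*) (?h' i (x $ i))) (at (x $ i))"
      using DERIV_bump[OF assms] by (simp add: has_field_derivative_def)
    moreover have "((\<lambda>x::real^'a. x $ i) has_derivative (\<lambda>y. y $ i)) (at x)"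
      by (rule bounded_linear_imp_has_derivative) (rule bounded_linear_vec_nth)
    ultimately show ?thesis by (rule has_derivative_compose[rotated])
  qed
  then have D: "(box_bump a b c p k has_derivative
      (\<lambda>y. \<Sum>i\<in>UNIV. (?h' i (x $ i) * (y $ i)) * (\<Prod>j\<in>UNIV - {i}. ?h j (x $ j)))) (at x)"
    unfolding box_bump_def[abs_def] by (rule has_derivative_prod)
  then show "box_bump a b c p k differentiable at x" by (auto simp: differentiable_def)
  have "partial_deriv_on UNIV i (box_bump a b c p k) x = 
     (\<Sum>j\<in>UNIV. (?h' j (x $ j) * (axis i 1 $ j)) * (\<Prod>l\<in>UNIV - {j}. ?h l (x $ l)))"
    by (rule partial_deriv_on_UNIV[OF D])
  also have "\<dots> = (\<Sum>j\<in>UNIV. if j = i then ?h' i (x $ i) * (\<Prod>l\<in>UNIV - {i}. ?h l (x $ l)) else 0)"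
    by (intro sum.cong) (auto simp: axis_def)
  also have "\<dots> = ?h' i (x $ i) * (\<Prod>l\<in>UNIV - {i}. ?h l (x $ l))" by simp
  also have "\<dots> = box_bump a b c (p(i := ?q i)) (k(i := k i + 2)) x"
    unfolding box_bump_def by (subst (2) prod.remove[of _ i]) (auto intro!: prod.cong)
  finally show "partial_deriv_on UNIV i (box_bump a b c p k) x = box_bump a b c (p(i := ?q i)) (k(i := k i + 2)) x" .
qed

lemma test_function_box_bump:
  assumes "c > 0"
  shows "test_function (box_bump a b c p k)"
proof -
  have "Ck_on n UNIV (box_bump a b c p k)" for n
  proof (induction n arbitrary: p k)
    case 0
    show ?case
      using box_bump_deriv(1)[OF assms] 
      by (auto intro!: continuous_at_imp_continuous_on differentiable_imp_continuous_within)
  next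
    case (Suc n)
    have "partial_deriv_on UNIV i (box_bump a b c p k) =
       box_bump a b c (p(i := bump_deriv_poly (a $ i) (b $ i) c (p i) (k i))) (k(i := k i + 2))" for i
      using box_bump_deriv(2)[OF assms] by blast
    then show ?case
      using Suc box_bump_deriv(1)[OF assms] by (auto simp: differentiable_on_def)
  qed
  moreover have "compact (closure {x. box_bump a b c p k x \<noteq> 0})"
  proof -
    have "{x. box_bump a b c p k x \<noteq> 0} \<subseteq> cbox a b"
    proof clarify
      fix x assume "box_bump a b c p k x \<noteq> 0"
      then have "bump (a $ i) (b $ i) c (p i) (k i) (x $ i) \<noteq> 0" for i
        by (auto simp: box_bump_def)
      then show "x \<in> cbox a b"
        unfolding mem_box_cart bump_def by (meson less_imp_le)
    qed
    then have "bounded {x. box_bump a b c p k x \<noteq> 0}" using bounded_cbox bounded_subset by blast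
    then show ?thesis by simp
  qed
  ultimately show ?thesis by (simp add: test_function_def)
qed

text \<open>
  The exponent \<open>c\<close> only shapes the flanks: as it tends to \<open>0\<close> the bump fills its box.
\<close>

lemma box_bump_tendsto_indicator:
  "(\<lambda>n. box_bump a b (1 / Suc n) (\<lambda>_. 1) (\<lambda>_. 0) x) \<longlonglongrightarrow> indicator (box a b) x"
proof (cases "x \<in> box a b")
  case True
  have "(\<lambda>n. bump (a $ i) (b $ i) (1 / Suc n) 1 0 (x $ i)) \<longlonglongrightarrow> 1" for i
  proof -
    let ?w = "(x $ i - a $ i) * (b $ i - x $ i)"
    have w: "?w \<noteq> 0" using True by (auto simp: mem_box_cart) (metis less_irrefl)+
    have "(\<lambda>n. exp (- (1 / real (Suc n)) / ?w)) \<longlonglongrightarrow> exp (- 0 / ?w)"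
      using w by (intro tendsto_intros LIMSEQ_inverse_real_of_nat[unfolded inverse_eq_divide])
    then show ?thesis using True by (auto simp: mem_box_cart bump_def)
  qed
  then have "(\<lambda>n. box_bump a b (1 / Suc n) (\<lambda>_. 1) (\<lambda>_. 0) x) \<longlonglongrightarrow> (\<Prod>i\<in>(UNIV :: 'a set). 1)"
    unfolding box_bump_def by (intro tendsto_prod) auto
  then show ?thesis using True by simp
next
  case False
  then obtain i where "\<not> (a $ i < x $ i \<and> x $ i < b $ i)" by (auto simp: mem_box_cart)
  then have "box_bump a b c (\<lambda>_. 1) (\<lambda>_. 0) x = 0" for c
    unfolding box_bump_def by (intro prod_zero) (auto simp: bump_def intro!: bexI[of _ i])
  then show ?thesis using False by simp
qed

lemma box_bump_bound:
  assumes "c > 0"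
  shows "\<bar>box_bump a b c (\<lambda>_. 1) (\<lambda>_. 0) x\<bar> \<le> indicator (cbox a b) x"
proof (cases "x \<in> cbox a b")
  case True
  have "\<bar>box_bump a b c (\<lambda>_. 1) (\<lambda>_. 0) x\<bar> = (\<Prod>i\<in>UNIV. \<bar>bump (a $ i) (b $ i) c 1 0 (x $ i)\<bar>)"
    by (simp add: box_bump_def abs_prod)
  also have "\<dots> \<le> 1"
    using assms by (intro prod_le_1) (auto simp: bump_def divide_nonneg_pos)
  finally show ?thesis using True by simp
next
  case False
  then have "x \<notin> box a b" using box_subset_cbox[of a b] by blast
  then obtain i where "\<not> (a $ i < x $ i \<and> x $ i < b $ i)" by (auto simp: mem_box_cart)
  then have "box_bump a b c (\<lambda>_. 1) (\<lambda>_. 0) x = 0" for c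
    unfolding box_bump_def by (intro prod_zero) (auto simp: bump_def intro!: bexI[of _ i])
  then show ?thesis using False by simp
qed

text \<open>
  Bumps converge boundedly to the indicator of a box, so \<open>u\<close> integrates to zero over every box, and
  Lebesgue's differentiation theorem recovers \<open>u\<close> from these integrals.
\<close>

theorem fundamental_lemma:
  fixes u :: "real^'d \<Rightarrow> real"
  assumes int: "\<And>a b. set_integrable lebesgue (cbox a b) u"
    and 0: "\<And>\<psi>. test_function \<psi> \<Longrightarrow> (LINT x|lebesgue. u x * \<psi> x) = 0"
  shows "AE x in lebesgue. u x = 0"
proof -
  have box0: "integral (cbox a b) u = 0" for a b
  proof -
    let ?\<psi> = "\<lambda>n x. box_bump a b (1 / Suc n) (\<lambda>_. 1) (\<lambda>_. 0) x"
    have m[measurable]: "?\<psi> n \<in> borel_measurable borel" for n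
    proof -
      have "test_function (?\<psi> n)" by (rule test_function_box_bump) simp
      then have "Ck_on 0 UNIV (?\<psi> n)" unfolding test_function_def by blast
      then show ?thesis by (intro borel_measurable_continuous_onI) simp
    qed
    have ind: "(\<lambda>x. indicator (cbox a b) x * u x) \<in> borel_measurable lebesgue"
      using int[of a b] by (auto simp: set_integrable_def)
    have e: "u x * ?\<psi> n x = (indicator (cbox a b) x * u x) * ?\<psi> n x" for n x
      using box_bump_bound[of "1 / Suc n" a b x] by (cases "x \<in> cbox a b") auto
    have "(\<lambda>n. LINT x|lebesgue. u x * ?\<psi> n x) \<longlonglongrightarrow> (LINT x|lebesgue. (indicator (cbox a b) x * u x) * indicator (box a b) x)"
      unfolding e
    proof (rule integral_dominated_convergence[where w = "\<lambda>x. \<bar>indicator (cbox a b) x * u x\<bar>"])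
      show "integrable lebesgue (\<lambda>x. \<bar>indicator (cbox a b) x * u x\<bar>)"
        using int[of a b] by (auto simp: set_integrable_def)
      have "(\<lambda>x. ?\<psi> n x) \<in> borel_measurable lebesgue" for n 
        by (intro measurable_completion) (use m in simp)
      then show "(\<lambda>x. indicator (cbox a b) x * u x * ?\<psi> n x) \<in> borel_measurable lebesgue" for n
        using borel_measurable_times[OF ind] by blast
      show "(\<lambda>x. indicator (cbox a b) x * u x * indicator (box a b) x) \<in> borel_measurable lebesgue"
        by (intro borel_measurable_times[OF ind] borel_measurable_indicator) simp
      show "AE x in lebesgue. (\<lambda>n. indicator (cbox a b) x * u x * ?\<psi> n x) \<longlonglongrightarrow> indicator (cbox a b) x * u x * indicator (box a b) x"
        by (intro AE_I2 tendsto_mult_left box_bump_tendsto_indicator)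
      show "AE x in lebesgue. norm (indicator (cbox a b) x * u x * ?\<psi> n x) \<le> \<bar>indicator (cbox a b) x * u x\<bar>" for n
      proof (rule AE_I2)
        fix x
        have "\<bar>?\<psi> n x\<bar> \<le> 1" using box_bump_bound[of "1 / Suc n" a b x] by (auto split: split_indicator_asm)
        then show "norm (indicator (cbox a b) x * u x * ?\<psi> n x) \<le> \<bar>indicator (cbox a b) x * u x\<bar>"
          unfolding abs_mult real_norm_def by (intro mult_left_le) auto
      qed
    qed
    moreover have "(LINT x|lebesgue. u x * ?\<psi> n x) = 0" for n
      by (intro 0 test_function_box_bump) auto
    ultimately have "(LINT x|lebesgue. (indicator (cbox a b) x * u x) * indicator (box a b) x) = 0"
      by (simp add: LIMSEQ_const_iff)
    also have "(LINT x|lebesgue. (indicator (cbox a b) x * u x) * indicator (box a b) x) = (LINT x:box a b|lebesgue. u x)"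
      unfolding set_lebesgue_integral_def
      by (intro Bochner_Integration.integral_cong refl) (use box_subset_cbox[of a b] in \<open>auto split: split_indicator\<close>)
    also have "\<dots> = integral (box a b) u"
      by (intro set_lebesgue_integral_eq_integral set_integrable_subset[OF int[of a b]]) (auto simp: box_subset_cbox)
    also have "\<dots> = integral (cbox a b) u" 
      by (simp add: integral_open_interval)
    finally show ?thesis .
  qed
  have "u integrable_on cbox a b" for a b
    using int[of a b] set_lebesgue_integral_eq_integral(1) by blast
  then obtain N where N: "negligible N"
    "\<And>x e. \<lbrakk>x \<notin> N; 0 < e\<rbrakk> \<Longrightarrow> \<exists>d>0. \<forall>h. 0 < h \<and> h < d \<longrightarrow>
        norm(integral (cbox x (x + h *\<^sub>R One)) u /\<^sub>R h ^ DIM(real^'d) - u x) < e"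
    using integrable_ccontinuous_explicit by blast
  have "u x = 0" if x: "x \<notin> N" for x
  proof (rule ccontr)
    assume "u x \<noteq> 0"
    then have "\<exists>d>0. \<forall>h::real. 0 < h \<and> h < d \<longrightarrow> \<bar>u x\<bar> < \<bar>u x\<bar>"
      using N(2)[OF x, of "\<bar>u x\<bar>"] by (simp add: box0)
    then show False by (meson dense less_irrefl)
  qed
  moreover have "N \<in> null_sets lebesgue" using N(1) negligible_iff_null_sets by blast
  ultimately show ?thesis by (intro AE_I'[of N]) auto
qed

section \<open>Convolution of nonnegative functions\<close>

lemma nn_integral_lborel_affine:
  fixes f :: "'a::euclidean_space \<Rightarrow> ennreal"
  assumes [measurable]: "f \<in> borel_measurable borel" and "c \<noteq> 0"
  shows "(\<integral>\<^sup>+x. f x \<partial>lborel) = ennreal (\<bar>c\<bar> ^ DIM('a)) * (\<integral>\<^sup>+x. f (t + c *\<^sub>R x) \<partial>lborel)"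
  by (subst lborel_affine[OF \<open>c \<noteq> 0\<close>, of t])
    (simp add: nn_integral_density nn_integral_distr nn_integral_cmult)

lemma distr_lborel_reflect: "distr lborel borel (\<lambda>x. t - x) = (lborel :: 'a::euclidean_space measure)"
  using lborel_affine[of "-1" t] by (simp add: density_1)

lemma distr_lborel_translate: "distr lborel borel (\<lambda>x. t + x) = (lborel :: 'a::euclidean_space measure)"
  using lborel_affine[of 1 t] by (simp add: density_1)

lemma nn_integral_lborel_reflect:
  fixes f :: "'a::euclidean_space \<Rightarrow> ennreal"
  assumes [measurable]: "f \<in> borel_measurable borel"
  shows "(\<integral>\<^sup>+x. f (t - x) \<partial>lborel) = (\<integral>\<^sup>+x. f x \<partial>lborel)"
  using nn_integral_lborel_affine[OF assms, of "-1" t] by simp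

lemma nn_integral_lborel_translate:
  fixes f :: "'a::euclidean_space \<Rightarrow> ennreal"
  assumes [measurable]: "f \<in> borel_measurable borel"
  shows "(\<integral>\<^sup>+x. f (t + x) \<partial>lborel) = (\<integral>\<^sup>+x. f x \<partial>lborel)"
    "(\<integral>\<^sup>+x. f (x - t) \<partial>lborel) = (\<integral>\<^sup>+x. f x \<partial>lborel)"
  using nn_integral_lborel_affine[OF assms, of "1" t] nn_integral_lborel_affine[OF assms, of "1" "-t"] by simp_all

lemma integral_lborel_reflect:
  fixes f :: "'a::euclidean_space \<Rightarrow> real"
  assumes [measurable]: "f \<in> borel_measurable borel"
  shows "(LINT x|lborel. f (t - x)) = (LINT x|lborel. f x)"
    "integrable lborel (\<lambda>x. f (t - x)) \<longleftrightarrow> integrable lborel f"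
proof -
  have "integral\<^sup>L (distr lborel borel (\<lambda>x. t - x)) f = (LINT x|lborel. f (t - x))"
    by (rule integral_distr) auto
  then show "(LINT x|lborel. f (t - x)) = (LINT x|lborel. f x)"
    unfolding distr_lborel_reflect by simp
  have "integrable (distr lborel borel (\<lambda>x. t - x)) f = integrable lborel (\<lambda>x. f (t - x))"
    by (rule integrable_distr_eq) auto
  then show "integrable lborel (\<lambda>x. f (t - x)) \<longleftrightarrow> integrable lborel f"
    unfolding distr_lborel_reflect by simp
qed

lemma integral_lborel_translate:
  fixes f :: "'a::euclidean_space \<Rightarrow> real"
  assumes [measurable]: "f \<in> borel_measurable borel"
  shows "(LINT x|lborel. f (t + x)) = (LINT x|lborel. f x)"
    "integrable lborel (\<lambda>x. f (t + x)) \<longleftrightarrow> integrable lborel f"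
proof -
  have "integral\<^sup>L (distr lborel borel (\<lambda>x. t + x)) f = (LINT x|lborel. f (t + x))"
    by (rule integral_distr) auto
  then show "(LINT x|lborel. f (t + x)) = (LINT x|lborel. f x)"
    unfolding distr_lborel_translate by simp
  have "integrable (distr lborel borel (\<lambda>x. t + x)) f = integrable lborel (\<lambda>x. f (t + x))"
    by (rule integrable_distr_eq) auto
  then show "integrable lborel (\<lambda>x. f (t + x)) \<longleftrightarrow> integrable lborel f"
    unfolding distr_lborel_translate by simp
qed

text \<open>
  Convolution with values in \<open>[0, \<infinity>]\<close>: Tonelli's theorem applies to it without any integrability
  condition, so the estimates come first and justify the use of signed integrals later.
\<close>

definition nconv :: "('a::euclidean_space \<Rightarrow> ennreal) \<Rightarrow> ('a \<Rightarrow> ennreal) \<Rightarrow> 'a \<Rightarrow> ennreal" where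
  "nconv k f x = (\<integral>\<^sup>+y. k (x - y) * f y \<partial>lborel)"

lemma borel_measurable_nconv [measurable]:
  assumes [measurable]: "k \<in> borel_measurable borel" "f \<in> borel_measurable borel"
  shows "nconv k f \<in> borel_measurable borel"
  unfolding nconv_def[abs_def] by measurable

lemma nconv_commute:
  assumes [measurable]: "k \<in> borel_measurable borel" "f \<in> borel_measurable borel"
  shows "nconv k f = nconv f k"
proof
  fix x
  show "nconv k f x = nconv f k x"
    using nn_integral_lborel_reflect[of "\<lambda>y. k y * f (x - y)" x]
    by (simp add: nconv_def mult.commute)
qed

lemma nn_integral_nconv:
  assumes [measurable]: "k \<in> borel_measurable borel" "f \<in> borel_measurable borel"
  shows "(\<integral>\<^sup>+x. nconv k f x \<partial>lborel) = (\<integral>\<^sup>+x. k x \<partial>lborel) * (\<integral>\<^sup>+x. f x \<partial>lborel)"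
proof -
  have "(\<integral>\<^sup>+x. nconv k f x \<partial>lborel) = (\<integral>\<^sup>+y. \<integral>\<^sup>+x. k (x - y) * f y \<partial>lborel \<partial>lborel)"
    unfolding nconv_def by (rule lborel_pair.Fubini') measurable
  also have "\<dots> = (\<integral>\<^sup>+y. (\<integral>\<^sup>+x. k x \<partial>lborel) * f y \<partial>lborel)"
    by (simp add: nn_integral_multc nn_integral_lborel_translate)
  also have "\<dots> = (\<integral>\<^sup>+x. k x \<partial>lborel) * (\<integral>\<^sup>+x. f x \<partial>lborel)"
    by (simp add: nn_integral_cmult)
  finally show ?thesis .
qed

text \<open>
  The Cauchy-Schwarz inequality for the measure with density \<open>k (x - \<cdot>)\<close>.
\<close>

lemma nconv_square_le:
  assumes [measurable]: "k \<in> borel_measurable borel" "f \<in> borel_measurable borel"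
  shows "(nconv k f x)\<^sup>2 \<le> (\<integral>\<^sup>+y. k y \<partial>lborel) * nconv k (\<lambda>y. (f y)\<^sup>2) x"
proof -
  let ?M = "density lborel (\<lambda>y. k (x - y))"
  have "(\<integral>\<^sup>+y. 1 * f y \<partial>?M)\<^sup>2 \<le> (\<integral>\<^sup>+y. 1\<^sup>2 \<partial>?M) * (\<integral>\<^sup>+y. (f y)\<^sup>2 \<partial>?M)"
    by (rule Cauchy_Schwarz_nn_integral) auto
  moreover have "(\<integral>\<^sup>+y. 1\<^sup>2 \<partial>?M) = (\<integral>\<^sup>+y. k (x - y) * 1 \<partial>lborel)"
    by (subst nn_integral_density) auto
  ultimately show ?thesis
    by (simp add: nn_integral_density nconv_def nn_integral_lborel_reflect)
qed

lemma nn_integral_nconv_square_le: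
  assumes [measurable]: "k \<in> borel_measurable borel" "f \<in> borel_measurable borel"
  shows "(\<integral>\<^sup>+x. (nconv k f x)\<^sup>2 \<partial>lborel) \<le> (\<integral>\<^sup>+y. k y \<partial>lborel)\<^sup>2 * (\<integral>\<^sup>+y. (f y)\<^sup>2 \<partial>lborel)"
proof -
  have "(\<integral>\<^sup>+x. (nconv k f x)\<^sup>2 \<partial>lborel) \<le> (\<integral>\<^sup>+x. (\<integral>\<^sup>+y. k y \<partial>lborel) * nconv k (\<lambda>y. (f y)\<^sup>2) x \<partial>lborel)"
    by (intro nn_integral_mono nconv_square_le) auto
  also have "\<dots> = (\<integral>\<^sup>+y. k y \<partial>lborel)\<^sup>2 * (\<integral>\<^sup>+y. (f y)\<^sup>2 \<partial>lborel)"
    by (simp add: nn_integral_cmult nn_integral_nconv power2_eq_square mult.assoc)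
  finally show ?thesis .
qed

lemma nconv_assoc:
  fixes k :: "'a::euclidean_space \<Rightarrow> ennreal"
  assumes [measurable]: "k \<in> borel_measurable borel" "l \<in> borel_measurable borel" "f \<in> borel_measurable borel"
  shows "nconv k (nconv l f) = nconv (nconv k l) f"
proof
  fix x
  have "nconv k (nconv l f) x = (\<integral>\<^sup>+y. \<integral>\<^sup>+z. k (x - y) * (l (y - z) * f z) \<partial>lborel \<partial>lborel)"
    unfolding nconv_def by (simp add: nn_integral_cmult)
  also have "\<dots> = (\<integral>\<^sup>+z. \<integral>\<^sup>+y. k (x - y) * (l (y - z) * f z) \<partial>lborel \<partial>lborel)"
    by (rule lborel_pair.Fubini') measurable
  also have "\<dots> = (\<integral>\<^sup>+z. (\<integral>\<^sup>+y. k (x - y) * l (y - z) \<partial>lborel) * f z \<partial>lborel)"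
    by (simp add: nn_integral_multc flip: mult.assoc)
  also have "\<dots> = nconv (nconv k l) f x"
  proof -
    have "(\<integral>\<^sup>+y. k (x - y) * l (y - z) \<partial>lborel) = nconv k l (x - z)" for z
      using nn_integral_lborel_translate(1)[of "\<lambda>y. k (x - y) * l (y - z)" z]
      by (simp add: nconv_def algebra_simps)
    then show ?thesis by (simp add: nconv_def)
  qed
  finally show "nconv k (nconv l f) x = nconv (nconv k l) f x" .
qed

lemma nconv_symmetric:
  fixes k :: "'a::euclidean_space \<Rightarrow> ennreal"
  assumes [measurable]: "k \<in> borel_measurable borel" "f \<in> borel_measurable borel" "g \<in> borel_measurable borel"
    and even: "\<And>x. k (- x) = k x"
  shows "(\<integral>\<^sup>+x. f x * nconv k g x \<partial>lborel) = (\<integral>\<^sup>+x. nconv k f x * g x \<partial>lborel)"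
proof -
  have e: "k (y - x) = k (x - y)" for x y using even[of "x - y"] by simp
  have "(\<integral>\<^sup>+x. f x * nconv k g x \<partial>lborel) = (\<integral>\<^sup>+x. \<integral>\<^sup>+y. f x * (k (x - y) * g y) \<partial>lborel \<partial>lborel)"
    unfolding nconv_def by (simp add: nn_integral_cmult)
  also have "\<dots> = (\<integral>\<^sup>+y. \<integral>\<^sup>+x. f x * (k (x - y) * g y) \<partial>lborel \<partial>lborel)"
    by (rule lborel_pair.Fubini') measurable
  also have "\<dots> = (\<integral>\<^sup>+y. \<integral>\<^sup>+x. (k (y - x) * f x) * g y \<partial>lborel \<partial>lborel)"
    by (intro nn_integral_cong) (simp add: e mult_ac)
  also have "\<dots> = (\<integral>\<^sup>+y. nconv k f y * g y \<partial>lborel)"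
    unfolding nconv_def by (simp add: nn_integral_multc)
  finally show ?thesis .
qed

text \<open>
  The transposition rule for signed kernels.  Finiteness of the corresponding integral of absolute
  values is always obtained from a bound on \<open>nconv\<close>.
\<close>

lemma integral_kernel_swap:
  fixes F r h :: "'a::euclidean_space \<Rightarrow> real"
  assumes [measurable]: "F \<in> borel_measurable borel" "r \<in> borel_measurable borel" "h \<in> borel_measurable borel"
    and fin: "(\<integral>\<^sup>+x. ennreal \<bar>F x\<bar> * nconv (\<lambda>x. ennreal \<bar>r x\<bar>) (\<lambda>x. ennreal \<bar>h x\<bar>) x \<partial>lborel) < \<infinity>"
  shows "integrable lborel (\<lambda>x. F x * (LINT y|lborel. r (x - y) * h y))"
    "(LINT x|lborel. F x * (LINT y|lborel. r (x - y) * h y)) = (LINT y|lborel. (LINT x|lborel. F x * r (x - y)) * h y)"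
proof -
  have "(\<integral>\<^sup>+x. \<integral>\<^sup>+y. ennreal \<bar>F x * r (x - y) * h y\<bar> \<partial>lborel \<partial>lborel) < \<infinity>"
    using fin by (simp add: nconv_def abs_mult ennreal_mult mult.assoc flip: nn_integral_cmult)
  then have "integrable (lborel \<Otimes>\<^sub>M lborel) (\<lambda>(x, y). F x * r (x - y) * h y)"
    by (subst integrable_iff_bounded) (simp add: lborel.nn_integral_fst[symmetric] split_beta')
  note * = this
  from lborel_pair.integrable_fst'[OF *]
  show "integrable lborel (\<lambda>x. F x * (LINT y|lborel. r (x - y) * h y))"
    by (simp add: mult.assoc)
  show "(LINT x|lborel. F x * (LINT y|lborel. r (x - y) * h y)) = (LINT y|lborel. (LINT x|lborel. F x * r (x - y)) * h y)"
    using lborel_pair.Fubini_integral[OF *] by (simp add: mult.assoc flip: integral_mult_left_zero)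
qed

lemma ennreal_le_if_square_le:
  fixes a b :: ennreal
  assumes "a\<^sup>2 \<le> b\<^sup>2"
  shows "a \<le> b"
proof (cases a; cases b)
  fix r s assume "0 \<le> r" "a = ennreal r" "0 \<le> s" "b = ennreal s"
  then show ?thesis using assms by (auto simp: ennreal_power intro: power2_le_imp_le)
next
  fix r assume "0 \<le> r" "a = top" "b = ennreal r"
  then show ?thesis using assms by (simp add: ennreal_power top_unique)
qed auto

lemma Cauchy_Schwarz_integral:
  fixes f g :: "'a \<Rightarrow> real"
  assumes [measurable]: "f \<in> borel_measurable M" "g \<in> borel_measurable M"
    and f: "integrable M (\<lambda>x. (f x)\<^sup>2)" and g: "integrable M (\<lambda>x. (g x)\<^sup>2)"
  shows "integrable M (\<lambda>x. f x * g x)"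
    "(LINT x|M. \<bar>f x * g x\<bar>) \<le> sqrt (LINT x|M. (f x)\<^sup>2) * sqrt (LINT x|M. (g x)\<^sup>2)"
proof -
  let ?a = "LINT x|M. (f x)\<^sup>2" and ?b = "LINT x|M. (g x)\<^sup>2"
  have "(\<integral>\<^sup>+x. ennreal \<bar>f x\<bar> * ennreal \<bar>g x\<bar> \<partial>M)\<^sup>2 \<le> (\<integral>\<^sup>+x. (ennreal \<bar>f x\<bar>)\<^sup>2 \<partial>M) * (\<integral>\<^sup>+x. (ennreal \<bar>g x\<bar>)\<^sup>2 \<partial>M)"
    by (intro Cauchy_Schwarz_nn_integral) auto
  also have "\<dots> = ennreal ?a * ennreal ?b"
    using f g by (simp add: ennreal_power nn_integral_eq_integral)
  also have "\<dots> = ennreal (sqrt ?a * sqrt ?b) ^ 2"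
    by (simp add: ennreal_power power_mult_distrib ennreal_mult)
  finally have "(\<integral>\<^sup>+x. ennreal \<bar>f x\<bar> * ennreal \<bar>g x\<bar> \<partial>M)\<^sup>2 \<le> ennreal (sqrt ?a * sqrt ?b) ^ 2" .
  then have *: "(\<integral>\<^sup>+x. ennreal \<bar>f x * g x\<bar> \<partial>M) \<le> ennreal (sqrt ?a * sqrt ?b)"
    unfolding abs_mult by (subst ennreal_mult) (auto intro: ennreal_le_if_square_le)
  then have fin: "(\<integral>\<^sup>+x. ennreal \<bar>f x * g x\<bar> \<partial>M) < \<infinity>"
    by (rule le_less_trans) simp
  then show i: "integrable M (\<lambda>x. f x * g x)"
    by (intro integrableI_bounded) auto
  then show "(LINT x|M. \<bar>f x * g x\<bar>) \<le> sqrt ?a * sqrt ?b"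
    using * by (simp add: nn_integral_eq_integral) 
qed

section \<open>The heat kernel and its Laplace transforms\<close>

lemma integral_lborel_affine:
  fixes f :: "'a::euclidean_space \<Rightarrow> real"
  assumes [measurable]: "f \<in> borel_measurable borel" and "c \<noteq> 0"
  shows "(LINT x|lborel. f x) = \<bar>c\<bar> ^ DIM('a) * (LINT x|lborel. f (t + c *\<^sub>R x))"
  by (subst lborel_affine[OF \<open>c \<noteq> 0\<close>, of t])
    (simp add: integral_density integral_distr)

text \<open>
  The kernel of \<open>e\<^sup>t\<^sup>\<Delta>\<close>: the Gaussian of covariance \<open>2t\<close> times the identity.
\<close>

definition heat :: "real \<Rightarrow> 'a::euclidean_space \<Rightarrow> real" where
  "heat t x = (4 * pi * t) powr (- real DIM('a) / 2) * exp (- (norm x)\<^sup>2 / (4 * t))"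

lemma heat_nonneg [simp]: "heat t x \<ge> 0"
  by (simp add: heat_def)

lemma heat_minus [simp]: "heat t (- x) = heat t x"
  by (simp add: heat_def)

lemma borel_measurable_heat [measurable]:
  assumes [measurable]: "f \<in> borel_measurable M" "g \<in> borel_measurable M"
  shows "(\<lambda>x. heat (f x) (g x :: 'a::euclidean_space)) \<in> borel_measurable M"
  unfolding heat_def by measurable

lemma heat_le: "t > 0 \<Longrightarrow> heat t (x::'a::euclidean_space) \<le> (4 * pi * t) powr (- real DIM('a) / 2)"
  unfolding heat_def by (rule mult_left_le) auto

lemma heat_eq_prod_normal_density:
  fixes x :: "'a::euclidean_space"
  assumes "t > 0"
  shows "heat t x = (\<Prod>b\<in>Basis. normal_density 0 (sqrt (2 * t)) (x \<bullet> b))"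
proof -
  have "(\<Prod>b\<in>(Basis::'a set). normal_density 0 (sqrt (2 * t)) (x \<bullet> b))
    = (1 / sqrt (4 * pi * t)) ^ DIM('a) * exp (\<Sum>b\<in>Basis. - (x \<bullet> b)\<^sup>2 / (4 * t))"
    using assms unfolding normal_density_def by (simp add: prod.distrib exp_sum prod_dividef mult_ac power_divide)
  also have "(\<Sum>b\<in>Basis. - (x \<bullet> b)\<^sup>2 / (4 * t)) = - (norm x)\<^sup>2 / (4 * t)"
    unfolding power2_norm_eq_inner by (subst euclidean_inner) (simp add: power2_eq_square sum_negf sum_divide_distrib)
  also have "(1 / sqrt (4 * pi * t)) ^ DIM('a) = (4 * pi * t) powr (- real DIM('a) / 2)"
  proof -
    have "(1 / sqrt (4 * pi * t)) = (4 * pi * t) powr (- 1 / 2)"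
      using assms by (simp add: powr_half_sqrt powr_minus_divide)
    then show ?thesis using assms by (simp add: powr_powr flip: powr_realpow)
  qed
  finally show ?thesis by (simp add: heat_def)
qed

lemma nn_integral_heat:
  assumes "t > 0"
  shows "(\<integral>\<^sup>+x. ennreal (heat t x) \<partial>(lborel :: 'a::euclidean_space measure)) = 1"
proof -
  have "(\<integral>\<^sup>+x. ennreal (heat t x) \<partial>(lborel :: 'a measure))
     = (\<integral>\<^sup>+x. (\<Prod>b\<in>Basis. ennreal (normal_density 0 (sqrt (2 * t)) (x \<bullet> b))) \<partial>(lborel :: 'a measure))"
    using assms by (intro nn_integral_cong) (simp add: heat_eq_prod_normal_density prod_ennreal)
  also have "\<dots> = (\<Prod>b\<in>(Basis::'a set). \<integral>\<^sup>+x. ennreal (normal_density 0 (sqrt (2 * t)) x) \<partial>lborel)"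
    by (rule nn_integral_lborel_prod) auto
  also have "(\<integral>\<^sup>+x. ennreal (normal_density 0 (sqrt (2 * t)) x) \<partial>lborel) = 1"
    using assms by (subst nn_integral_eq_integral) auto
  finally show ?thesis by simp
qed

text \<open>
  Completing the square; integrating over \<open>y\<close> then yields the semigroup law.
\<close>

lemma heat_mult_heat:
  fixes x y :: "'a::euclidean_space"
  assumes t: "t > 0" and s: "s > 0"
  shows "heat t (x - y) * heat s y = heat (t + s) x * heat (t * s / (t + s)) (y - (s / (t + s)) *\<^sub>R x)"
proof -
  have p: "(4 * pi * t) powr e * (4 * pi * s) powr e = (4 * pi * (t + s)) powr e * (4 * pi * (t * s / (t + s))) powr e" for e
  proof -
    have "a powr e * b powr e = (a * b) powr e" if "a \<ge> 0" "b \<ge> 0" for a b :: real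
      using that by (simp add: powr_mult)
    moreover have "(4 * pi * t) * (4 * pi * s) = (4 * pi * (t + s)) * (4 * pi * (t * s / (t + s)))"
      using assms by simp
    ultimately show ?thesis using assms by (simp add: mult_ac)
  qed
  have "(norm (x - y))\<^sup>2 / (4 * t) + (norm y)\<^sup>2 / (4 * s)
    = (norm x)\<^sup>2 / (4 * (t + s)) + (norm (y - (s / (t + s)) *\<^sub>R x))\<^sup>2 / (4 * (t * s / (t + s)))"
  proof -
    define X Y Z where "X = x \<bullet> x" and "Y = y \<bullet> y" and "Z = x \<bullet> y"
    have 1: "(norm (x - y))\<^sup>2 = X - 2 * Z + Y"
      unfolding power2_norm_eq_inner X_def Y_def Z_def by (simp add: inner_diff inner_commute algebra_simps)
    have 2: "(norm (y - c *\<^sub>R x))\<^sup>2 = Y - 2 * c * Z + c\<^sup>2 * X" for c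
      unfolding power2_norm_eq_inner X_def Y_def Z_def
      by (simp add: inner_diff inner_commute algebra_simps power2_eq_square)
    show ?thesis unfolding 1 2 using assms
      by (simp add: power2_norm_eq_inner flip: X_def Y_def)
        (simp add: divide_simps power2_eq_square, simp add: algebra_simps)
  qed
  then have e: "exp (- (norm (x - y))\<^sup>2 / (4 * t)) * exp (- (norm y)\<^sup>2 / (4 * s))
     = exp (- (norm x)\<^sup>2 / (4 * (t + s))) * exp (- (norm (y - (s / (t + s)) *\<^sub>R x))\<^sup>2 / (4 * (t * s / (t + s))))"
    by (simp flip: exp_add)
  have R: "(A * B) * (C * D) = (A * C) * (B * D)" for A B C D :: real by simp
  show ?thesis
    unfolding heat_def by (subst R, subst p, subst e, subst R) (rule refl)
qed

abbreviation nheat :: "real \<Rightarrow> 'a::euclidean_space \<Rightarrow> ennreal" where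
  "nheat t x \<equiv> ennreal (heat t x)"

lemma nconv_heat_heat:
  assumes t: "t > 0" and s: "s > 0"
  shows "nconv (nheat t) (nheat s) = nheat (t + s)"
proof
  fix x :: 'a
  let ?r = "t * s / (t + s)"
  have r: "?r > 0" using assms by simp
  have "nconv (nheat t) (nheat s) x = (\<integral>\<^sup>+y. nheat (t + s) x * nheat ?r (y - (s / (t + s)) *\<^sub>R x) \<partial>lborel)"
    unfolding nconv_def using heat_mult_heat[OF assms, of x] by (simp flip: ennreal_mult)
  also have "\<dots> = nheat (t + s) x"
    using nn_integral_heat[OF r, where 'a = 'a] nn_integral_lborel_translate(2)[of "nheat ?r :: 'a \<Rightarrow> ennreal"]
    by (simp add: nn_integral_cmult)
  finally show "nconv (nheat t) (nheat s) x = nheat (t + s) x" .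
qed

text \<open>
  The kernel of the resolvent \<open>(l - \<Delta>)\<^sup>-\<^sup>1\<close> as the Laplace transform of the heat semigroup.  In
  dimension two and higher it is infinite at the origin, hence the extended values.
\<close>

definition nres :: "real \<Rightarrow> 'a::euclidean_space \<Rightarrow> ennreal" where
  "nres l x = (\<integral>\<^sup>+t. indicator {0<..} t * ennreal (exp (- l * t)) * nheat t x \<partial>lborel)"

lemma borel_measurable_nres [measurable]: "nres l \<in> borel_measurable borel"
  unfolding nres_def[abs_def] by measurable

lemma nres_minus [simp]: "nres l (- x) = nres l x"
  by (simp add: nres_def)

lemma nres_antimono: "0 \<le> l \<Longrightarrow> l \<le> m \<Longrightarrow> nres m x \<le> nres l x"
  unfolding nres_def
proof (intro nn_integral_mono)
  fix t :: real assume "0 \<le> l" "l \<le> m"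
  then have "t > 0 \<Longrightarrow> exp (- m * t) \<le> exp (- l * t)" by (simp add: mult_right_mono)
  then show "indicator {0<..} t * ennreal (exp (- m * t)) * nheat t x \<le> indicator {0<..} t * ennreal (exp (- l * t)) * nheat t x"
    by (auto simp: indicator_def intro!: mult_right_mono ennreal_leI)
qed

lemma nconv_nres:
  assumes [measurable]: "f \<in> borel_measurable borel"
  shows "nconv (nres l) f x = (\<integral>\<^sup>+t. indicator {0<..} t * ennreal (exp (- l * t)) * nconv (nheat t) f x \<partial>lborel)"
proof -
  have "nconv (nres l) f x = (\<integral>\<^sup>+y. \<integral>\<^sup>+t. indicator {0<..} t * ennreal (exp (- l * t)) * nheat t (x - y) * f y \<partial>lborel \<partial>lborel)"
    unfolding nconv_def nres_def by (simp add: nn_integral_multc)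
  also have "\<dots> = (\<integral>\<^sup>+t. \<integral>\<^sup>+y. indicator {0<..} t * ennreal (exp (- l * t)) * nheat t (x - y) * f y \<partial>lborel \<partial>lborel)"
    by (rule lborel_pair.Fubini') measurable
  also have "\<dots> = (\<integral>\<^sup>+t. indicator {0<..} t * ennreal (exp (- l * t)) * nconv (nheat t) f x \<partial>lborel)"
    unfolding nconv_def by (simp add: mult.assoc nn_integral_cmult)
  finally show ?thesis .
qed

lemma nn_integral_exp_Ioi: "(\<integral>\<^sup>+t. indicator {0<..} t * ennreal (exp (- t)) \<partial>lborel) = 1"
proof -
  have "(\<integral>\<^sup>+t. indicator {0<..} t * ennreal (exp (- t)) \<partial>lborel) = (\<integral>\<^sup>+t. ennreal (exp (- t)) * indicator {0..} t \<partial>lborel)"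
    by (intro nn_integral_cong_AE) (use AE_lborel_singleton[of 0] in eventually_elim, auto simp: indicator_def)
  also have "\<dots> = ennreal (0 - (- exp (- 0)))"
    by (rule nn_integral_FTC_atLeast[where F = "\<lambda>t. - exp (- t)"])
      (auto intro!: derivative_eq_intros tendsto_minus_cancel_left[THEN iffD1] filterlim_compose[OF exp_at_bot] filterlim_uminus_at_bot_at_top)
  finally show ?thesis by simp
qed

lemma nn_integral_nres_1: "(\<integral>\<^sup>+x. nres 1 x \<partial>(lborel :: 'a::euclidean_space measure)) = 1"
proof -
  have "(\<integral>\<^sup>+x. nres 1 x \<partial>(lborel :: 'a measure))
     = (\<integral>\<^sup>+t. \<integral>\<^sup>+x. indicator {0<..} t * ennreal (exp (- 1 * t)) * nheat t x \<partial>(lborel :: 'a measure) \<partial>lborel)"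
    unfolding nres_def by (rule lborel_pair.Fubini') measurable
  also have "\<dots> = (\<integral>\<^sup>+t. indicator {0<..} t * ennreal (exp (- t)) \<partial>lborel)"
    by (intro nn_integral_cong) (auto simp: nn_integral_cmult nn_integral_heat indicator_def)
  finally show ?thesis by (simp add: nn_integral_exp_Ioi)
qed

text \<open>
  Moving one factor to the other side by symmetry and merging the two times by the semigroup law.
\<close>

lemma nn_integral_heat_form:
  fixes f :: "'a::euclidean_space \<Rightarrow> ennreal"
  assumes [measurable]: "f \<in> borel_measurable borel" and t: "t > 0" and s: "s > 0"
  shows "(\<integral>\<^sup>+x. nconv (nheat t) f x * nconv (nheat s) f x \<partial>lborel) = (\<integral>\<^sup>+x. f x * nconv (nheat (t + s)) f x \<partial>lborel)"
proof -
  have "(\<integral>\<^sup>+x. nconv (nheat t) f x * nconv (nheat s) f x \<partial>lborel) = (\<integral>\<^sup>+x. f x * nconv (nheat t) (nconv (nheat s) f) x \<partial>lborel)"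
    by (rule nconv_symmetric[symmetric]) auto
  then show ?thesis by (simp add: nconv_assoc nconv_heat_heat t s)
qed

lemma heat_form_le_L2:
  fixes f :: "'a::euclidean_space \<Rightarrow> ennreal"
  assumes [measurable]: "f \<in> borel_measurable borel" and t: "t > 0"
  shows "(\<integral>\<^sup>+x. f x * nconv (nheat t) f x \<partial>lborel) \<le> (\<integral>\<^sup>+x. (f x)\<^sup>2 \<partial>lborel)"
proof (rule ennreal_le_if_square_le)
  have "(\<integral>\<^sup>+x. f x * nconv (nheat t) f x \<partial>lborel)\<^sup>2
     \<le> (\<integral>\<^sup>+x. (f x)\<^sup>2 \<partial>lborel) * (\<integral>\<^sup>+x. (nconv (nheat t) f x)\<^sup>2 \<partial>lborel)"
    by (rule Cauchy_Schwarz_nn_integral) auto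
  also have "\<dots> \<le> (\<integral>\<^sup>+x. (f x)\<^sup>2 \<partial>lborel) * (\<integral>\<^sup>+x. (f x)\<^sup>2 \<partial>lborel)"
    using nn_integral_nconv_square_le[of "nheat t :: 'a \<Rightarrow> ennreal" f] nn_integral_heat[OF t, where 'a = 'a]
    by (intro mult_left_mono) auto
  finally show "(\<integral>\<^sup>+x. f x * nconv (nheat t) f x \<partial>lborel)\<^sup>2 \<le> (\<integral>\<^sup>+x. (f x)\<^sup>2 \<partial>lborel)\<^sup>2"
    by (simp add: power2_eq_square)
qed

lemma nconv_heat_le:
  fixes f :: "'a::euclidean_space \<Rightarrow> ennreal"
  assumes [measurable]: "f \<in> borel_measurable borel" and t: "t > 0"
  shows "nconv (nheat t) f x \<le> ennreal ((4 * pi * t) powr (- real DIM('a) / 2)) * (\<integral>\<^sup>+x. f x \<partial>lborel)"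
proof -
  have "nconv (nheat t) f x \<le> (\<integral>\<^sup>+y. ennreal ((4 * pi * t) powr (- real DIM('a) / 2)) * f y \<partial>lborel)"
    unfolding nconv_def by (intro nn_integral_mono mult_right_mono ennreal_leI heat_le t) auto
  then show ?thesis by (simp add: nn_integral_cmult)
qed

lemma heat_form_le_L1:
  fixes f :: "'a::euclidean_space \<Rightarrow> ennreal"
  assumes [measurable]: "f \<in> borel_measurable borel" and t: "t > 0"
  shows "(\<integral>\<^sup>+x. f x * nconv (nheat t) f x \<partial>lborel)
    \<le> ennreal ((4 * pi * t) powr (- real DIM('a) / 2)) * (\<integral>\<^sup>+x. f x \<partial>lborel)\<^sup>2"
proof -
  have "(\<integral>\<^sup>+x. f x * nconv (nheat t) f x \<partial>lborel)
    \<le> (\<integral>\<^sup>+x. f x * (ennreal ((4 * pi * t) powr (- real DIM('a) / 2)) * (\<integral>\<^sup>+x. f x \<partial>lborel)) \<partial>lborel)"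
    by (intro nn_integral_mono mult_left_mono nconv_heat_le t) auto
  then show ?thesis by (simp add: nn_integral_multc power2_eq_square mult_ac)
qed

text \<open>
  The square of a time integral is a double time integral in which only the total time \<open>r = t + s\<close>
  matters; the segment of pairs with a given total time has length \<open>r\<close>, which is the weight on the
  right.
\<close>

lemma nn_integral_nconv_nres_0_square:
  fixes f :: "'a::euclidean_space \<Rightarrow> ennreal"
  assumes [measurable]: "f \<in> borel_measurable borel"
  shows "(\<integral>\<^sup>+x. (nconv (nres 0) f x)\<^sup>2 \<partial>lborel)
     = (\<integral>\<^sup>+t. indicator {0<..} t * ennreal t * (\<integral>\<^sup>+x. f x * nconv (nheat t) f x \<partial>lborel) \<partial>lborel)"
proof -
  define I :: "real \<Rightarrow> ennreal" where "I = indicator {0<..}"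
  have [measurable]: "I \<in> borel_measurable borel" by (simp add: I_def)
  have [measurable]: "(\<lambda>(t, x). nconv (nheat t) f x) \<in> borel_measurable (borel \<Otimes>\<^sub>M borel)"
    unfolding nconv_def by measurable
  define q where "q t = (\<integral>\<^sup>+x. f x * nconv (nheat t) f x \<partial>lborel)" for t
  have [measurable]: "q \<in> borel_measurable borel" unfolding q_def by measurable
  have "(\<integral>\<^sup>+x. (nconv (nres 0) f x)\<^sup>2 \<partial>lborel)
      = (\<integral>\<^sup>+x. \<integral>\<^sup>+t. \<integral>\<^sup>+s. (I t * nconv (nheat t) f x) * (I s * nconv (nheat s) f x) \<partial>lborel \<partial>lborel \<partial>lborel)"
    by (simp add: nconv_nres power2_eq_square nn_integral_cmult nn_integral_multc flip: I_def)
  also have "\<dots> = (\<integral>\<^sup>+t. \<integral>\<^sup>+x. \<integral>\<^sup>+s. (I t * nconv (nheat t) f x) * (I s * nconv (nheat s) f x) \<partial>lborel \<partial>lborel \<partial>lborel)"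
    by (rule lborel_pair.Fubini') measurable
  also have "\<dots> = (\<integral>\<^sup>+t. \<integral>\<^sup>+s. \<integral>\<^sup>+x. (I t * nconv (nheat t) f x) * (I s * nconv (nheat s) f x) \<partial>lborel \<partial>lborel \<partial>lborel)"
    by (intro nn_integral_cong lborel_pair.Fubini') measurable
  also have "\<dots> = (\<integral>\<^sup>+t. \<integral>\<^sup>+s. I t * I s * q (t + s) \<partial>lborel \<partial>lborel)"
  proof (intro nn_integral_cong)
    fix t s :: real
    have "(\<integral>\<^sup>+x. (I t * nconv (nheat t) f x) * (I s * nconv (nheat s) f x) \<partial>lborel)
      = I t * I s * (\<integral>\<^sup>+x. nconv (nheat t) f x * nconv (nheat s) f x \<partial>lborel)"
      by (subst nn_integral_cmult[symmetric]) (auto simp: mult_ac)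
    also have "\<dots> = I t * I s * q (t + s)"
      by (auto simp: I_def indicator_def q_def nn_integral_heat_form)
    finally show "(\<integral>\<^sup>+x. (I t * nconv (nheat t) f x) * (I s * nconv (nheat s) f x) \<partial>lborel) = I t * I s * q (t + s)" .
  qed
  also have "\<dots> = (\<integral>\<^sup>+t. \<integral>\<^sup>+r. I t * I (r - t) * q r \<partial>lborel \<partial>lborel)"
  proof (rule nn_integral_cong)
    fix t :: real
    show "(\<integral>\<^sup>+s. I t * I s * q (t + s) \<partial>lborel) = (\<integral>\<^sup>+r. I t * I (r - t) * q r \<partial>lborel)"
      using nn_integral_lborel_translate(1)[of "\<lambda>r. I t * I (r - t) * q r" t] by simp
  qed
  also have "\<dots> = (\<integral>\<^sup>+r. \<integral>\<^sup>+t. I t * I (r - t) * q r \<partial>lborel \<partial>lborel)"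
    by (rule lborel_pair.Fubini') measurable
  also have "\<dots> = (\<integral>\<^sup>+r. I r * ennreal r * q r \<partial>lborel)"
  proof (intro nn_integral_cong)
    fix r :: real
    have "(\<integral>\<^sup>+t. I t * I (r - t) \<partial>lborel) = (\<integral>\<^sup>+t. indicator {0<..<r} t \<partial>lborel)"
      by (intro nn_integral_cong) (auto simp: I_def indicator_def)
    also have "\<dots> = I r * ennreal r"
      by (cases "r > 0") (auto simp: I_def ennreal_neg)
    finally show "(\<integral>\<^sup>+t. I t * I (r - t) * q r \<partial>lborel) = I r * ennreal r * q r"
      by (simp add: nn_integral_multc)
  qed
  finally show ?thesis by (simp add: I_def q_def)
qed

lemma nn_integral_powr_tail:
  assumes "T > 0" "a < -1"
  shows "(\<integral>\<^sup>+t. indicator {T<..} t * ennreal (t powr a) \<partial>lborel) = ennreal (T powr (a + 1) / (- a - 1))"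
proof -
  have "(\<integral>\<^sup>+t. indicator {T<..} t * ennreal (t powr a) \<partial>lborel) = (\<integral>\<^sup>+t. ennreal (t powr a) * indicator {T..} t \<partial>lborel)"
    by (intro nn_integral_cong_AE) (use AE_lborel_singleton[of T] in eventually_elim, auto simp: indicator_def)
  also have "\<dots> = ennreal (0 / (a + 1) - (T powr (a + 1) / (a + 1)))"
  proof (rule nn_integral_FTC_atLeast[where F = "\<lambda>t. t powr (a + 1) / (a + 1)"])
    show "((\<lambda>t. t powr (a + 1) / (a + 1)) has_real_derivative x powr a) (at x)" if "T \<le> x" for x
      using that assms by (auto intro!: derivative_eq_intros)
    show "((\<lambda>t. t powr (a + 1) / (a + 1)) \<longlongrightarrow> 0 / (a + 1)) at_top"
      using assms by (intro tendsto_divide tendsto_const tendsto_neg_powr filterlim_ident) auto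
  qed auto
  also have "0 / (a + 1) - (T powr (a + 1) / (a + 1)) = T powr (a + 1) / (- a - 1)"
    using assms by (simp add: divide_simps) (simp add: algebra_simps)
  finally show ?thesis .
qed

text \<open>
  Up to the time \<open>T\<close> the heat form is bounded by the square of the \<open>L\<^sup>2\<close> norm, after it by the decay
  from \<open>L\<^sup>1\<close>.  The tail \<open>\<integral> t\<^sup>1\<^sup>-\<^sup>d\<^sup>/\<^sup>2\<close> converges exactly for \<open>d > 4\<close>.
\<close>

theorem nconv_nres_0_L2_bound:
  fixes f :: "'a::euclidean_space \<Rightarrow> ennreal"
  defines "d \<equiv> real DIM('a)"
  assumes [measurable]: "f \<in> borel_measurable borel" and T: "T > 0" and d: "d > 4"
  shows "(\<integral>\<^sup>+x. (nconv (nres 0) f x)\<^sup>2 \<partial>lborel)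
     \<le> ennreal (T\<^sup>2 / 2) * (\<integral>\<^sup>+x. (f x)\<^sup>2 \<partial>lborel)
       + ennreal ((4 * pi) powr (- d / 2) * (T powr (2 - d / 2) / (d / 2 - 2))) * (\<integral>\<^sup>+x. f x \<partial>lborel)\<^sup>2"
proof -
  let ?b = "\<integral>\<^sup>+x. (f x)\<^sup>2 \<partial>lborel" and ?a = "(\<integral>\<^sup>+x. f x \<partial>lborel)\<^sup>2"
  have "(\<integral>\<^sup>+x. (nconv (nres 0) f x)\<^sup>2 \<partial>lborel)
     \<le> (\<integral>\<^sup>+t. ennreal t * indicator {0..T} t * ?b + indicator {T<..} t * ennreal (t powr (1 - d / 2)) * (ennreal ((4 * pi) powr (- d / 2)) * ?a) \<partial>lborel)"
    unfolding nn_integral_nconv_nres_0_square[OF assms(2)]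
  proof (rule nn_integral_mono)
    fix t :: real
    let ?q = "\<integral>\<^sup>+x. f x * nconv (nheat t) f x \<partial>lborel"
    consider "t \<le> 0" | "0 < t" "t \<le> T" | "t > T" by linarith
    then show "indicator {0<..} t * ennreal t * ?q \<le> ennreal t * indicator {0..T} t * ?b + indicator {T<..} t * ennreal (t powr (1 - d / 2)) * (ennreal ((4 * pi) powr (- d / 2)) * ?a)"
    proof cases
      case 2
      then show ?thesis using heat_form_le_L2[of f t] by (auto intro: mult_left_mono)
    next
      case 3
      then have t: "t > 0" using T by simp
      have "ennreal t * ?q \<le> ennreal t * (ennreal ((4 * pi * t) powr (- d / 2)) * ?a)"
        using heat_form_le_L1[of f t] t by (intro mult_left_mono) (auto simp: d_def)
      also have "t * (4 * pi * t) powr (- d / 2) = t powr (1 - d / 2) * (4 * pi) powr (- d / 2)"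
        using t powr_add[of t 1 "- d / 2"] by (simp add: powr_mult)
      then have "ennreal t * (ennreal ((4 * pi * t) powr (- d / 2)) * ?a) = ennreal (t powr (1 - d / 2)) * (ennreal ((4 * pi) powr (- d / 2)) * ?a)"
        using t by (simp flip: ennreal_mult mult.assoc)
      finally show ?thesis using 3 t by simp
    qed simp
  qed
  also have "\<dots> = (\<integral>\<^sup>+t. ennreal t * indicator {0..T} t \<partial>lborel) * ?b
     + (\<integral>\<^sup>+t. indicator {T<..} t * ennreal (t powr (1 - d / 2)) \<partial>lborel) * (ennreal ((4 * pi) powr (- d / 2)) * ?a)"
    by (subst nn_integral_add) (auto simp: nn_integral_multc)
  also have "(\<integral>\<^sup>+t. ennreal t * indicator {0..T} t \<partial>lborel) = ennreal (T\<^sup>2 / 2 - 0\<^sup>2 / 2)"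
    using T by (intro nn_integral_FTC_Icc) (auto intro!: derivative_eq_intros)
  also have "(\<integral>\<^sup>+t. indicator {T<..} t * ennreal (t powr (1 - d / 2)) \<partial>lborel) = ennreal (T powr (2 - d / 2) / (d / 2 - 2))"
    using T d by (subst nn_integral_powr_tail) (auto simp: algebra_simps)
  finally have "(\<integral>\<^sup>+x. (nconv (nres 0) f x)\<^sup>2 \<partial>lborel) \<le> ennreal (T\<^sup>2 / 2 - 0\<^sup>2 / 2) * ?b
     + ennreal (T powr (2 - d / 2) / (d / 2 - 2)) * (ennreal ((4 * pi) powr (- d / 2)) * ?a)" .
  moreover have "ennreal ((4 * pi) powr (- d / 2) * (T powr (2 - d / 2) / (d / 2 - 2)))
    = ennreal ((4 * pi) powr (- d / 2)) * ennreal (T powr (2 - d / 2) / (d / 2 - 2))"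
    using d by (intro ennreal_mult) auto
  ultimately show ?thesis
    by (simp add: mult_ac)
qed

section \<open>The resolvent at one as a positive contraction\<close>

text \<open>
  Convolution of real functions.  It is \<open>0\<close> by convention at points where the integrand is not
  integrable; in the applications these form a null set.
\<close>

definition rconv :: "('a::euclidean_space \<Rightarrow> real) \<Rightarrow> ('a \<Rightarrow> real) \<Rightarrow> 'a \<Rightarrow> real" where
  "rconv k f x = (LINT y|lborel. k (x - y) * f y)"

lemma borel_measurable_rconv [measurable]:
  assumes [measurable]: "k \<in> borel_measurable borel" "f \<in> borel_measurable borel"
  shows "rconv k f \<in> borel_measurable borel"
  unfolding rconv_def[abs_def] by measurable

abbreviation nabs :: "('a \<Rightarrow> real) \<Rightarrow> 'a \<Rightarrow> ennreal" where
  "nabs f x \<equiv> ennreal \<bar>f x\<bar>"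

lemma nabs_rconv_le:
  assumes [measurable]: "k \<in> borel_measurable borel" "f \<in> borel_measurable borel"
  shows "nabs (rconv k f) x \<le> nconv (nabs k) (nabs f) x"
proof -
  have "ennreal (norm (LINT y|lborel. k (x - y) * f y)) \<le> (\<integral>\<^sup>+y. ennreal (norm (k (x - y) * f y)) \<partial>lborel)"
  proof (cases "integrable lborel (\<lambda>y. k (x - y) * f y)")
    case True
    then show ?thesis by (rule integral_norm_bound_ennreal)
  qed (simp add: not_integrable_integral_eq)
  then show ?thesis by (simp add: rconv_def nconv_def abs_mult ennreal_mult)
qed

lemma nn_integral_square_finite:
  assumes "f \<in> borel_measurable M" "integrable M (\<lambda>x. (f x :: real)\<^sup>2)"
  shows "(\<integral>\<^sup>+x. (nabs f x)\<^sup>2 \<partial>M) = ennreal (LINT x|M. (f x)\<^sup>2)"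
  using assms by (simp add: ennreal_power nn_integral_eq_integral)

lemma square_integrable_if_nn_integral_le:
  assumes "f \<in> borel_measurable M" "(\<integral>\<^sup>+x. (nabs f x)\<^sup>2 \<partial>M) \<le> ennreal C" "C \<ge> 0"
  shows "integrable M (\<lambda>x. (f x :: real)\<^sup>2)" "(LINT x|M. (f x)\<^sup>2) \<le> C"
proof -
  have *: "(\<integral>\<^sup>+x. ennreal (norm ((f x)\<^sup>2)) \<partial>M) \<le> ennreal C"
    using assms(2) by (simp add: ennreal_power)
  then show i: "integrable M (\<lambda>x. (f x)\<^sup>2)"
    using assms(1) by (intro integrableI_bounded) (auto intro: le_less_trans)
  show "(LINT x|M. (f x)\<^sup>2) \<le> C"
    using * assms(3) i by (simp add: nn_integral_eq_integral)
qed

lemma rconv_L2_le: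
  fixes k f :: "'a::euclidean_space \<Rightarrow> real"
  assumes [measurable]: "k \<in> borel_measurable borel" "f \<in> borel_measurable borel"
    and k: "(\<integral>\<^sup>+x. nabs k x \<partial>lborel) \<le> ennreal a" "a \<ge> 0"
    and f: "integrable lborel (\<lambda>x. (f x)\<^sup>2)"
  shows "integrable lborel (\<lambda>x. (rconv k f x)\<^sup>2)"
    "(LINT x|lborel. (rconv k f x)\<^sup>2) \<le> a\<^sup>2 * (LINT x|lborel. (f x)\<^sup>2)"
proof -
  have nf: "(\<integral>\<^sup>+y. (nabs f y)\<^sup>2 \<partial>lborel) = ennreal (LINT x|lborel. (f x)\<^sup>2)"
    by (rule nn_integral_square_finite) (use f in simp_all)
  have "(\<integral>\<^sup>+x. (nabs (rconv k f) x)\<^sup>2 \<partial>lborel) \<le> (\<integral>\<^sup>+x. (nconv (nabs k) (nabs f) x)\<^sup>2 \<partial>lborel)"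
    by (intro nn_integral_mono power_mono nabs_rconv_le) auto
  also have "\<dots> \<le> (\<integral>\<^sup>+y. nabs k y \<partial>lborel)\<^sup>2 * (\<integral>\<^sup>+y. (nabs f y)\<^sup>2 \<partial>lborel)"
    by (rule nn_integral_nconv_square_le) auto
  also have "\<dots> \<le> (ennreal a)\<^sup>2 * (\<integral>\<^sup>+y. (nabs f y)\<^sup>2 \<partial>lborel)"
    by (intro mult_right_mono power_mono k) auto
  also have "\<dots> = ennreal (a\<^sup>2 * (LINT x|lborel. (f x)\<^sup>2))"
    unfolding nf using k(2) by (simp add: ennreal_power ennreal_mult)
  finally show "integrable lborel (\<lambda>x. (rconv k f x)\<^sup>2)"
    "(LINT x|lborel. (rconv k f x)\<^sup>2) \<le> a\<^sup>2 * (LINT x|lborel. (f x)\<^sup>2)"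
    by (auto intro!: square_integrable_if_nn_integral_le[where C = "a\<^sup>2 * (LINT x|lborel. (f x)\<^sup>2)"])
qed

lemma integral_heat_mult_heat:
  fixes x z :: "'a::euclidean_space"
  assumes t: "t > 0" and s: "s > 0"
  shows "(LINT y|lborel. heat t (x - y) * heat s (y - z)) = heat (t + s) (x - z)"
proof -
  have "(LINT y|lborel. heat t (x - y) * heat s (y - z)) = enn2real (\<integral>\<^sup>+y. ennreal (heat t (x - y) * heat s (y - z)) \<partial>lborel)"
    by (intro integral_eq_nn_integral) auto
  also have "(\<integral>\<^sup>+y. ennreal (heat t (x - y) * heat s (y - z)) \<partial>lborel) = (\<integral>\<^sup>+y. nheat t ((x - z) - y) * nheat s y \<partial>lborel)"
    using nn_integral_lborel_translate(1)[of "\<lambda>y. ennreal (heat t (x - y) * heat s (y - z))" z]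
    by (simp add: ennreal_mult algebra_simps)
  also have "\<dots> = nheat (t + s) (x - z)"
    using fun_cong[OF nconv_heat_heat[OF t s], of "x - z"] by (simp add: nconv_def)
  finally show ?thesis by simp
qed

context
  fixes F :: "'a::euclidean_space \<Rightarrow> real"
  assumes F_meas [measurable]: "F \<in> borel_measurable borel"
    and F_int: "integrable lborel F"
    and F_sq: "integrable lborel (\<lambda>x. (F x)\<^sup>2)"
begin

lemma nabs_heat: "nabs (heat t) = nheat t"
  by (simp add: fun_eq_iff)

lemma rconv_heat_L2:
  assumes "t > 0" "g \<in> borel_measurable borel" "integrable lborel (\<lambda>x::'a. (g x)\<^sup>2)"
  shows "integrable lborel (\<lambda>x. (rconv (heat t) g x)\<^sup>2)"
    "(LINT x|lborel. (rconv (heat t) g x)\<^sup>2) \<le> (LINT x|lborel. (g x)\<^sup>2)"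
  using rconv_L2_le[of "heat t" g 1] nn_integral_heat[OF assms(1), where 'a = 'a] assms(2,3)
  by simp_all

lemma nconv_heat_F_finite: "t > 0 \<Longrightarrow> nconv (nheat t) (nabs F) x < \<infinity>"
proof -
  assume t: "t > 0"
  have "nconv (nheat t) (nabs F) x \<le> ennreal ((4 * pi * t) powr (- real DIM('a) / 2)) * (\<integral>\<^sup>+x. nabs F x \<partial>lborel)"
    by (rule nconv_heat_le) (use t in auto)
  also have "\<dots> < \<infinity>"
    using F_int by (simp add: integrable_iff_bounded ennreal_mult_less_top)
  finally show ?thesis .
qed

lemma rconv_heat_rconv_heat:
  assumes t: "t > 0" and s: "s > 0"
  shows "rconv (heat t) (rconv (heat s) F) x = rconv (heat (t + s)) F x"
proof -
  have "(\<integral>\<^sup>+y. nabs (\<lambda>y. heat t (x - y)) y * nconv (nabs (heat s)) (nabs F) y \<partial>lborel) = nconv (nheat t) (nconv (nheat s) (nabs F)) x"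
    by (simp add: nconv_def)
  also have "\<dots> = nconv (nheat (t + s)) (nabs F) x"
    by (simp add: nconv_assoc nconv_heat_heat t s)
  also have "\<dots> < \<infinity>"
    using nconv_heat_F_finite[of "t + s" x] t s by simp
  finally have fin: "(\<integral>\<^sup>+y. nabs (\<lambda>y. heat t (x - y)) y * nconv (nabs (heat s)) (nabs F) y \<partial>lborel) < \<infinity>" .
  have "rconv (heat t) (rconv (heat s) F) x = (LINT z|lborel. (LINT y|lborel. heat t (x - y) * heat s (y - z)) * F z)"
    unfolding rconv_def by (rule integral_kernel_swap(2)) (use fin in auto)
  then show ?thesis by (simp add: integral_heat_mult_heat t s rconv_def)
qed

lemma nn_integral_heat_form_finite:
  assumes t: "t > 0"
  shows "(\<integral>\<^sup>+x. nabs F x * nconv (nabs (heat t)) (nabs F) x \<partial>lborel) \<le> ennreal (LINT x|lborel. (F x)\<^sup>2)"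
  using heat_form_le_L2[of "nabs F" t] t F_sq by (simp add: nn_integral_square_finite)

lemma integral_rconv_heat_rconv_heat:
  assumes t: "t > 0" and s: "s > 0"
  shows "(LINT x|lborel. rconv (heat t) F x * rconv (heat s) F x) = (LINT x|lborel. F x * rconv (heat (t + s)) F x)"
proof -
  have 1: "(\<integral>\<^sup>+x. nabs F x * nconv (nabs (heat t)) (nabs (rconv (heat s) F)) x \<partial>lborel)
    \<le> (\<integral>\<^sup>+x. nabs F x * nconv (nheat t) (nconv (nheat s) (nabs F)) x \<partial>lborel)"
  proof (intro nn_integral_mono mult_left_mono)
    fix x
    show "nconv (nabs (heat t)) (nabs (rconv (heat s) F)) x \<le> nconv (nheat t) (nconv (nheat s) (nabs F)) x"
      unfolding nconv_def[of _ _ x] nabs_heat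
      using nabs_rconv_le[of "heat s" F] by (intro nn_integral_mono mult_left_mono) (auto simp: nabs_heat)
  qed auto
  also have "\<dots> = (\<integral>\<^sup>+x. nabs F x * nconv (nabs (heat (t + s))) (nabs F) x \<partial>lborel)"
    by (simp add: nconv_assoc nconv_heat_heat t s nabs_heat)
  also have "\<dots> \<le> ennreal (LINT x|lborel. (F x)\<^sup>2)"
    using nn_integral_heat_form_finite[of "t + s"] t s by simp
  finally have fin: "(\<integral>\<^sup>+x. nabs F x * nconv (nabs (heat t)) (nabs (rconv (heat s) F)) x \<partial>lborel) < \<infinity>"
    by (rule le_less_trans) simp
  have "(LINT x|lborel. F x * rconv (heat (t + s)) F x) = (LINT x|lborel. F x * rconv (heat t) (rconv (heat s) F) x)"
    by (simp add: rconv_heat_rconv_heat t s)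
  also have "\<dots> = (LINT y|lborel. (LINT x|lborel. F x * heat t (x - y)) * rconv (heat s) F y)"
    unfolding rconv_def[of "heat t"] by (rule integral_kernel_swap(2)) (use fin in auto)
  also have "\<dots> = (LINT x|lborel. rconv (heat t) F x * rconv (heat s) F x)"
  proof -
    have "heat t (x - y) = heat t (y - x)" for x y :: 'a using heat_minus[of t "x - y"] by simp
    then show ?thesis by (simp add: rconv_def[of "heat t"] mult.commute)
  qed
  finally show ?thesis by simp
qed

text \<open>
  Both sides are values of the same decreasing function: with \<open>q(t) = \<langle>F, e\<^sup>t\<^sup>\<Delta>F\<rangle>\<close> the left side is
  \<open>q(2t)\<close> and the right side \<open>q(t)\<close>.  Halving the time exhibits the step from one to the other as an
  application of the contraction \<open>e\<^sup>(\<^sup>t\<^sup>/\<^sup>2\<^sup>)\<^sup>\<Delta>\<close>.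
\<close>

lemma rconv_heat_square_le_form:
  assumes t: "t > 0"
  shows "(LINT x|lborel. (rconv (heat t) F x)\<^sup>2) \<le> (LINT x|lborel. F x * rconv (heat t) F x)"
proof -
  have t2: "t / 2 > 0" using t by simp
  have "(LINT x|lborel. (rconv (heat t) F x)\<^sup>2) = (LINT x|lborel. (rconv (heat (t/2)) (rconv (heat (t/2)) F) x)\<^sup>2)"
    using rconv_heat_rconv_heat[OF t2 t2] by simp
  also have "\<dots> \<le> (LINT x|lborel. (rconv (heat (t/2)) F x)\<^sup>2)"
    by (intro rconv_heat_L2 t2 F_sq) auto
  also have "\<dots> = (LINT x|lborel. F x * rconv (heat t) F x)"
    using integral_rconv_heat_rconv_heat[OF t2 t2] by (simp add: power2_eq_square)
  finally show ?thesis .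
qed

end

text \<open>
  The real-valued resolvent kernel, with \<open>\<infinity>\<close> replaced by \<open>0\<close>.  It never exceeds \<open>nres\<close>, which is all
  that estimates of absolute values require.
\<close>

definition res :: "real \<Rightarrow> 'a::euclidean_space \<Rightarrow> real" where
  "res l x = enn2real (nres l x)"

lemma borel_measurable_res [measurable]: "res l \<in> borel_measurable borel"
  unfolding res_def[abs_def] by measurable

lemma res_minus [simp]: "res l (- x) = res l x" and res_nonneg [simp]: "res l x \<ge> 0"
  by (simp_all add: res_def)

text \<open>
  The exponential distribution: \<open>R\<^sub>1\<close> is the average of \<open>e\<^sup>t\<^sup>\<Delta>\<close> under it, so Jensen's inequality is
  available.
\<close>

definition exp_measure :: "real measure" where
  "exp_measure = density lborel (\<lambda>t. indicator {0<..} t * ennreal (exp (- t)))"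

lemma sets_exp_measure [measurable_cong, simp]: "sets exp_measure = sets borel"
  by (simp add: exp_measure_def)

lemma space_exp_measure [simp]: "space exp_measure = UNIV"
  by (simp add: exp_measure_def)

lemma prob_space_exp_measure: "prob_space exp_measure"
  by (rule prob_spaceI) (simp add: exp_measure_def emeasure_density nn_integral_exp_Ioi)

interpretation exp_measure: prob_space exp_measure by (rule prob_space_exp_measure)

lemma nn_integral_exp_measure:
  "f \<in> borel_measurable borel \<Longrightarrow> (\<integral>\<^sup>+t. f t \<partial>exp_measure) = (\<integral>\<^sup>+t. indicator {0<..} t * ennreal (exp (- t)) * f t \<partial>lborel)"
  unfolding exp_measure_def by (subst nn_integral_density) auto

lemma AE_exp_measure_pos: "AE t in exp_measure. t > 0"
  unfolding exp_measure_def by (subst AE_density) (auto simp: indicator_def)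

lemma nres_1_eq: "nres 1 x = (\<integral>\<^sup>+t. nheat t x \<partial>exp_measure)"
  by (simp add: nn_integral_exp_measure nres_def)

lemma res_1_eq: "res 1 x = (LINT t|exp_measure. heat t x)"
  unfolding res_def nres_1_eq by (rule integral_eq_nn_integral[symmetric]) auto

interpretation exp_lborel: pair_sigma_finite exp_measure "lborel :: 'a::euclidean_space measure" ..

context
  fixes F :: "'a::euclidean_space \<Rightarrow> real"
  assumes F_meas [measurable]: "F \<in> borel_measurable borel"
    and F_int: "integrable lborel F"
    and F_sq: "integrable lborel (\<lambda>x. (F x)\<^sup>2)"
begin

lemma nconv_nres_1_eq: "nconv (nres 1) (nabs F) x = (\<integral>\<^sup>+t. nconv (nheat t) (nabs F) x \<partial>exp_measure)"
proof -
  have "(\<lambda>t. nconv (nheat t) (nabs F) x) \<in> borel_measurable borel"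
    unfolding nconv_def by measurable
  then show ?thesis by (simp add: nconv_nres nn_integral_exp_measure)
qed

lemma rconv_res_1_eq:
  assumes "nconv (nres 1) (nabs F) x < \<infinity>"
  shows "integrable exp_measure (\<lambda>t. rconv (heat t) F x)"
    "rconv (res 1) F x = (LINT t|exp_measure. rconv (heat t) F x)"
proof -
  have "(\<integral>\<^sup>+t. \<integral>\<^sup>+y. ennreal \<bar>heat t (x - y) * F y\<bar> \<partial>lborel \<partial>exp_measure) < \<infinity>"
    using assms unfolding nconv_nres_1_eq by (simp add: nconv_def abs_mult ennreal_mult)
  then have *: "integrable (exp_measure \<Otimes>\<^sub>M lborel) (\<lambda>(t, y). heat t (x - y) * F y)"
    by (subst integrable_iff_bounded) (simp add: lborel.nn_integral_fst[symmetric] split_beta')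
  show "integrable exp_measure (\<lambda>t. rconv (heat t) F x)"
    using exp_lborel.integrable_fst'[OF *] by (simp add: rconv_def)
  show "rconv (res 1) F x = (LINT t|exp_measure. rconv (heat t) F x)"
    using exp_lborel.Fubini_integral[OF *] by (simp add: rconv_def res_1_eq)
qed

lemma nn_integral_F_nconv_nres_1: "(\<integral>\<^sup>+x. nabs F x * nconv (nres 1) (nabs F) x \<partial>lborel) < \<infinity>"
  and AE_nconv_nres_1_finite: "AE x in lborel. nconv (nres 1) (nabs F) x < \<infinity>"
proof -
  have n: "(\<integral>\<^sup>+x. nconv (nres 1) (nabs F) x \<partial>lborel) < \<infinity>"
    using F_int by (simp add: nn_integral_nconv nn_integral_nres_1 integrable_iff_bounded)
  show "AE x in lborel. nconv (nres 1) (nabs F) x < \<infinity>"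
    using nn_integral_PInf_AE[of "nconv (nres 1) (nabs F)" lborel] n by (auto simp: less_top)
  have nF: "(\<integral>\<^sup>+x. (nabs F x)\<^sup>2 \<partial>lborel) = ennreal (LINT x|lborel. (F x)\<^sup>2)"
    by (rule nn_integral_square_finite) (use F_sq in simp_all)
  have "(\<integral>\<^sup>+x. nabs F x * nconv (nres 1) (nabs F) x \<partial>lborel)\<^sup>2 \<le> (\<integral>\<^sup>+x. (nabs F x)\<^sup>2 \<partial>lborel) * (\<integral>\<^sup>+x. (nconv (nres 1) (nabs F) x)\<^sup>2 \<partial>lborel)"
    by (rule Cauchy_Schwarz_nn_integral) auto
  also have "\<dots> \<le> (\<integral>\<^sup>+x. (nabs F x)\<^sup>2 \<partial>lborel) * ((\<integral>\<^sup>+x. nres 1 (x::'a) \<partial>lborel)\<^sup>2 * (\<integral>\<^sup>+x. (nabs F x)\<^sup>2 \<partial>lborel))"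
    by (intro mult_left_mono nn_integral_nconv_square_le) auto
  also have "\<dots> = (ennreal (LINT x|lborel. (F x)\<^sup>2))\<^sup>2"
    unfolding nF nn_integral_nres_1 by (simp add: power2_eq_square)
  finally show "(\<integral>\<^sup>+x. nabs F x * nconv (nres 1) (nabs F) x \<partial>lborel) < \<infinity>"
    by (rule le_less_trans[OF ennreal_le_if_square_le]) simp
qed

text \<open>
  Fubini's theorem for the average over time, in the quadratic form of \<open>R\<^sub>1\<close>.
\<close>

lemma rconv_res_1_form:
  "integrable lborel (\<lambda>x. F x * rconv (res 1) F x)"
  "integrable exp_measure (\<lambda>t. LINT x|lborel. F x * rconv (heat t) F x)"
  "(LINT x|lborel. F x * rconv (res 1) F x) = (LINT t|exp_measure. LINT x|lborel. F x * rconv (heat t) F x)"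
proof -
  have "(\<integral>\<^sup>+x. \<integral>\<^sup>+t. ennreal \<bar>F x * rconv (heat t) F x\<bar> \<partial>exp_measure \<partial>lborel)
    \<le> (\<integral>\<^sup>+x. nabs F x * nconv (nres 1) (nabs F) x \<partial>lborel)"
  proof (rule nn_integral_mono)
    fix x
    have [measurable]: "(\<lambda>t. nconv (nheat t) (nabs F) x) \<in> borel_measurable borel" "(\<lambda>t. rconv (heat t) F x) \<in> borel_measurable borel"
      unfolding nconv_def rconv_def by measurable
    have "(\<integral>\<^sup>+t. ennreal \<bar>F x * rconv (heat t) F x\<bar> \<partial>exp_measure) \<le> (\<integral>\<^sup>+t. nabs F x * nconv (nheat t) (nabs F) x \<partial>exp_measure)"
      using nabs_rconv_le[of "heat _" F x] by (intro nn_integral_mono) (auto simp: abs_mult ennreal_mult intro!: mult_left_mono)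
    also have "\<dots> = nabs F x * nconv (nres 1) (nabs F) x"
      by (simp add: nconv_nres_1_eq nn_integral_cmult)
    finally show "(\<integral>\<^sup>+t. ennreal \<bar>F x * rconv (heat t) F x\<bar> \<partial>exp_measure) \<le> nabs F x * nconv (nres 1) (nabs F) x" .
  qed
  note fin = le_less_trans[OF this nn_integral_F_nconv_nres_1]
  have [measurable]: "(\<lambda>(t, x). rconv (heat t) F x) \<in> borel_measurable (borel \<Otimes>\<^sub>M borel)"
    unfolding rconv_def by measurable
  have "(\<integral>\<^sup>+t. \<integral>\<^sup>+x. ennreal \<bar>F x * rconv (heat t) F x\<bar> \<partial>lborel \<partial>exp_measure) < \<infinity>"
    using fin by (subst exp_lborel.Fubini'[symmetric]) auto
  then have *: "integrable (exp_measure \<Otimes>\<^sub>M lborel) (\<lambda>(t, x). F x * rconv (heat t) F x)"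
    by (subst integrable_iff_bounded) (simp add: lborel.nn_integral_fst[symmetric] split_beta')
  show "integrable exp_measure (\<lambda>t. LINT x|lborel. F x * rconv (heat t) F x)"
    using exp_lborel.integrable_fst'[OF *] by simp
  have ae: "AE x in lborel. F x * rconv (res 1) F x = (LINT t|exp_measure. F x * rconv (heat t) F x)"
    using AE_nconv_nres_1_finite by eventually_elim (simp add: rconv_res_1_eq)
  have "integrable lborel (\<lambda>x. LINT t|exp_measure. F x * rconv (heat t) F x)"
    using exp_lborel.integrable_snd[OF *] by simp
  then show "integrable lborel (\<lambda>x. F x * rconv (res 1) F x)"
    by (subst integrable_cong_AE[OF _ _ ae]) auto
  have "(LINT x|lborel. F x * rconv (res 1) F x) = (LINT x|lborel. LINT t|exp_measure. F x * rconv (heat t) F x)"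
    by (rule integral_cong_AE[OF _ _ ae]) auto
  also have "\<dots> = (LINT t|exp_measure. LINT x|lborel. F x * rconv (heat t) F x)"
    by (rule exp_lborel.Fubini_integral[OF *])
  finally show "(LINT x|lborel. F x * rconv (res 1) F x) = (LINT t|exp_measure. LINT x|lborel. F x * rconv (heat t) F x)" .
qed

text \<open>
  The operator inequality \<open>R\<^sub>1\<^sup>2 \<le> R\<^sub>1\<close>: by Jensen's inequality the left side is at most the average over
  time of the squared norm of \<open>e\<^sup>t\<^sup>\<Delta>F\<close>, to which \<open>rconv_heat_square_le_form\<close> applies.
\<close>

lemma rconv_res_1_square_le_form:
  "integrable lborel (\<lambda>x. (rconv (res 1) F x)\<^sup>2)"
  "(LINT x|lborel. (rconv (res 1) F x)\<^sup>2) \<le> (LINT x|lborel. F x * rconv (res 1) F x)"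
proof -
  have [measurable]: "(\<lambda>(t, x). rconv (heat t) F x) \<in> borel_measurable (borel \<Otimes>\<^sub>M borel)"
    unfolding rconv_def by measurable
  let ?q = "\<lambda>t. LINT x|lborel. F x * rconv (heat t) F x"
  have q: "AE t in exp_measure. (LINT x|lborel. (rconv (heat t) F x)\<^sup>2) \<le> ?q t"
    using AE_exp_measure_pos by eventually_elim (rule rconv_heat_square_le_form[OF F_meas F_int F_sq])
  have q0: "AE t in exp_measure. 0 \<le> ?q t"
    using q by eventually_elim (erule order_trans[rotated], auto)
  \<comment> \<open>Jensen's inequality, in the form of the Cauchy-Schwarz inequality with the constant function \<open>1\<close>.\<close>
  have pt: "AE x in lborel. (nabs (rconv (res 1) F) x)\<^sup>2 \<le> (\<integral>\<^sup>+t. (nabs (rconv (heat t) F) x)\<^sup>2 \<partial>exp_measure)"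
    using AE_nconv_nres_1_finite
  proof eventually_elim
    case (elim x)
    have [measurable]: "(\<lambda>t. rconv (heat t) F x) \<in> borel_measurable borel"
      unfolding rconv_def by measurable
    have "nabs (rconv (res 1) F) x \<le> (\<integral>\<^sup>+t. 1 * nabs (rconv (heat t) F) x \<partial>exp_measure)"
      using integral_norm_bound_ennreal[OF rconv_res_1_eq(1)[OF elim]] by (simp add: rconv_res_1_eq(2)[OF elim])
    then have "(nabs (rconv (res 1) F) x)\<^sup>2 \<le> (\<integral>\<^sup>+t. 1 * nabs (rconv (heat t) F) x \<partial>exp_measure)\<^sup>2"
      by (rule power_mono) auto
    also have "\<dots> \<le> (\<integral>\<^sup>+t. 1\<^sup>2 \<partial>exp_measure) * (\<integral>\<^sup>+t. (nabs (rconv (heat t) F) x)\<^sup>2 \<partial>exp_measure)"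
      by (rule Cauchy_Schwarz_nn_integral) auto
    finally show ?case using exp_measure.emeasure_space_1 by simp
  qed
  have "(\<integral>\<^sup>+x. (nabs (rconv (res 1) F) x)\<^sup>2 \<partial>lborel) \<le> (\<integral>\<^sup>+x. \<integral>\<^sup>+t. (nabs (rconv (heat t) F) x)\<^sup>2 \<partial>exp_measure \<partial>lborel)"
    by (intro nn_integral_mono_AE pt)
  also have "\<dots> = (\<integral>\<^sup>+t. \<integral>\<^sup>+x. (nabs (rconv (heat t) F) x)\<^sup>2 \<partial>lborel \<partial>exp_measure)"
    by (rule exp_lborel.Fubini') measurable
  also have "\<dots> \<le> (\<integral>\<^sup>+t. ennreal (?q t) \<partial>exp_measure)"
  proof (rule nn_integral_mono_AE)
    show "AE t in exp_measure. (\<integral>\<^sup>+x. (nabs (rconv (heat t) F) x)\<^sup>2 \<partial>lborel) \<le> ennreal (?q t)"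
      using q AE_exp_measure_pos
    proof eventually_elim
      case (elim t)
      have "(\<integral>\<^sup>+x. (nabs (rconv (heat t) F) x)\<^sup>2 \<partial>lborel) = ennreal (LINT x|lborel. (rconv (heat t) F x)\<^sup>2)"
        by (intro nn_integral_square_finite rconv_heat_L2[OF F_meas F_int F_sq]) (use elim F_sq in auto)
      then show ?case using elim by (simp add: ennreal_leI)
    qed
  qed
  also have "\<dots> = ennreal (LINT x|lborel. F x * rconv (res 1) F x)"
    unfolding rconv_res_1_form(3) using q0 rconv_res_1_form(2) by (simp add: nn_integral_eq_integral)
  finally have *: "(\<integral>\<^sup>+x. (nabs (rconv (res 1) F) x)\<^sup>2 \<partial>lborel) \<le> ennreal (LINT x|lborel. F x * rconv (res 1) F x)" .
  have "0 \<le> (LINT x|lborel. F x * rconv (res 1) F x)"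
    unfolding rconv_res_1_form(3) using q0 by (rule integral_nonneg_AE)
  from square_integrable_if_nn_integral_le[OF _ * this]
  show "integrable lborel (\<lambda>x. (rconv (res 1) F x)\<^sup>2)"
    "(LINT x|lborel. (rconv (res 1) F x)\<^sup>2) \<le> (LINT x|lborel. F x * rconv (res 1) F x)"
    by auto
qed

text \<open>
  Expanding the square leaves \<open>\<parallel>F\<parallel>\<^sup>2 - 2\<langle>F, R\<^sub>1F\<rangle> + \<parallel>R\<^sub>1F\<parallel>\<^sup>2\<close>, and \<open>R\<^sub>1\<^sup>2 \<le> R\<^sub>1\<close> makes the last two terms
  nonpositive in total.
\<close>

theorem rconv_res_1_complement_L2_le:
  "integrable lborel (\<lambda>x. (F x - rconv (res 1) F x)\<^sup>2)"
  "(LINT x|lborel. (F x - rconv (res 1) F x)\<^sup>2) \<le> (LINT x|lborel. (F x)\<^sup>2)"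
proof -
  let ?B = "rconv (res 1) F"
  have eq: "(F x - ?B x)\<^sup>2 = (F x)\<^sup>2 - 2 * (F x * ?B x) + (?B x)\<^sup>2" for x
    by (simp add: power2_eq_square algebra_simps)
  note i = F_sq rconv_res_1_form(1) rconv_res_1_square_le_form(1)
  show "integrable lborel (\<lambda>x. (F x - ?B x)\<^sup>2)"
    unfolding eq using i by auto
  have "(LINT x|lborel. (F x - ?B x)\<^sup>2) = (LINT x|lborel. (F x)\<^sup>2) - 2 * (LINT x|lborel. F x * ?B x) + (LINT x|lborel. (?B x)\<^sup>2)"
    unfolding eq using i by simp
  moreover have "0 \<le> (LINT x|lborel. (?B x)\<^sup>2)" by simp
  ultimately show "(LINT x|lborel. (F x - ?B x)\<^sup>2) \<le> (LINT x|lborel. (F x)\<^sup>2)"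
    using rconv_res_1_square_le_form(2) by linarith
qed

end

section \<open>Calculus of test functions\<close>

text \<open>
  The partial derivatives are defined through the Frechet derivative, so they determine it, also
  relative to a set \<open>S\<close>.
\<close>

lemma has_derivative_partials:
  fixes f :: "real^'k \<Rightarrow> real"
  assumes "f differentiable (at x within S)"
  shows "(f has_derivative (\<lambda>v. \<Sum>i\<in>UNIV. v $ i * partial_deriv_on S i f x)) (at x within S)"
proof -
  let ?D = "frechet_derivative f (at x within S)"
  have D: "(f has_derivative ?D) (at x within S)" using assms frechet_derivative_works by blast
  then interpret D: bounded_linear ?D by (rule has_derivative_bounded_linear)
  have "?D v = (\<Sum>i\<in>UNIV. v $ i * partial_deriv_on S i f x)" for v
  proof -
    have "?D v = ?D (\<Sum>i\<in>UNIV. v $ i *\<^sub>R axis i 1)"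
      by (simp add: basis_expansion flip: scalar_mult_eq_scaleR)
    then show ?thesis by (simp add: D.sum D.scaleR partial_deriv_on_def)
  qed
  then have "?D = (\<lambda>v. \<Sum>i\<in>UNIV. v $ i * partial_deriv_on S i f x)" by (rule ext)
  with D show ?thesis by simp
qed

lemma partial_deriv_add:
  assumes "f differentiable at x" "g differentiable at x"
  shows "partial_deriv_on UNIV i (\<lambda>x. f x + g x) x = partial_deriv_on UNIV i f x + partial_deriv_on UNIV i g x"
proof -
  obtain D E where DE: "(f has_derivative D) (at x)" "(g has_derivative E) (at x)"
    using assms by (auto simp: differentiable_def)
  show ?thesis
    using partial_deriv_on_UNIV[OF has_derivative_add[OF DE]] by (simp add: partial_deriv_on_UNIV[OF DE(1)] partial_deriv_on_UNIV[OF DE(2)])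
qed

lemma partial_deriv_cmult:
  assumes "f differentiable at x"
  shows "partial_deriv_on UNIV i (\<lambda>x. c * f x) x = c * partial_deriv_on UNIV i f x"
proof -
  obtain D where D: "(f has_derivative D) (at x)"
    using assms by (auto simp: differentiable_def)
  show ?thesis
    using partial_deriv_on_UNIV[OF has_derivative_mult_right[OF D]] by (simp add: partial_deriv_on_UNIV[OF D])
qed

lemma partial_deriv_translate:
  assumes "f differentiable at (a + x)"
  shows "partial_deriv_on UNIV i (\<lambda>x. f (a + x)) x = partial_deriv_on UNIV i f (a + x)"
    and "(\<lambda>x. f (a + x)) differentiable at x"
proof -
  obtain D where D: "(f has_derivative D) (at (a + x))"
    using assms by (auto simp: differentiable_def)
  have "((\<lambda>x. a + x) has_derivative (\<lambda>x. x)) (at x)" by (auto intro!: derivative_eq_intros)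
  from has_derivative_compose[OF this D]
  have *: "((\<lambda>x. f (a + x)) has_derivative D) (at x)" by simp
  then show "(\<lambda>x. f (a + x)) differentiable at x" by (auto simp: differentiable_def)
  show "partial_deriv_on UNIV i (\<lambda>x. f (a + x)) x = partial_deriv_on UNIV i f (a + x)"
    using partial_deriv_on_UNIV[OF *] partial_deriv_on_UNIV[OF D] by simp
qed

lemma Ck_on_add: "Ck_on k UNIV f \<Longrightarrow> Ck_on k UNIV g \<Longrightarrow> Ck_on k UNIV (\<lambda>x. f x + g x)"
proof (induction k arbitrary: f g)
  case 0
  then show ?case by (auto intro: continuous_on_add)
next
  case (Suc k)
  then have d: "f differentiable at x" "g differentiable at x" for x by (auto simp: differentiable_on_def)
  have "partial_deriv_on UNIV i (\<lambda>x. f x + g x) = (\<lambda>x. partial_deriv_on UNIV i f x + partial_deriv_on UNIV i g x)" for i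
    using partial_deriv_add[OF d] by blast
  then show ?case using Suc by (auto simp: differentiable_on_def)
qed

lemma Ck_on_cmult: "Ck_on k UNIV f \<Longrightarrow> Ck_on k UNIV (\<lambda>x. c * f x)"
proof (induction k arbitrary: f)
  case 0
  then show ?case by (auto intro: continuous_intros)
next
  case (Suc k)
  then have d: "f differentiable at x" for x by (auto simp: differentiable_on_def)
  have "partial_deriv_on UNIV i (\<lambda>x. c * f x) = (\<lambda>x. c * partial_deriv_on UNIV i f x)" for i
    using partial_deriv_cmult[OF d] by blast
  then show ?case using Suc by (auto simp: differentiable_on_def)
qed

lemma Ck_on_translate: "Ck_on k UNIV f \<Longrightarrow> Ck_on k UNIV (\<lambda>x. f (a + x))"
proof (induction k arbitrary: f)
  case 0
  then have "continuous_on UNIV f" by simp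
  then have "continuous_on UNIV (\<lambda>x. f (a + x))"
    by (rule continuous_on_compose2) (auto intro: continuous_intros)
  then show ?case by simp
next
  case (Suc k)
  then have d: "f differentiable at x" for x by (auto simp: differentiable_on_def)
  have "partial_deriv_on UNIV i (\<lambda>x. f (a + x)) = (\<lambda>x. partial_deriv_on UNIV i f (a + x))" for i
    using partial_deriv_translate(1)[OF d] by blast
  then show ?case using Suc partial_deriv_translate(2)[OF d] by (auto simp: differentiable_on_def)
qed

text \<open>
  Compactness of the support in the form that is preserved most directly by the operations below.
\<close>

lemma test_function_iff:
  "test_function f \<longleftrightarrow> (\<forall>k. Ck_on k UNIV f) \<and> (\<exists>R. \<forall>x. norm x > R \<longrightarrow> f x = 0)"
proof -
  have "compact (closure {x. f x \<noteq> 0}) \<longleftrightarrow> bounded {x. f x \<noteq> 0}" by simp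
  also have "\<dots> \<longleftrightarrow> (\<exists>R. \<forall>x. norm x > R \<longrightarrow> f x = 0)"
    by (auto simp: bounded_iff) (metis not_le)+
  finally show ?thesis by (simp add: test_function_def)
qed

lemma test_function_differentiable: "test_function f \<Longrightarrow> f differentiable at x"
  unfolding test_function_iff by (metis Ck_on.simps(2) differentiable_on_def UNIV_I)

lemma test_function_continuous: "test_function f \<Longrightarrow> continuous_on S f"
  unfolding test_function_iff by (metis Ck_on.simps(1) continuous_on_subset subset_UNIV)

lemma test_function_partial:
  assumes "test_function f"
  shows "test_function (partial_deriv_on UNIV i f)"
proof -
  have "Ck_on k UNIV (partial_deriv_on UNIV i f)" for k
    using assms unfolding test_function_iff by (metis Ck_on.simps(2))
  moreover obtain R where R: "\<And>x. norm x > R \<Longrightarrow> f x = 0"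
    using assms unfolding test_function_iff by blast
  have "partial_deriv_on UNIV i f x = 0" if x: "norm x > R" for x
  proof -
    have "((\<lambda>_. 0) has_derivative (\<lambda>_. 0)) (at x)" by simp
    then have "(f has_derivative (\<lambda>_. 0)) (at x)"
    proof (rule has_derivative_transform_within_open)
      show "open (- cball 0 R)" by (simp add: open_Compl)
    qed (use x R in auto)
    then show ?thesis by (simp add: partial_deriv_on_UNIV)
  qed
  ultimately show ?thesis unfolding test_function_iff by blast
qed

lemma test_function_add:
  assumes "test_function f" "test_function g"
  shows "test_function (\<lambda>x. f x + g x)"
proof -
  obtain R R' where "\<And>x. norm x > R \<Longrightarrow> f x = 0" "\<And>x. norm x > R' \<Longrightarrow> g x = 0"
    using assms unfolding test_function_iff by metis
  then have "\<forall>x. norm x > max R R' \<longrightarrow> f x + g x = 0" by simp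
  then show ?thesis using assms Ck_on_add unfolding test_function_iff by blast
qed

lemma test_function_cmult: "test_function f \<Longrightarrow> test_function (\<lambda>x. c * f x)"
  using Ck_on_cmult unfolding test_function_iff by (metis mult_zero_right)

lemma test_function_diff: "test_function f \<Longrightarrow> test_function g \<Longrightarrow> test_function (\<lambda>x. f x - g x)"
  using test_function_add[of f "\<lambda>x. -1 * g x"] test_function_cmult[of g "-1"] by simp

lemma test_function_0: "test_function (\<lambda>_. 0)"
proof -
  have "Ck_on k UNIV (\<lambda>_::real^'a. 0)" for k
    by (induction k) (auto simp: partial_deriv_on_UNIV[OF has_derivative_const, abs_def])
  then show ?thesis by (auto simp: test_function_iff)
qed

lemma test_function_sum: "(\<And>i. i \<in> A \<Longrightarrow> test_function (f i)) \<Longrightarrow> test_function (\<lambda>x. \<Sum>i\<in>A. f i x)"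
  by (induction A rule: infinite_finite_induct) (auto intro: test_function_add test_function_0)

lemma test_function_laplacian: "test_function f \<Longrightarrow> test_function (laplacian f)"
  unfolding laplacian_def[abs_def] by (intro test_function_sum test_function_partial)

lemma test_function_translate:
  assumes "test_function f"
  shows "test_function (\<lambda>x. f (a + x))"
proof -
  obtain R where R: "\<And>x. norm x > R \<Longrightarrow> f x = 0"
    using assms unfolding test_function_iff by metis
  have "f (a + x) = 0" if "norm x > R + norm a" for x
    using that norm_triangle_ineq4[of "a + x" a] by (intro R) simp
  then show ?thesis using assms Ck_on_translate unfolding test_function_iff by blast
qed

lemma laplacian_translate:
  assumes "test_function f"
  shows "laplacian (\<lambda>x. f (a + x)) = (\<lambda>x. laplacian f (a + x))"
proof -
  have "partial_deriv_on UNIV i (\<lambda>x. g (a + x)) = (\<lambda>x. partial_deriv_on UNIV i g (a + x))"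
    if "test_function g" for g i
    using partial_deriv_translate(1)[OF test_function_differentiable[OF that]] by blast
  then show ?thesis
    unfolding laplacian_def[abs_def] using assms by (simp add: test_function_partial)
qed

lemma continuous_compact_support_bounded:
  fixes f :: "'a::euclidean_space \<Rightarrow> real"
  assumes "continuous_on UNIV f" "\<And>x. norm x > R \<Longrightarrow> f x = 0"
  obtains C where "C > 0" "\<And>x. \<bar>f x\<bar> \<le> C * indicator (cball 0 R) x"
proof -
  have "compact (f ` cball 0 R)"
    by (intro compact_continuous_image continuous_on_subset[OF assms(1)]) auto
  then obtain C where C: "C > 0" "\<And>x. x \<in> cball 0 R \<Longrightarrow> norm (f x) \<le> C"
    using bounded_pos[of "f ` cball 0 R"] compact_imp_bounded by auto
  have "\<bar>f x\<bar> \<le> C * indicator (cball 0 R) x" for x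
    using C(2)[of x] assms(2)[of x] by (auto simp: indicator_def)
  then show thesis using C(1) that by blast
qed

lemma integrable_if_le_indicator:
  fixes f :: "'a::euclidean_space \<Rightarrow> real"
  assumes [measurable]: "f \<in> borel_measurable borel" and "\<And>x. \<bar>f x\<bar> \<le> C * indicator (cball 0 R) x"
  shows "integrable lborel f"
proof (rule Bochner_Integration.integrable_bound)
  show "integrable lborel (\<lambda>x. C * indicator (cball 0 R) x)"
    by (intro integrable_mult_right integrable_real_indicator) (use emeasure_bounded_finite[OF bounded_cball] in \<open>auto simp: less_top\<close>)
  show "AE x in lborel. norm (f x) \<le> norm (C * indicator (cball 0 R) x)"
    using assms(2) by (intro AE_I2) (metis abs_ge_self order_trans real_norm_def)
qed auto

lemma continuous_compact_support_integrable:
  fixes f :: "'a::euclidean_space \<Rightarrow> real"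
  assumes "continuous_on UNIV f" "\<And>x. norm x > R \<Longrightarrow> f x = 0"
  shows "integrable lborel f"
proof -
  obtain C where C: "C > 0" "\<And>x. \<bar>f x\<bar> \<le> C * indicator (cball 0 R) x"
    using continuous_compact_support_bounded[OF assms] by blast
  then show ?thesis
    by (intro integrable_if_le_indicator[where C = C and R = R] borel_measurable_continuous_onI assms(1))
qed

lemma test_functionE:
  fixes f :: "real^'k \<Rightarrow> real"
  assumes "test_function f"
  obtains C R where "C > 0" "\<And>x. \<bar>f x\<bar> \<le> C * indicator (cball 0 R) x"
proof -
  obtain R where R: "\<And>x. norm x > R \<Longrightarrow> f x = 0"
    using assms unfolding test_function_iff by metis
  show thesis
    using continuous_compact_support_bounded[OF test_function_continuous[OF assms] R] that by metis
qed

lemma test_function_borel [measurable_dest]: "test_function f \<Longrightarrow> f \<in> borel_measurable borel"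
  by (intro borel_measurable_continuous_onI test_function_continuous)

lemma test_function_integrable:
  assumes "test_function f"
  shows "integrable lborel f" "integrable lborel (\<lambda>x. (f x)\<^sup>2)"
proof -
  obtain R where R: "\<And>x. norm x > R \<Longrightarrow> f x = 0"
    using assms unfolding test_function_iff by metis
  show "integrable lborel f"
    using R by (intro continuous_compact_support_integrable[of _ R] test_function_continuous assms)
  show "integrable lborel (\<lambda>x. (f x)\<^sup>2)"
    using R by (intro continuous_compact_support_integrable[of _ R] continuous_intros test_function_continuous assms) auto
qed

text \<open>
  The integral of \<open>h (x + e) - h x\<close> vanishes by translation invariance, and by the fundamental theorem
  of calculus along the segment it equals the integral of the directional derivative.
\<close>

lemma integral_directional_derivative_eq_0:
  fixes h :: "'a::euclidean_space \<Rightarrow> real"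
  assumes deriv: "\<And>x. (h has_derivative h' x) (at x)"
    and cont: "continuous_on UNIV (\<lambda>x. h' x e)"
    and supp: "\<And>x. norm x > R \<Longrightarrow> h x = 0" "\<And>x. norm x > R \<Longrightarrow> h' x e = 0"
  shows "(LINT x|lborel. h' x e) = 0"
proof -
  define g where "g x = h' x e" for x
  have ch: "continuous_on UNIV h"
    using deriv by (metis has_derivative_continuous continuous_at_imp_continuous_on)
  have cg: "continuous_on UNIV g" using cont by (simp add: g_def[abs_def])
  note [measurable] = borel_measurable_continuous_onI[OF ch] borel_measurable_continuous_onI[OF cg]
  have ih: "integrable lborel h" by (rule continuous_compact_support_integrable[OF ch supp(1)])
  have ig: "integrable lborel g" 
    using supp(2) by (intro continuous_compact_support_integrable[OF cg, of R]) (simp add: g_def)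
  have ftc: "(LINT r|lborel. indicator {0..1} r * g (x + r *\<^sub>R e)) = h (x + e) - h x" for x
  proof -
    have "(LINT r|lborel. indicator {0..1} r *\<^sub>R g (x + r *\<^sub>R e)) = h (x + 1 *\<^sub>R e) - h (x + 0 *\<^sub>R e)"
    proof (rule integral_FTC_Icc)
      show "continuous_on {0..1} (\<lambda>r. g (x + r *\<^sub>R e))"
        by (rule continuous_on_compose2[OF cg]) (auto intro!: continuous_intros)
      fix r :: real
      have "((\<lambda>r. x + r *\<^sub>R e) has_derivative (\<lambda>r. r *\<^sub>R e)) (at r)"
        by (auto intro!: derivative_eq_intros)
      from has_derivative_compose[OF this deriv]
      have "((\<lambda>r. h (x + r *\<^sub>R e)) has_derivative (\<lambda>r'. h' (x + r *\<^sub>R e) (r' *\<^sub>R e))) (at r)" .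
      moreover have "h' (x + r *\<^sub>R e) (r' *\<^sub>R e) = r' *\<^sub>R g (x + r *\<^sub>R e)" for r'
        using linear_cmul[OF has_derivative_linear[OF deriv]] by (simp add: g_def)
      ultimately show "((\<lambda>r. h (x + r *\<^sub>R e)) has_vector_derivative g (x + r *\<^sub>R e)) (at r within {0..1})"
        by (simp add: has_vector_derivative_def has_derivative_at_withinI)
    qed auto
    then show ?thesis by simp
  qed
  have "(\<integral>\<^sup>+r. \<integral>\<^sup>+x. ennreal \<bar>indicator {0..1} r * g (x + r *\<^sub>R e)\<bar> \<partial>lborel \<partial>lborel)
    = (\<integral>\<^sup>+r. indicator {0..1} r * (\<integral>\<^sup>+x. ennreal \<bar>g x\<bar> \<partial>lborel) \<partial>(lborel :: real measure))"
  proof (rule nn_integral_cong)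
    fix r :: real
    show "(\<integral>\<^sup>+x. ennreal \<bar>indicator {0..1} r * g (x + r *\<^sub>R e)\<bar> \<partial>lborel) = indicator {0..1} r * (\<integral>\<^sup>+x. ennreal \<bar>g x\<bar> \<partial>lborel)"
      using nn_integral_lborel_translate(1)[of "\<lambda>x. ennreal \<bar>g x\<bar>" "r *\<^sub>R e"]
      by (auto simp: indicator_def add.commute)
  qed
  also have "\<dots> < \<infinity>"
    using ig by (simp add: nn_integral_multc integrable_iff_bounded)
  finally have "integrable (lborel \<Otimes>\<^sub>M lborel) (\<lambda>(r::real, x). indicator {0..1} r * g (x + r *\<^sub>R e))"
    by (subst integrable_iff_bounded) (simp add: lborel.nn_integral_fst[symmetric] split_beta')
  from lborel_pair.Fubini_integral[OF this]
  have "(LINT x|lborel. LINT r|lborel. indicator {0..1} r * g (x + r *\<^sub>R e)) =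
    (LINT r|lborel. LINT x|lborel. indicator {0..1} r * g (x + r *\<^sub>R e))" .
  also have "\<dots> = (LINT r|lborel. indicator {0..1::real} r * (LINT x|lborel. g x))"
    using integral_lborel_translate(1)[of g "_ *\<^sub>R e"] by (simp add: add.commute)
  also have "\<dots> = (LINT x|lborel. g x)" by simp
  also have "(LINT x|lborel. LINT r|lborel. indicator {0..1} r * g (x + r *\<^sub>R e)) = 0"
    unfolding ftc using integral_lborel_translate[of h e] ih
    by (simp add: add.commute)
  finally show ?thesis by (simp add: g_def)
qed

section \<open>Gaussian integration by parts\<close>

text \<open>
  The speed \<open>1/\<surd>(2t)\<close> at which \<open>\<surd>(2t) w\<close> moves, for a unit vector \<open>w\<close>, is singular but integrable at \<open>t = 0\<close>.
\<close>

lemma nn_integral_inverse_sqrt: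
  assumes "T > 0"
  shows "(\<integral>\<^sup>+t. indicator {0<..<T} t * ennreal (1 / sqrt (2 * t)) \<partial>lborel) = ennreal (sqrt (2 * T))"
proof -
  have d: "((\<lambda>t. sqrt (2 * t)) has_real_derivative 1 / sqrt (2 * t)) (at t)" if "t > 0" for t
    using that by (auto intro!: derivative_eq_intros simp: field_simps)
  have A: "(((\<lambda>t. sqrt (2 * t)) \<circ> real_of_ereal) \<longlongrightarrow> 0) (at_right (ereal 0))"
    unfolding ereal_tendsto_simps by (rule tendsto_eq_intros | simp)+
  have B: "(((\<lambda>t. sqrt (2 * t)) \<circ> real_of_ereal) \<longlongrightarrow> sqrt (2 * T)) (at_left (ereal T))"
    unfolding ereal_tendsto_simps by (rule tendsto_eq_intros | simp)+
  have c: "isCont (\<lambda>t. 1 / sqrt (2 * t)) t" if "t > 0" for t using that by (auto intro!: continuous_intros)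
  note * = interval_integral_FTC_nonneg[of "ereal 0" "ereal T" "\<lambda>t. sqrt (2 * t)" "\<lambda>t. 1 / sqrt (2 * t)", OF _ _ _ _ A B]
  have i: "set_integrable lborel {0<..<T} (\<lambda>t. 1 / sqrt (2 * t))"
    using *(1) assms d c by simp
  have v: "(LBINT t=ereal 0..ereal T. 1 / sqrt (2 * t)) = sqrt (2 * T)"
    using *(2) assms d c by simp
  have "(\<integral>\<^sup>+t. indicator {0<..<T} t * ennreal (1 / sqrt (2 * t)) \<partial>lborel)
     = (\<integral>\<^sup>+t. ennreal (indicator {0<..<T} t *\<^sub>R (1 / sqrt (2 * t))) \<partial>lborel)"
    by (intro nn_integral_cong) (auto simp: indicator_def)
  also have "\<dots> = ennreal (LINT t:{0<..<T}|lborel. 1 / sqrt (2 * t))"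
    using i unfolding set_integrable_def set_lebesgue_integral_def
    by (intro nn_integral_eq_integral) (auto simp: indicator_def)
  also have "(LINT t:{0<..<T}|lborel. 1 / sqrt (2 * t)) = sqrt (2 * T)"
    using v assms by (simp add: interval_lebesgue_integral_def)
  finally show ?thesis .
qed

lemma heat_half_has_derivative:
  "(heat (1/2) has_derivative (\<lambda>v. - (z \<bullet> v) * heat (1/2) z)) (at (z::'a::euclidean_space))"
proof -
  have e: "heat (1/2) = (\<lambda>z::'a. (2 * pi) powr (- real DIM('a) / 2) * exp (- (z \<bullet> z) / 2))"
    by (simp add: heat_def[abs_def] power2_norm_eq_inner)
  show ?thesis unfolding e
    by (auto intro!: derivative_eq_intros simp: inner_commute fun_eq_iff)
qed

lemma test_function_affine_support:
  assumes f: "test_function f" and s: "s > 0"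
  shows "\<exists>R. \<forall>z. norm z > R \<longrightarrow> f (y + s *\<^sub>R z) = 0"
proof -
  obtain R where R: "\<And>x. norm x > R \<Longrightarrow> f x = 0" using f unfolding test_function_iff by metis
  have "f (y + s *\<^sub>R z) = 0" if "norm z > (R + norm y) / s" for z
  proof (rule R)
    have "R + norm y < s * norm z" using that s by (simp add: field_simps)
    then show "R < norm (y + s *\<^sub>R z)" using norm_triangle_ineq4[of "y + s *\<^sub>R z" y] s by simp
  qed
  then show ?thesis by blast
qed

lemma test_function_affine_continuous:
  "test_function f \<Longrightarrow> continuous_on S (\<lambda>z. f (y + s *\<^sub>R z))"
  by (rule continuous_on_compose2[OF test_function_continuous[of f UNIV]]) (auto intro!: continuous_intros)

lemma continuous_heat_half: "continuous_on S (heat (1/2))"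
  using heat_half_has_derivative by (metis has_derivative_continuous continuous_at_imp_continuous_on)

lemma integrable_gaussian_test_function:
  assumes "test_function f" "s > 0" "continuous_on UNIV p"
  shows "integrable lborel (\<lambda>z. heat (1/2) z * (p z * f (y + s *\<^sub>R z)))"
proof -
  obtain R where "\<And>z. norm z > R \<Longrightarrow> f (y + s *\<^sub>R z) = 0"
    using test_function_affine_support[OF assms(1,2)] by blast
  then show ?thesis
    by (intro continuous_compact_support_integrable[of _ R] continuous_intros continuous_heat_half
        test_function_affine_continuous assms) auto
qed

text \<open>
  Since \<open>z\<^sub>i\<close> times the Gaussian is minus its \<open>i\<close>-th derivative, integration by parts moves this
  derivative onto \<open>\<partial>\<^sub>i\<psi>\<close>, where the chain rule contributes the factor \<open>s\<close>.
\<close>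

lemma gaussian_ibp:
  fixes \<psi> :: "real^'k \<Rightarrow> real"
  assumes \<psi>: "test_function \<psi>" and s: "s > 0"
  shows "(LINT z|lborel. heat (1/2) z * (\<Sum>i\<in>UNIV. z $ i * partial_deriv_on UNIV i \<psi> (y + s *\<^sub>R z)))
     = s * (LINT z|lborel. heat (1/2) z * laplacian \<psi> (y + s *\<^sub>R z))"
proof -
  let ?D = "\<lambda>i. partial_deriv_on UNIV i"
  note supp = test_function_affine_support[OF _ s, of _ y]
    and cont = test_function_affine_continuous[of _ _ y s] and conth = continuous_heat_half
  have one: "integrable lborel (\<lambda>z. heat (1/2) z * (z $ i * ?D i \<psi> (y + s *\<^sub>R z)))"
     "integrable lborel (\<lambda>z. heat (1/2) z * ?D i (?D i \<psi>) (y + s *\<^sub>R z))"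
     "(LINT z|lborel. heat (1/2) z * (z $ i * ?D i \<psi> (y + s *\<^sub>R z))) = s * (LINT z|lborel. heat (1/2) z * ?D i (?D i \<psi>) (y + s *\<^sub>R z))" for i
  proof -
    let ?f = "?D i \<psi>"
    have f: "test_function ?f" and Df: "test_function (?D i ?f)" using \<psi> by (simp_all add: test_function_partial)
    obtain R where R: "\<And>z. norm z > R \<Longrightarrow> ?f (y + s *\<^sub>R z) = 0" using supp[OF f] by blast
    obtain R' where R': "\<And>z. norm z > R' \<Longrightarrow> ?D i ?f (y + s *\<^sub>R z) = 0" using supp[OF Df] by blast
    show i1: "integrable lborel (\<lambda>z. heat (1/2) z * (z $ i * ?f (y + s *\<^sub>R z)))"
      by (intro integrable_gaussian_test_function f s continuous_intros)
    show i2: "integrable lborel (\<lambda>z. heat (1/2) z * ?D i ?f (y + s *\<^sub>R z))"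
      using integrable_gaussian_test_function[OF Df s, of "\<lambda>_. 1"] by simp
    let ?h' = "\<lambda>z v. heat (1/2) z * (\<Sum>j\<in>UNIV. (s *\<^sub>R v) $ j * ?D j ?f (y + s *\<^sub>R z)) + - (z \<bullet> v) * heat (1/2) z * ?f (y + s *\<^sub>R z)"
    have h'e: "?h' z (axis i 1) = s * (heat (1/2) z * ?D i ?f (y + s *\<^sub>R z)) - heat (1/2) z * (z $ i * ?f (y + s *\<^sub>R z))" for z
    proof -
      have "(\<Sum>j\<in>UNIV. (s *\<^sub>R axis i 1) $ j * ?D j ?f (y + s *\<^sub>R z)) = (\<Sum>j\<in>UNIV. if j = i then s * ?D i ?f (y + s *\<^sub>R z) else 0)"
        by (intro sum.cong) (auto simp: axis_def)
      then show ?thesis by (simp add: inner_axis mult_ac)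
    qed
    have "(LINT z|lborel. ?h' z (axis i 1)) = 0"
    proof (rule integral_directional_derivative_eq_0[where h = "\<lambda>z. heat (1/2) z * ?f (y + s *\<^sub>R z)" and h' = ?h' and e = "axis i 1" and R = "max R R'"])
      fix z
      have "((\<lambda>z. y + s *\<^sub>R z) has_derivative (\<lambda>v. s *\<^sub>R v)) (at z)" by (auto intro!: derivative_eq_intros)
      from has_derivative_compose[OF this has_derivative_partials[OF test_function_differentiable[OF f]]]
      show "((\<lambda>z. heat (1/2) z * ?f (y + s *\<^sub>R z)) has_derivative ?h' z) (at z)"
        by (intro has_derivative_mult heat_half_has_derivative)
    next
      show "continuous_on UNIV (\<lambda>z. ?h' z (axis i 1))"
        unfolding h'e by (intro continuous_intros cont conth f Df)
    next
      fix z :: "real^'k" assume "norm z > max R R'"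
      then show "heat (1/2) z * ?f (y + s *\<^sub>R z) = 0" "?h' z (axis i 1) = 0"
        unfolding h'e by (simp_all add: R R')
    qed
    then show "(LINT z|lborel. heat (1/2) z * (z $ i * ?f (y + s *\<^sub>R z))) = s * (LINT z|lborel. heat (1/2) z * ?D i ?f (y + s *\<^sub>R z))"
      unfolding h'e using i1 i2 by simp
  qed
  have "(LINT z|lborel. heat (1/2) z * (\<Sum>i\<in>UNIV. z $ i * ?D i \<psi> (y + s *\<^sub>R z)))
     = (\<Sum>i\<in>UNIV. LINT z|lborel. heat (1/2) z * (z $ i * ?D i \<psi> (y + s *\<^sub>R z)))"
    unfolding sum_distrib_left by (rule Bochner_Integration.integral_sum) (rule one(1))
  also have "\<dots> = s * (LINT z|lborel. heat (1/2) z * laplacian \<psi> (y + s *\<^sub>R z))"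
    unfolding one(3) laplacian_def sum_distrib_left
    by (subst Bochner_Integration.integral_sum) (auto intro: one(2) simp: sum_distrib_left)
  finally show ?thesis .
qed

section \<open>Resolvent kernels as fundamental solutions\<close>

text \<open>
  Near \<open>t = 0\<close> boundedness of \<open>f\<close> is used, for large \<open>t\<close> the decay of the heat kernel, which is
  integrable for \<open>d > 2\<close>.
\<close>

lemma nconv_nres_0_finite:
  fixes f :: "'a::euclidean_space \<Rightarrow> ennreal"
  assumes [measurable]: "f \<in> borel_measurable borel" and d: "DIM('a) > 2"
    and bound: "\<And>x. f x \<le> ennreal C" and int: "(\<integral>\<^sup>+x. f x \<partial>lborel) < \<infinity>"
  shows "nconv (nres 0) f x < \<infinity>"
proof -
  let ?d = "real DIM('a)"
  let ?A = "ennreal ((4 * pi) powr (- ?d / 2)) * (\<integral>\<^sup>+x. f x \<partial>lborel)"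
  have 1: "nconv (nheat t) f x \<le> ennreal C" if "t > 0" for t
  proof -
    have "nconv (nheat t) f x \<le> (\<integral>\<^sup>+y. nheat t (x - y) * ennreal C \<partial>lborel)"
      unfolding nconv_def by (intro nn_integral_mono mult_left_mono bound) auto
    also have "\<dots> = ennreal C"
      using nn_integral_heat[OF that, where 'a = 'a] nn_integral_lborel_reflect[of "nheat t :: 'a \<Rightarrow> ennreal" x]
      by (simp add: nn_integral_multc)
    finally show ?thesis .
  qed
  have "nconv (nres 0) f x \<le> (\<integral>\<^sup>+t. ennreal C * indicator {0..1} t + indicator {1<..} t * ennreal (t powr (- ?d / 2)) * ?A \<partial>lborel)"
    unfolding nconv_nres[OF assms(1)]
  proof (rule nn_integral_mono)
    fix t :: real
    consider "t \<le> 0" | "0 < t" "t \<le> 1" | "t > 1" by linarith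
    then show "indicator {0<..} t * ennreal (exp (- 0 * t)) * nconv (nheat t) f x
      \<le> ennreal C * indicator {0..1} t + indicator {1<..} t * ennreal (t powr (- ?d / 2)) * ?A"
    proof cases
      case 3
      have "nconv (nheat t) f x \<le> ennreal ((4 * pi * t) powr (- ?d / 2)) * (\<integral>\<^sup>+x. f x \<partial>lborel)"
        using nconv_heat_le[of f t] 3 by auto
      also have "(4 * pi * t) powr (- ?d / 2) = t powr (- ?d / 2) * (4 * pi) powr (- ?d / 2)"
        using 3 by (simp add: powr_mult)
      finally show ?thesis using 3 by (simp add: ennreal_mult mult.assoc)
    qed (use 1 in auto)
  qed
  also have "\<dots> = ennreal C + ennreal (1 powr (- ?d / 2 + 1) / (?d / 2 - 1)) * ?A"
  proof -
    have "(\<integral>\<^sup>+t. indicator {1<..} t * ennreal (t powr (- ?d / 2)) \<partial>lborel) = ennreal (1 powr (- ?d / 2 + 1) / (- (- ?d / 2) - 1))"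
      using d by (intro nn_integral_powr_tail) auto
    then show ?thesis
      by (subst nn_integral_add) (auto simp: nn_integral_multc nn_integral_cmult)
  qed
  also have "\<dots> < \<infinity>"
    using int by (simp add: ennreal_mult_less_top)
  finally show ?thesis .
qed

lemma nabs_res_le: "nabs (res l) x \<le> nres l x"
  by (simp add: res_def) (metis ennreal_enn2real_if top_greatest zero_le order_refl)

lemma res_eq_integral: "res l x = (LINT t|lborel. indicator {0<..} t * exp (- l * t) * heat t x)"
proof -
  have "(LINT t|lborel. indicator {0<..} t * exp (- l * t) * heat t x) = enn2real (\<integral>\<^sup>+t. ennreal (indicator {0<..} t * exp (- l * t) * heat t x) \<partial>lborel)"
    by (rule integral_eq_nn_integral) auto
  also have "(\<integral>\<^sup>+t. ennreal (indicator {0<..} t * exp (- l * t) * heat t x) \<partial>lborel) = nres l x"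
    unfolding nres_def by (intro nn_integral_cong) (auto simp: indicator_def ennreal_mult)
  finally show ?thesis by (simp add: res_def)
qed

lemma integrable_rconv_res:
  fixes h :: "'a::euclidean_space \<Rightarrow> real"
  assumes [measurable]: "h \<in> borel_measurable borel" and fin: "nconv (nres l) (nabs h) x < \<infinity>"
  shows "integrable lborel (\<lambda>y. res l (x - y) * h y)"
proof (rule integrableI_bounded)
  have "(\<integral>\<^sup>+y. ennreal (norm (res l (x - y) * h y)) \<partial>lborel) \<le> nconv (nres l) (nabs h) x"
    unfolding nconv_def using nabs_res_le[of l]
    by (intro nn_integral_mono) (auto simp: abs_mult ennreal_mult intro!: mult_right_mono)
  then show "(\<integral>\<^sup>+y. ennreal (norm (res l (x - y) * h y)) \<partial>lborel) < \<infinity>"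
    using fin by (rule le_less_trans)
qed auto

lemma rconv_res_eq:
  fixes h :: "'a::euclidean_space \<Rightarrow> real"
  assumes [measurable]: "h \<in> borel_measurable borel" and fin: "nconv (nres l) (nabs h) x < \<infinity>"
  shows "rconv (res l) h x = (LINT t|lborel. indicator {0<..} t * exp (- l * t) * rconv (heat t) h x)"
proof -
  have "(\<integral>\<^sup>+t. \<integral>\<^sup>+y. ennreal \<bar>indicator {0<..} t * exp (- l * t) * (heat t (x - y) * h y)\<bar> \<partial>lborel \<partial>lborel)
     = (\<integral>\<^sup>+t. indicator {0<..} t * ennreal (exp (- l * t)) * nconv (nheat t) (nabs h) x \<partial>lborel)"
    unfolding nconv_def
    by (intro nn_integral_cong, subst nn_integral_cmult[symmetric]) (auto simp: indicator_def abs_mult ennreal_mult intro!: nn_integral_cong)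
  also have "\<dots> < \<infinity>" using fin by (simp add: nconv_nres)
  finally have *: "integrable (lborel \<Otimes>\<^sub>M lborel) (\<lambda>(t, y). indicator {0<..} t * exp (- l * t) * (heat t (x - y) * h y))"
    by (subst integrable_iff_bounded) (simp add: lborel.nn_integral_fst[symmetric] split_beta')
  have "rconv (res l) h x = (LINT y|lborel. LINT t|lborel. indicator {0<..} t * exp (- l * t) * (heat t (x - y) * h y))"
    unfolding rconv_def res_eq_integral by (simp add: mult.assoc flip: integral_mult_left_zero)
  also have "\<dots> = (LINT t|lborel. LINT y|lborel. indicator {0<..} t * exp (- l * t) * (heat t (x - y) * h y))"
    using lborel_pair.Fubini_integral[OF *] by simp
  finally show ?thesis by (simp add: rconv_def)
qed

text \<open>
  The heat flow as an average over a standard Gaussian at the scale \<open>\<surd>(2t)\<close>; in this form the time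
  derivative falls on \<open>h\<close>.
\<close>

lemma rconv_heat_scale:
  fixes h :: "'a::euclidean_space \<Rightarrow> real"
  assumes [measurable]: "h \<in> borel_measurable borel" and t: "t > 0"
  shows "rconv (heat t) h x = (LINT z|lborel. heat (1/2) z * h (x + sqrt (2 * t) *\<^sub>R z))"
proof -
  let ?c = "sqrt (2 * t)"
  have c: "?c > 0" using t by simp
  have "?c ^ DIM('a) * heat t (?c *\<^sub>R z) = heat (1/2) z" for z :: 'a
  proof -
    have "(4 * pi * t) powr (- real DIM('a) / 2) = (2 * pi) powr (- real DIM('a) / 2) * (2 * t) powr (- real DIM('a) / 2)"
      using t by (simp add: mult_ac flip: powr_mult)
    moreover have "?c ^ DIM('a) = (2 * t) powr (real DIM('a) / 2)"
      using t by (simp add: powr_half_sqrt[symmetric] powr_powr flip: powr_realpow)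
    moreover have "(2 * t) powr (real DIM('a) / 2) * (2 * t) powr (- real DIM('a) / 2) = 1"
      using t by (simp flip: powr_add)
    ultimately show ?thesis
      using t unfolding heat_def by (simp add: power_mult_distrib)
  qed
  note * = this
  have "rconv (heat t) h x = \<bar>?c\<bar> ^ DIM('a) * (LINT z|lborel. heat t (x - (x + ?c *\<^sub>R z)) * h (x + ?c *\<^sub>R z))"
    unfolding rconv_def by (rule integral_lborel_affine) (use c in auto)
  also have "\<dots> = (LINT z|lborel. (?c ^ DIM('a) * heat t (?c *\<^sub>R z)) * h (x + ?c *\<^sub>R z))"
    using c by (simp add: mult.assoc)
  finally show ?thesis unfolding * .
qed

lemma integral_heat: "t > 0 \<Longrightarrow> (LINT x|(lborel :: 'a::euclidean_space measure). heat t x) = 1"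
  "t > 0 \<Longrightarrow> integrable (lborel :: 'a::euclidean_space measure) (heat t)"
proof -
  assume t: "t > 0"
  show "integrable (lborel :: 'a::euclidean_space measure) (heat t)"
    using nn_integral_heat[OF t, where 'a = 'a] by (intro integrableI_bounded) auto
  show "(LINT x|(lborel :: 'a::euclidean_space measure). heat t x) = 1"
    using nn_integral_heat[OF t, where 'a = 'a] by (subst integral_eq_nn_integral) auto
qed

lemma nconv_nres_test_finite:
  fixes h :: "real^'d \<Rightarrow> real"
  assumes h: "test_function h" and d: "CARD('d) > 2" and l: "l \<ge> 0"
  shows "nconv (nres l) (nabs h) x < \<infinity>"
proof -
  note [measurable] = test_function_borel[OF h]
  obtain C R where C: "C > 0" "\<And>x. \<bar>h x\<bar> \<le> C * indicator (cball 0 R) x" using test_functionE[OF h] by metis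
  have "nconv (nres l) (nabs h) x \<le> nconv (nres 0) (nabs h) x"
    unfolding nconv_def by (intro nn_integral_mono mult_right_mono nres_antimono l) auto
  also have "\<dots> < \<infinity>"
  proof (rule nconv_nres_0_finite[where C = C])
    show "nabs h x \<le> ennreal C" for x
      using C(2)[of x] C(1) by (intro ennreal_leI) (cases "x \<in> cball 0 R"; simp)
    show "(\<integral>\<^sup>+x. nabs h x \<partial>lborel) < \<infinity>"
      using test_function_integrable(1)[OF h] by (simp add: integrable_iff_bounded)
  qed (use d in auto)
  finally show ?thesis .
qed

text \<open>
  A ray leaves the support of \<open>\<phi>\<close> at the latest when \<open>\<surd>(2t)|w| = R + |y|\<close>, and up to that time it has
  travelled this distance, uniformly in the direction and speed \<open>w\<close>.  The summand \<open>1\<close> makes the exit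
  time positive and the comparison of times strict.
\<close>

lemma nn_integral_heat_ray_le:
  fixes \<phi> :: "real^'d \<Rightarrow> real" and w :: "real^'d"
  assumes C: "C > 0" "\<And>x. \<bar>\<phi> x\<bar> \<le> C * indicator (cball 0 R) x" and R: "R \<ge> 0" and p: "\<bar>p\<bar> \<le> norm w"
  shows "(\<integral>\<^sup>+t. indicator {0<..} t * ennreal \<bar>p * \<phi> (y + sqrt (2 * t) *\<^sub>R w) / sqrt (2 * t)\<bar> \<partial>lborel)
    \<le> ennreal (C * (R + norm y + 1))"
proof (cases "w = 0")
  case True
  then show ?thesis using p by simp
next
  case False
  define r where "r = R + norm y + 1"
  define T where "T = r\<^sup>2 / (2 * (norm w)\<^sup>2)"
  have r: "r > 0" using R by (simp add: r_def add_nonneg_pos)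
  have T: "T > 0" using False r by (simp add: T_def)
  have sT: "norm w * sqrt (2 * T) = r"
    using False r by (simp add: T_def real_sqrt_divide)
  have "(\<integral>\<^sup>+t. indicator {0<..} t * ennreal \<bar>p * \<phi> (y + sqrt (2 * t) *\<^sub>R w) / sqrt (2 * t)\<bar> \<partial>lborel)
     \<le> (\<integral>\<^sup>+t. ennreal (norm w * C) * (indicator {0<..<T} t * ennreal (1 / sqrt (2 * t))) \<partial>lborel)"
  proof (rule nn_integral_mono)
    fix t :: real
    show "indicator {0<..} t * ennreal \<bar>p * \<phi> (y + sqrt (2 * t) *\<^sub>R w) / sqrt (2 * t)\<bar>
       \<le> ennreal (norm w * C) * (indicator {0<..<T} t * ennreal (1 / sqrt (2 * t)))"
    proof (cases "t > 0 \<and> \<phi> (y + sqrt (2 * t) *\<^sub>R w) \<noteq> 0")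
      case True
      let ?x = "y + sqrt (2 * t) *\<^sub>R w"
      have x: "norm ?x \<le> R" using True C(2)[of ?x] by (cases "norm ?x \<le> R") auto
      have "sqrt (2 * t) * norm w \<le> norm ?x + norm y"
        using norm_triangle_ineq4[of ?x y] True by simp
      then have "sqrt (2 * t) * norm w < sqrt (2 * T) * norm w"
        using x sT by (simp add: r_def mult.commute)
      then have "t < T" using False by simp
      moreover have "\<bar>p * \<phi> ?x\<bar> \<le> norm w * C"
        unfolding abs_mult using p C(2)[of ?x] x by (intro mult_mono) auto
      then have "\<bar>p * \<phi> ?x / sqrt (2 * t)\<bar> \<le> norm w * C * (1 / sqrt (2 * t))"
        using True by (simp add: divide_right_mono)
      then have "ennreal \<bar>p * \<phi> ?x / sqrt (2 * t)\<bar> \<le> ennreal (norm w * C) * ennreal (1 / sqrt (2 * t))"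
        using True C(1) by (subst ennreal_mult[symmetric]) (auto intro: ennreal_leI)
      ultimately show ?thesis using True by simp
    qed auto
  qed
  also have "\<dots> = ennreal (norm w * C) * ennreal (sqrt (2 * T))"
    by (simp add: nn_integral_cmult nn_integral_inverse_sqrt T)
  also have "\<dots> = ennreal (C * (R + norm y + 1))"
    using C(1) T sT by (simp add: mult_ac flip: ennreal_mult r_def)
  finally show ?thesis .
qed

text \<open>
  An inequality, since the left side is \<open>0\<close> for \<open>l = 0\<close>.
\<close>

lemma nn_integral_damping: "l \<ge> 0 \<Longrightarrow> (\<integral>\<^sup>+t. indicator {0<..} t * ennreal (l * exp (- l * t)) \<partial>lborel) \<le> 1"
proof (cases "l = 0")
  case False
  assume "l \<ge> 0"
  with False have l: "l > 0" by simp
  have "(\<integral>\<^sup>+t. indicator {0<..} t * ennreal (l * exp (- l * t)) \<partial>lborel) \<le> (\<integral>\<^sup>+t. ennreal (l * exp (- l * t)) * indicator {0..} t \<partial>lborel)"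
    by (intro nn_integral_mono) (auto simp: indicator_def)
  also have "\<dots> = ennreal (0 - (- exp (- l * 0)))"
  proof (rule nn_integral_FTC_atLeast[where F = "\<lambda>t. - exp (- l * t)"])
    have "((\<lambda>t. - exp (- (l * t))) \<longlongrightarrow> - 0) at_top"
      by (intro tendsto_minus filterlim_compose[OF exp_at_bot] filterlim_uminus_at_top[THEN iffD1] filterlim_tendsto_pos_mult_at_top[OF tendsto_const l] filterlim_ident)
    then show "((\<lambda>t. - exp (- l * t)) \<longlongrightarrow> 0) at_top" by simp
  qed (use l in \<open>auto intro!: derivative_eq_intros\<close>)
  finally show ?thesis by simp
qed simp

text \<open>
  The integrand is the derivative of \<open>e\<^sup>-\<^sup>l\<^sup>t \<psi>(y + \<surd>(2t) w)\<close>, a function that starts at \<open>\<psi>(y)\<close> and is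
  eventually zero because the ray leaves the support.
\<close>

lemma sqrt_ray_FTC:
  fixes \<psi> :: "real^'d \<Rightarrow> real" and y :: "real^'d"
  assumes \<psi>: "test_function \<psi>" and l: "l \<ge> 0" and w: "w \<noteq> 0"
  defines "f \<equiv> \<lambda>t. exp (- l * t) * ((\<Sum>i\<in>UNIV. w $ i * partial_deriv_on UNIV i \<psi> (y + sqrt (2 * t) *\<^sub>R w)) / sqrt (2 * t) - l * \<psi> (y + sqrt (2 * t) *\<^sub>R w))"
  assumes int: "integrable lborel (\<lambda>t. indicator {0<..} t * f t)"
  shows "(LINT t|lborel. indicator {0<..} t * f t) = - \<psi> y"
proof -
  let ?F = "\<lambda>t. exp (- l * t) * \<psi> (y + sqrt (2 * t) *\<^sub>R w)"
  have "(LBINT t=ereal 0..\<infinity>. f t) = 0 - \<psi> y"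
  proof (rule interval_integral_FTC_integrable)
    show "(?F has_vector_derivative f t) (at t)" if "ereal 0 < ereal t" for t
    proof -
      have t: "t > 0" using that by simp
      define S where "S = (\<Sum>i\<in>UNIV. w $ i * partial_deriv_on UNIV i \<psi> (y + sqrt (2 * t) *\<^sub>R w))"
      have s: "((\<lambda>t. y + sqrt (2 * t) *\<^sub>R w) has_derivative (\<lambda>h. (h / sqrt (2 * t)) *\<^sub>R w)) (at t)"
        using t by (auto intro!: derivative_eq_intros simp: fun_eq_iff field_simps)
      have e: "((\<lambda>t. exp (- l * t)) has_derivative (\<lambda>h. h * (- l * exp (- l * t)))) (at t)"
        by (auto intro!: derivative_eq_intros)
      have "(?F has_derivative (\<lambda>h. exp (- l * t) * (\<Sum>i\<in>UNIV. ((h / sqrt (2 * t)) *\<^sub>R w) $ i * partial_deriv_on UNIV i \<psi> (y + sqrt (2 * t) *\<^sub>R w))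
         + h * (- l * exp (- l * t)) * \<psi> (y + sqrt (2 * t) *\<^sub>R w))) (at t)"
        by (rule has_derivative_mult[OF e has_derivative_compose[OF s has_derivative_partials[OF test_function_differentiable[OF \<psi>]]]])
      moreover have "(\<Sum>i\<in>UNIV. ((h / sqrt (2 * t)) *\<^sub>R w) $ i * partial_deriv_on UNIV i \<psi> (y + sqrt (2 * t) *\<^sub>R w))
        = h * ((\<Sum>i\<in>UNIV. w $ i * partial_deriv_on UNIV i \<psi> (y + sqrt (2 * t) *\<^sub>R w)) / sqrt (2 * t))" for h
        by (simp add: sum_divide_distrib sum_distrib_left mult.assoc)
      ultimately have D: "(?F has_derivative (\<lambda>h. exp (- l * t) * (h * (S / sqrt (2 * t))) + h * (- l * exp (- l * t)) * \<psi> (y + sqrt (2 * t) *\<^sub>R w))) (at t)"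
        by (simp only: S_def)
      have f: "f t = exp (- l * t) * (S / sqrt (2 * t) - l * \<psi> (y + sqrt (2 * t) *\<^sub>R w))"
        by (simp only: f_def S_def)
      show ?thesis
        unfolding has_vector_derivative_def f
        by (rule has_derivative_eq_rhs[OF D]) (simp add: fun_eq_iff algebra_simps)
    qed
    have c: "continuous_on {0<..} (\<lambda>t. \<phi> (y + sqrt (2 * t) *\<^sub>R w))" if "test_function \<phi>" for \<phi>
      by (rule continuous_on_compose2[OF test_function_continuous[OF that, of UNIV]]) (auto intro!: continuous_intros)
    have "continuous_on {0<..} f"
      unfolding f_def by (intro continuous_intros c \<psi> test_function_partial) auto
    then show "isCont f t" if "ereal 0 < ereal t" for t
      using that by (simp add: continuous_on_eq_continuous_at)
    have e: "einterval (ereal 0) \<infinity> = {0<..}" by (auto simp: einterval_def)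
    show "set_integrable lborel (einterval (ereal 0) \<infinity>) f"
      unfolding e set_integrable_def using int by simp
    have "isCont (\<lambda>t. exp (- l * t) * \<psi> (y + sqrt (2 * t) *\<^sub>R w)) 0"
    proof -
      have "continuous_on UNIV (\<lambda>t. \<psi> (y + sqrt (2 * t) *\<^sub>R w))"
        by (rule continuous_on_compose2[OF test_function_continuous[OF \<psi>, of UNIV]]) (auto intro!: continuous_intros)
      then have "continuous_on UNIV ?F" by (intro continuous_intros)
      then show ?thesis by (simp add: continuous_on_eq_continuous_at)
    qed
    then have "(?F \<longlongrightarrow> \<psi> y) (at 0)" by (simp add: isCont_def)
    then have "(?F \<longlongrightarrow> \<psi> y) (at_right 0)" by (simp add: filterlim_at_split)
    then show "((?F \<circ> real_of_ereal) \<longlongrightarrow> \<psi> y) (at_right (ereal 0))"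
      unfolding ereal_tendsto_simps .
    obtain R where R: "\<And>x. norm x > R \<Longrightarrow> \<psi> x = 0" using \<psi> unfolding test_function_iff by metis
    have "eventually (\<lambda>t. ?F t = 0) at_top"
    proof -
      have "filterlim (\<lambda>t. sqrt (2 * t) * norm w) at_top at_top"
        using w by (intro filterlim_at_top_mult_tendsto_pos[OF tendsto_const] filterlim_compose[OF sqrt_at_top] filterlim_tendsto_pos_mult_at_top[OF tendsto_const] filterlim_ident) auto
      then have "eventually (\<lambda>t. sqrt (2 * t) * norm w > R + norm y) at_top"
        by (simp add: filterlim_at_top_dense)
      then show ?thesis
        using eventually_ge_at_top[of 0]
      proof eventually_elim
        case (elim t)
        have "norm (y + sqrt (2 * t) *\<^sub>R w) > R"
          using norm_triangle_ineq4[of "y + sqrt (2 * t) *\<^sub>R w" y] elim by simp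
        then show ?case using R by simp
      qed
    qed
    then show "((?F \<circ> real_of_ereal) \<longlongrightarrow> 0) (at_left \<infinity>)"
      unfolding ereal_tendsto_simps by (rule tendsto_eventually)
  qed simp
  then show ?thesis
    by (simp add: interval_lebesgue_integral_def set_lebesgue_integral_def einterval_def greaterThan_def)
qed

lemma borel_measurable_vec_component [measurable]:
  fixes f :: "'a \<Rightarrow> real^'d"
  shows "f \<in> borel_measurable M \<Longrightarrow> (\<lambda>x. f x $ i) \<in> borel_measurable M"
  by (rule borel_measurable_continuous_on) (auto intro!: continuous_intros)

text \<open>
  The identity \<open>R\<^sub>l(l\<psi> - \<Delta>\<psi>) = \<psi>\<close>.  The function \<open>\<gamma> w * (I t * f w t)\<close> is integrated in both orders:
  over \<open>w\<close> first, \<open>gaussian_ibp\<close> gives minus the integrand of the resolvent; over \<open>t\<close> first,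
  \<open>sqrt_ray_FTC\<close> gives \<open>-\<psi>(y)\<close> times the Gaussian.  Absolute integrability is checked separately for
  the transport terms \<open>G\<close> and the damping term \<open>Z\<close>.
\<close>

theorem rconv_res_test_function:
  fixes \<psi> :: "real^'d \<Rightarrow> real"
  assumes \<psi>: "test_function \<psi>" and d: "CARD('d) > 2" and l: "l \<ge> 0"
  shows "rconv (res l) (\<lambda>x. l * \<psi> x - laplacian \<psi> x) y = \<psi> y"
proof -
  define h where "h x = l * \<psi> x - laplacian \<psi> x" for x
  have h: "test_function h"
    unfolding h_def[abs_def] by (intro test_function_diff test_function_cmult test_function_laplacian \<psi>)
  \<comment> \<open>\<open>I\<close> extends the integrands by zero to negative times, so that products of full Lebesgue measures
    can be used.\<close>
  define I :: "real \<Rightarrow> real" where "I = indicator {0<..}"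
  define \<gamma> :: "real^'d \<Rightarrow> real" where "\<gamma> = heat (1/2)"
  define D where "D i = partial_deriv_on UNIV i \<psi>" for i
  have D: "test_function (D i)" for i unfolding D_def by (rule test_function_partial[OF \<psi>])
  define G where "G i t w = I t * (\<gamma> w * (exp (- l * t) * (w $ i * D i (y + sqrt (2 * t) *\<^sub>R w) / sqrt (2 * t))))" for i t w
  define Z where "Z t w = I t * (\<gamma> w * (l * exp (- l * t) * \<psi> (y + sqrt (2 * t) *\<^sub>R w)))" for t w
  define f where "f w = (\<lambda>t. exp (- l * t) * ((\<Sum>i\<in>UNIV. w $ i * partial_deriv_on UNIV i \<psi> (y + sqrt (2 * t) *\<^sub>R w)) / sqrt (2 * t) - l * \<psi> (y + sqrt (2 * t) *\<^sub>R w)))" for w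
  have [measurable]: "\<psi> \<in> borel_measurable borel" "h \<in> borel_measurable borel" "D i \<in> borel_measurable borel" "laplacian \<psi> \<in> borel_measurable borel" for i
    using \<psi> h D test_function_laplacian[OF \<psi>] by (auto intro: test_function_borel)
  have [measurable]: "I \<in> borel_measurable borel" "\<gamma> \<in> borel_measurable borel"
    by (auto simp: I_def \<gamma>_def)
  have [measurable]: "(\<lambda>(t, w). G i t w) \<in> borel_measurable (borel \<Otimes>\<^sub>M borel)" for i
    unfolding G_def by measurable
  have [measurable]: "(\<lambda>(t, w). Z t w) \<in> borel_measurable (borel \<Otimes>\<^sub>M borel)"
    unfolding Z_def by measurable
  have \<gamma>0: "\<gamma> w > 0" for w by (simp add: \<gamma>_def heat_def)
  have J: "(\<Sum>i\<in>UNIV. G i t w) - Z t w = \<gamma> w * (I t * f w t)" for t w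
    unfolding G_def Z_def f_def D_def
    by (simp add: sum_distrib_left sum_divide_distrib right_diff_distrib mult_ac)
  have iG: "integrable (lborel \<Otimes>\<^sub>M lborel) (\<lambda>(t, w). G i t w)" for i
  proof (rule integrableI_bounded)
    obtain C R where C: "C > 0" "\<And>x. \<bar>D i x\<bar> \<le> C * indicator (cball 0 R) x" using test_functionE[OF D] by metis
    have C': "\<bar>D i x\<bar> \<le> C * indicator (cball 0 (max R 0)) x" for x
      using C(2)[of x] C(1) by (cases "norm x \<le> R") (auto simp: le_max_iff_disj)
    let ?K = "C * (max R 0 + norm y + 1)"
    have K: "?K \<ge> 0" using C(1) by (intro mult_nonneg_nonneg add_nonneg_nonneg) auto
    have "(\<integral>\<^sup>+x. ennreal (norm (case x of (t, w) \<Rightarrow> G i t w)) \<partial>(lborel \<Otimes>\<^sub>M lborel)) = (\<integral>\<^sup>+w. \<integral>\<^sup>+t. ennreal \<bar>G i t w\<bar> \<partial>lborel \<partial>lborel)"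
      by (subst lborel_pair.nn_integral_snd[symmetric]) auto
    also have "\<dots> \<le> (\<integral>\<^sup>+w. ennreal (\<gamma> w) * ennreal ?K \<partial>lborel)"
    proof (rule nn_integral_mono)
      fix w
      have "(\<integral>\<^sup>+t. ennreal \<bar>G i t w\<bar> \<partial>lborel)
        \<le> (\<integral>\<^sup>+t. ennreal (\<gamma> w) * (indicator {0<..} t * ennreal \<bar>w $ i * D i (y + sqrt (2 * t) *\<^sub>R w) / sqrt (2 * t)\<bar>) \<partial>lborel)"
      proof (rule nn_integral_mono)
        fix t :: real
        let ?q = "\<bar>w $ i * D i (y + sqrt (2 * t) *\<^sub>R w) / sqrt (2 * t)\<bar>"
        show "ennreal \<bar>G i t w\<bar> \<le> ennreal (\<gamma> w) * (indicator {0<..} t * ennreal ?q)"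
        proof (cases "t > 0")
          case True
          have "\<bar>G i t w\<bar> = \<gamma> w * (exp (- l * t) * ?q)"
            using True \<gamma>0[of w] by (simp add: G_def I_def abs_mult)
          also have "\<dots> \<le> \<gamma> w * ?q"
            using True l \<gamma>0[of w] by (intro mult_left_mono mult_left_le_one_le) auto
          finally show ?thesis using True \<gamma>0[of w] by (auto simp flip: ennreal_mult intro!: ennreal_leI)
        qed (simp add: G_def I_def)
      qed
      also have "\<dots> = ennreal (\<gamma> w) * (\<integral>\<^sup>+t. indicator {0<..} t * ennreal \<bar>w $ i * D i (y + sqrt (2 * t) *\<^sub>R w) / sqrt (2 * t)\<bar> \<partial>lborel)"
        by (rule nn_integral_cmult) measurable
      also have "\<dots> \<le> ennreal (\<gamma> w) * ennreal ?K"
        by (intro mult_left_mono nn_integral_heat_ray_le C(1) C' component_le_norm_cart) auto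
      finally show "(\<integral>\<^sup>+t. ennreal \<bar>G i t w\<bar> \<partial>lborel) \<le> ennreal (\<gamma> w) * ennreal ?K" .
    qed
    also have "\<dots> = ennreal ?K"
      by (simp add: nn_integral_multc nn_integral_heat \<gamma>_def)
    finally show "(\<integral>\<^sup>+x. ennreal (norm (case x of (t, w) \<Rightarrow> G i t w)) \<partial>(lborel \<Otimes>\<^sub>M lborel)) < \<infinity>"
      by (rule le_less_trans) simp
  qed simp
  have iZ: "integrable (lborel \<Otimes>\<^sub>M lborel) (\<lambda>(t, w). Z t w)"
  proof (rule integrableI_bounded)
    obtain C R where C: "C > 0" "\<And>x. \<bar>\<psi> x\<bar> \<le> C * indicator (cball 0 R) x" using test_functionE[OF \<psi>] by metis
    have C': "\<bar>\<psi> x\<bar> \<le> C" for x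
      using C(2)[of x] C(1) by (cases "x \<in> cball 0 R") auto
    have "(\<integral>\<^sup>+x. ennreal (norm (case x of (t, w) \<Rightarrow> Z t w)) \<partial>(lborel \<Otimes>\<^sub>M lborel)) = (\<integral>\<^sup>+w. \<integral>\<^sup>+t. ennreal \<bar>Z t w\<bar> \<partial>lborel \<partial>lborel)"
      by (subst lborel_pair.nn_integral_snd[symmetric]) auto
    also have "\<dots> \<le> (\<integral>\<^sup>+w. \<integral>\<^sup>+t. ennreal (\<gamma> w) * ennreal C * (indicator {0<..} t * ennreal (l * exp (- l * t))) \<partial>lborel \<partial>lborel)"
    proof (intro nn_integral_mono)
      fix w and t :: real
      show "ennreal \<bar>Z t w\<bar> \<le> ennreal (\<gamma> w) * ennreal C * (indicator {0<..} t * ennreal (l * exp (- l * t)))"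
      proof (cases "t > 0")
        case True
        have "\<bar>Z t w\<bar> = \<gamma> w * ((l * exp (- l * t)) * \<bar>\<psi> (y + sqrt (2 * t) *\<^sub>R w)\<bar>)"
          using True \<gamma>0[of w] l by (simp add: Z_def I_def abs_mult)
        also have "\<dots> \<le> \<gamma> w * ((l * exp (- l * t)) * C)"
          using l \<gamma>0[of w] by (intro mult_left_mono C') auto
        finally have "ennreal \<bar>Z t w\<bar> \<le> ennreal (\<gamma> w * C * (l * exp (- l * t)))"
          by (intro ennreal_leI) (simp add: mult_ac)
        also have "\<dots> = ennreal (\<gamma> w) * ennreal C * ennreal (l * exp (- l * t))"
          using l C(1) \<gamma>0[of w] by (simp add: ennreal_mult)
        finally show ?thesis using True by simp
      qed (simp add: Z_def I_def)
    qed
    also have "\<dots> \<le> (\<integral>\<^sup>+w. ennreal (\<gamma> w) * ennreal C * 1 \<partial>lborel)"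
    proof (rule nn_integral_mono)
      fix w
      have "(\<integral>\<^sup>+t. ennreal (\<gamma> w) * ennreal C * (indicator {0<..} t * ennreal (l * exp (- l * t))) \<partial>lborel)
        = ennreal (\<gamma> w) * ennreal C * (\<integral>\<^sup>+t. indicator {0<..} t * ennreal (l * exp (- l * t)) \<partial>lborel)"
        by (rule nn_integral_cmult) measurable
      also have "\<dots> \<le> ennreal (\<gamma> w) * ennreal C * 1"
        by (intro mult_left_mono nn_integral_damping l) auto
      finally show "(\<integral>\<^sup>+t. ennreal (\<gamma> w) * ennreal C * (indicator {0<..} t * ennreal (l * exp (- l * t))) \<partial>lborel)
        \<le> ennreal (\<gamma> w) * ennreal C * 1" .
    qed
    also have "\<dots> = ennreal C"
      by (simp add: nn_integral_multc nn_integral_heat \<gamma>_def)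
    finally show "(\<integral>\<^sup>+x. ennreal (norm (case x of (t, w) \<Rightarrow> Z t w)) \<partial>(lborel \<Otimes>\<^sub>M lborel)) < \<infinity>"
      by (rule le_less_trans) simp
  qed simp
  have "integrable (lborel \<Otimes>\<^sub>M lborel) (\<lambda>x. (\<Sum>i\<in>UNIV. (\<lambda>(t, w). G i t w) x) - (\<lambda>(t, w). Z t w) x)"
    by (intro Bochner_Integration.integrable_diff Bochner_Integration.integrable_sum iG iZ)
  then have iJ: "integrable (lborel \<Otimes>\<^sub>M lborel) (\<lambda>(t, w). \<gamma> w * (I t * f w t))"
    by (simp add: split_beta' J)
  have t_int: "(LINT w|lborel. \<gamma> w * (I t * f w t)) = - (indicator {0<..} t * exp (- l * t) * rconv (heat t) h y)" for t
  proof (cases "t > 0")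
    case True
    define s where "s = sqrt (2 * t)"
    have s: "s > 0" using True by (simp add: s_def)
    have 0: "integrable lborel (\<lambda>w. \<gamma> w * \<phi> (y + s *\<^sub>R w))" if "test_function \<phi>" for \<phi> :: "real^'d \<Rightarrow> real"
      using integrable_gaussian_test_function[OF that s, of "\<lambda>_. 1"] by (simp add: \<gamma>_def)
    have 1: "integrable lborel (\<lambda>w. \<gamma> w * (\<Sum>i\<in>UNIV. w $ i * partial_deriv_on UNIV i \<psi> (y + s *\<^sub>R w)))"
      unfolding sum_distrib_left \<gamma>_def
      by (intro Bochner_Integration.integrable_sum integrable_gaussian_test_function s continuous_intros D[unfolded D_def])
    note ibp = gaussian_ibp[OF \<psi> s, of y, folded \<gamma>_def]
    have "(LINT w|lborel. \<gamma> w * (I t * f w t))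
      = (LINT w|lborel. exp (- l * t) / s * (\<gamma> w * (\<Sum>i\<in>UNIV. w $ i * partial_deriv_on UNIV i \<psi> (y + s *\<^sub>R w))) - exp (- l * t) * l * (\<gamma> w * \<psi> (y + s *\<^sub>R w)))"
      using True by (intro Bochner_Integration.integral_cong refl) (simp add: I_def f_def s_def algebra_simps)
    also have "\<dots> = exp (- l * t) / s * (s * (LINT w|lborel. \<gamma> w * laplacian \<psi> (y + s *\<^sub>R w))) - exp (- l * t) * l * (LINT w|lborel. \<gamma> w * \<psi> (y + s *\<^sub>R w))"
      by (subst Bochner_Integration.integral_diff) (use 0[OF \<psi>] 1 in \<open>auto simp: ibp\<close>)
    also have "\<dots> = - (exp (- l * t) * (l * (LINT w|lborel. \<gamma> w * \<psi> (y + s *\<^sub>R w)) - (LINT w|lborel. \<gamma> w * laplacian \<psi> (y + s *\<^sub>R w))))"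
      using s by (simp add: algebra_simps)
    also have "l * (LINT w|lborel. \<gamma> w * \<psi> (y + s *\<^sub>R w)) - (LINT w|lborel. \<gamma> w * laplacian \<psi> (y + s *\<^sub>R w))
       = (LINT w|lborel. l * (\<gamma> w * \<psi> (y + s *\<^sub>R w)) - \<gamma> w * laplacian \<psi> (y + s *\<^sub>R w))"
      using 0[OF \<psi>] 0[OF test_function_laplacian[OF \<psi>]] by simp
    also have "\<dots> = (LINT w|lborel. \<gamma> w * h (y + s *\<^sub>R w))"
      by (intro Bochner_Integration.integral_cong refl) (simp add: h_def algebra_simps)
    also have "\<dots> = rconv (heat t) h y"
      using True by (simp add: rconv_heat_scale \<gamma>_def s_def)
    finally show ?thesis using True by simp
  qed (simp add: I_def)
  have w_int: "AE w in lborel. (LINT t|lborel. \<gamma> w * (I t * f w t)) = \<gamma> w * (- \<psi> y)"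
    using lborel_pair.AE_integrable_snd[OF iJ] AE_lborel_singleton[of 0]
  proof eventually_elim
    case (elim w)
    have "integrable lborel (\<lambda>t. I t * f w t)"
      using elim(1) \<gamma>0[of w] by simp
    then have "(LINT t|lborel. I t * f w t) = - \<psi> y"
      unfolding I_def f_def using elim(2) by (intro sqrt_ray_FTC \<psi> l)
    then show ?case by simp
  qed
  have "rconv (res l) h y = (LINT t|lborel. indicator {0<..} t * exp (- l * t) * rconv (heat t) h y)"
    by (rule rconv_res_eq) (use nconv_nres_test_finite[OF h d l] in auto)
  also have "\<dots> = - (LINT t|lborel. LINT w|lborel. \<gamma> w * (I t * f w t))"
    unfolding t_int by simp
  also have "(LINT t|lborel. LINT w|lborel. \<gamma> w * (I t * f w t)) = (LINT w|lborel. LINT t|lborel. \<gamma> w * (I t * f w t))"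
    by (rule lborel_pair.Fubini_integral[symmetric, OF iJ])
  also have "\<dots> = (LINT w|lborel. \<gamma> w * (- \<psi> y))"
  proof (rule integral_cong_AE[OF _ _ w_int])
    have [measurable]: "(\<lambda>(t, w). f w t) \<in> borel_measurable (borel \<Otimes>\<^sub>M borel)"
      unfolding f_def D_def[symmetric] by measurable
    show "(\<lambda>w. LINT t|lborel. \<gamma> w * (I t * f w t)) \<in> borel_measurable lborel" by measurable
  qed auto
  also have "\<dots> = - \<psi> y"
    using integral_heat(1)[of "1/2", where 'a = "real^'d"] by (simp add: \<gamma>_def)
  finally show ?thesis by (simp add: h_def[abs_def])
qed

section \<open>The linear equation with an integrable right-hand side\<close>

text \<open>
  The partial fraction decomposition \<open>1/(|p|\<^sup>2 + |p|\<^sup>4) = 1/|p|\<^sup>2 - 1/(1 + |p|\<^sup>2)\<close> in position space.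
\<close>

definition kernel :: "'a::euclidean_space \<Rightarrow> real" where
  "kernel x = res 0 x - res 1 x"

lemma borel_measurable_kernel [measurable]: "kernel \<in> borel_measurable borel"
  unfolding kernel_def[abs_def] by measurable

lemma kernel_minus [simp]: "kernel (- x) = kernel x"
  by (simp add: kernel_def)

lemma nabs_kernel_le: "nabs kernel x \<le> nres 0 x"
proof (cases "nres 0 x = top")
  case False
  then have r0: "nres 0 x < top" by (simp add: less_top)
  have "nres 1 x \<le> nres 0 x" by (rule nres_antimono) auto
  then have "res 1 x \<le> res 0 x" unfolding res_def by (rule enn2real_mono) (rule r0)
  then have "nabs kernel x \<le> ennreal (res 0 x)"
    by (intro ennreal_leI) (simp add: kernel_def)
  also have "\<dots> = nres 0 x" using r0 by (simp add: res_def)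
  finally show ?thesis .
qed simp

definition pde_op :: "(real^'d \<Rightarrow> real) \<Rightarrow> real^'d \<Rightarrow> real" where
  "pde_op \<psi> x = - laplacian \<psi> x + laplacian (laplacian \<psi>) x"

lemma test_function_pde_op: "test_function \<psi> \<Longrightarrow> test_function (pde_op \<psi>)"
  using test_function_diff[of "laplacian (laplacian \<psi>)" "laplacian \<psi>"]
  by (simp add: pde_op_def[abs_def] test_function_laplacian)

context
  fixes \<psi> :: "real^'d \<Rightarrow> real"
  assumes \<psi>: "test_function \<psi>" and d: "CARD('d) > 2"
begin

lemma integrable_rconv_res_test:
  "test_function h \<Longrightarrow> l \<ge> 0 \<Longrightarrow> integrable lborel (\<lambda>y. res l (x - y) * (h :: real^'d \<Rightarrow> real) y)"
  by (intro integrable_rconv_res nconv_nres_test_finite test_function_borel d)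

lemma rconv_kernel_test:
  "test_function h \<Longrightarrow> rconv kernel h x = rconv (res 0) h x - rconv (res 1) (h :: real^'d \<Rightarrow> real) x"
  unfolding rconv_def kernel_def
  by (simp add: left_diff_distrib integrable_rconv_res_test)

lemma rconv_res_test_add_cmult:
  "test_function f \<Longrightarrow> test_function g \<Longrightarrow> l \<ge> 0 \<Longrightarrow>
    rconv (res l) (\<lambda>x. a * f x + b * g x) x = a * rconv (res l) f x + b * rconv (res l) (g :: real^'d \<Rightarrow> real) x"
  unfolding rconv_def
  by (simp add: distrib_left mult.left_commute[of _ a] mult.left_commute[of _ b] integrable_rconv_res_test)

text \<open>
  Linear algebra with the instances of \<open>rconv_res_test_function\<close> in which \<open>\<psi>\<close> or \<open>\<Delta>\<psi>\<close> is fed to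
  \<open>R\<^sub>0\<close> and \<open>R\<^sub>1\<close>.
\<close>

lemma rconv_kernel_bilaplacian:
  "rconv kernel (laplacian (laplacian \<psi>)) x = \<psi> x - rconv (res 1) \<psi> x"
  and rconv_kernel_pde_op: "rconv kernel (pde_op \<psi>) x = \<psi> x"
proof -
  let ?L = "laplacian \<psi>"
  have t: "test_function ?L" "test_function (laplacian ?L)"
    using \<psi> by (auto intro: test_function_laplacian)
  have "rconv (res 0) (\<lambda>x. 0 * ?L x - laplacian ?L x) x = ?L x"
    by (rule rconv_res_test_function) (use t d in auto)
  then have 1: "rconv (res 0) (laplacian ?L) x = - ?L x"
    using rconv_res_test_add_cmult[OF t, of 0 0 "-1" x] by simp
  have "rconv (res 1) (\<lambda>x. 1 * ?L x - laplacian ?L x) x = ?L x"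
    by (rule rconv_res_test_function) (use t d in auto)
  then have 2: "rconv (res 1) ?L x - rconv (res 1) (laplacian ?L) x = ?L x"
    using rconv_res_test_add_cmult[OF t, of 1 1 "-1" x] by simp
  have "rconv (res 1) (\<lambda>x. 1 * \<psi> x - ?L x) x = \<psi> x"
    by (rule rconv_res_test_function) (use \<psi> d in auto)
  then have 3: "rconv (res 1) \<psi> x - rconv (res 1) ?L x = \<psi> x"
    using rconv_res_test_add_cmult[OF \<psi> t(1), of 1 1 "-1" x] by simp
  have "rconv (res 0) (\<lambda>x. 0 * \<psi> x - ?L x) x = \<psi> x"
    by (rule rconv_res_test_function) (use \<psi> d in auto)
  then have 4: "rconv (res 0) ?L x = - \<psi> x"
    using rconv_res_test_add_cmult[OF \<psi> t(1), of 0 0 "-1" x] rconv_res_test_add_cmult[OF \<psi> t(1), of 0 0 "1" x] by simp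
  show "rconv kernel (laplacian ?L) x = \<psi> x - rconv (res 1) \<psi> x"
    using rconv_kernel_test[OF t(2), of x] 1 2 3 by simp
  have "rconv (res l) (pde_op \<psi>) x = - rconv (res l) ?L x + rconv (res l) (laplacian ?L) x" if "l \<ge> 0" for l
    using rconv_res_test_add_cmult[OF t that, of "-1" 1 x] by (simp add: pde_op_def[abs_def])
  then show "rconv kernel (pde_op \<psi>) x = \<psi> x"
    using rconv_kernel_test[OF test_function_pde_op[OF \<psi>], of x] 1 2 3 4 by simp
qed

end

lemma nn_integral_mult_finite:
  assumes [measurable]: "f \<in> borel_measurable M" "g \<in> borel_measurable M"
    and "(\<integral>\<^sup>+x. (f x)\<^sup>2 \<partial>M) < \<infinity>" "(\<integral>\<^sup>+x. (g x)\<^sup>2 \<partial>M) < (\<infinity> :: ennreal)"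
  shows "(\<integral>\<^sup>+x. f x * g x \<partial>M) < \<infinity>"
proof -
  have "(\<integral>\<^sup>+x. f x * g x \<partial>M)\<^sup>2 \<le> (\<integral>\<^sup>+x. (f x)\<^sup>2 \<partial>M) * (\<integral>\<^sup>+x. (g x)\<^sup>2 \<partial>M)"
    by (rule Cauchy_Schwarz_nn_integral) auto
  also have "\<dots> < \<infinity>" using assms(3,4) by (simp add: ennreal_mult_less_top)
  finally show ?thesis
    by (cases "(\<integral>\<^sup>+x. f x * g x \<partial>M)") (auto simp: power2_eq_square)
qed

lemma nn_integral_square_less_top:
  "f \<in> borel_measurable M \<Longrightarrow> integrable M (\<lambda>x. (f x :: real)\<^sup>2) \<Longrightarrow> (\<integral>\<^sup>+x. (nabs f x)\<^sup>2 \<partial>M) < \<infinity>"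
  by (simp add: nn_integral_square_finite)

context
  fixes F :: "real^'d \<Rightarrow> real"
  assumes F_meas [measurable]: "F \<in> borel_measurable borel"
    and F_int: "integrable lborel F"
    and F_sq: "integrable lborel (\<lambda>x. (F x)\<^sup>2)"
    and d5: "CARD('d) \<ge> 5"
begin

lemma nn_integral_nconv_nres_0_le:
  assumes T: "T > 0"
  shows "(\<integral>\<^sup>+x. (nconv (nres 0) (nabs F) x)\<^sup>2 \<partial>lborel)
    \<le> ennreal (T\<^sup>2 / 2 * (LINT x|lborel. (F x)\<^sup>2)
       + (4 * pi) powr (- real CARD('d) / 2) * (T powr (2 - real CARD('d) / 2) / (real CARD('d) / 2 - 2)) * (LINT x|lborel. \<bar>F x\<bar>)\<^sup>2)"
proof -
  have nF: "(\<integral>\<^sup>+x. (nabs F x)\<^sup>2 \<partial>lborel) = ennreal (LINT x|lborel. (F x)\<^sup>2)"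
    by (rule nn_integral_square_finite) (use F_sq in auto)
  have nF1: "(\<integral>\<^sup>+x. nabs F x \<partial>lborel) = ennreal (LINT x|lborel. \<bar>F x\<bar>)"
    using F_int by (intro nn_integral_eq_integral) auto
  let ?c = "(4 * pi) powr (- real CARD('d) / 2) * (T powr (2 - real CARD('d) / 2) / (real CARD('d) / 2 - 2))"
  have c: "?c \<ge> 0" using d5 by auto
  have "(\<integral>\<^sup>+x. (nconv (nres 0) (nabs F) x)\<^sup>2 \<partial>lborel)
    \<le> ennreal (T\<^sup>2 / 2) * ennreal (LINT x|lborel. (F x)\<^sup>2) + ennreal ?c * (ennreal (LINT x|lborel. \<bar>F x\<bar>))\<^sup>2"
    using nconv_nres_0_L2_bound[of "nabs F" T] T d5 unfolding nF nF1 by simp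
  also have "\<dots> = ennreal (T\<^sup>2 / 2 * (LINT x|lborel. (F x)\<^sup>2) + ?c * (LINT x|lborel. \<bar>F x\<bar>)\<^sup>2)"
    using c by (simp only: ennreal_power integral_nonneg_AE AE_I2 abs_ge_zero zero_le_power2 ennreal_mult[symmetric] ennreal_plus[symmetric] mult_nonneg_nonneg divide_nonneg_pos zero_less_numeral)
  finally show ?thesis .
qed

lemma nconv_kernel_F_le: "nconv (nabs kernel) (nabs F) x \<le> nconv (nres 0) (nabs F) x"
  unfolding nconv_def by (intro nn_integral_mono mult_right_mono nabs_kernel_le) auto

lemma nabs_rconv_kernel_le: "nabs (rconv kernel F) x \<le> nconv (nres 0) (nabs F) x"
  by (rule order_trans[OF nabs_rconv_le nconv_kernel_F_le]) auto

lemma rconv_kernel_L2: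
  assumes T: "T > 0"
  shows "integrable lborel (\<lambda>x. (rconv kernel F x)\<^sup>2)"
    "(LINT x|lborel. (rconv kernel F x)\<^sup>2) \<le> T\<^sup>2 / 2 * (LINT x|lborel. (F x)\<^sup>2)
       + (4 * pi) powr (- real CARD('d) / 2) * (T powr (2 - real CARD('d) / 2) / (real CARD('d) / 2 - 2)) * (LINT x|lborel. \<bar>F x\<bar>)\<^sup>2"
    (is "_ \<le> ?B")
proof -
  have "(\<integral>\<^sup>+x. (nabs (rconv kernel F) x)\<^sup>2 \<partial>lborel) \<le> (\<integral>\<^sup>+x. (nconv (nres 0) (nabs F) x)\<^sup>2 \<partial>lborel)"
    by (intro nn_integral_mono power_mono nabs_rconv_kernel_le) auto
  also have "\<dots> \<le> ennreal ?B" by (rule nn_integral_nconv_nres_0_le[OF T])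
  finally have *: "(\<integral>\<^sup>+x. (nabs (rconv kernel F) x)\<^sup>2 \<partial>lborel) \<le> ennreal ?B" .
  have "?B \<ge> 0" using d5 by auto
  from square_integrable_if_nn_integral_le[OF _ * this]
  show "integrable lborel (\<lambda>x. (rconv kernel F x)\<^sup>2)" "(LINT x|lborel. (rconv kernel F x)\<^sup>2) \<le> ?B" by auto
qed

lemma nn_integral_nconv_nres_0_finite: "(\<integral>\<^sup>+x. (nconv (nres 0) (nabs F) x)\<^sup>2 \<partial>lborel) < \<infinity>"
  by (rule le_less_trans[OF nn_integral_nconv_nres_0_le[of 1]]) auto

lemma integral_rconv_kernel_mult:
  assumes [measurable]: "h \<in> borel_measurable borel" and h: "integrable lborel (\<lambda>x. (h x)\<^sup>2)"
  shows "(LINT x|lborel. rconv kernel F x * h x) = (LINT x|lborel. F x * rconv kernel h x)"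
proof -
  have k: "kernel (x - y) = kernel (y - x)" for x y :: "real^'d"
    using kernel_minus[of "x - y"] by simp
  have "(\<integral>\<^sup>+x. nabs h x * nconv (nabs kernel) (nabs F) x \<partial>lborel) \<le> (\<integral>\<^sup>+x. nabs h x * nconv (nres 0) (nabs F) x \<partial>lborel)"
    by (intro nn_integral_mono mult_left_mono nconv_kernel_F_le) auto
  also have "\<dots> < \<infinity>"
    by (rule nn_integral_mult_finite) (use nn_integral_nconv_nres_0_finite nn_integral_square_less_top[of h lborel] h in auto)
  finally have "(LINT x|lborel. h x * (LINT y|lborel. kernel (x - y) * F y)) = (LINT y|lborel. (LINT x|lborel. h x * kernel (x - y)) * F y)"
    by (intro integral_kernel_swap(2)) auto
  then show ?thesis
    by (simp add: rconv_def mult.commute k[of _ "_ :: real^'d"])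
qed

lemma integral_rconv_res_1_mult:
  assumes [measurable]: "h \<in> borel_measurable borel" and h: "integrable lborel (\<lambda>x. (h x)\<^sup>2)"
  shows "integrable lborel (\<lambda>x. h x * rconv (res 1) F x)"
    "(LINT x|lborel. h x * rconv (res 1) F x) = (LINT x|lborel. F x * rconv (res 1) h x)"
proof -
  have k: "res 1 (x - y) = res 1 (y - x)" for x y :: "real^'d"
    using res_minus[of 1 "x - y"] by simp
  have "(\<integral>\<^sup>+x. (nconv (nres 1) (nabs F) x)\<^sup>2 \<partial>lborel) \<le> (\<integral>\<^sup>+x. (nconv (nres 0) (nabs F) x)\<^sup>2 \<partial>lborel)"
    unfolding nconv_def by (intro nn_integral_mono power_mono mult_right_mono nres_antimono) auto
  then have 1: "(\<integral>\<^sup>+x. (nconv (nres 1) (nabs F) x)\<^sup>2 \<partial>lborel) < \<infinity>"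
    using nn_integral_nconv_nres_0_finite by (rule le_less_trans)
  have "(\<integral>\<^sup>+x. nabs h x * nconv (nabs (res 1)) (nabs F) x \<partial>lborel) \<le> (\<integral>\<^sup>+x. nabs h x * nconv (nres 1) (nabs F) x \<partial>lborel)"
    unfolding nconv_def by (intro nn_integral_mono mult_left_mono mult_right_mono nabs_res_le) auto
  also have "\<dots> < \<infinity>"
    by (rule nn_integral_mult_finite) (use 1 nn_integral_square_less_top[of h lborel] h in auto)
  finally have fin: "(\<integral>\<^sup>+x. nabs h x * nconv (nabs (res 1)) (nabs F) x \<partial>lborel) < \<infinity>" .
  show "integrable lborel (\<lambda>x. h x * rconv (res 1) F x)"
    unfolding rconv_def by (rule integral_kernel_swap(1)) (use fin in auto)
  have "(LINT x|lborel. h x * rconv (res 1) F x) = (LINT y|lborel. (LINT x|lborel. h x * res 1 (x - y)) * F y)"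
    unfolding rconv_def by (intro integral_kernel_swap(2)) (use fin in auto)
  also have "\<dots> = (LINT x|lborel. F x * rconv (res 1) h x)"
  proof -
    have "(LINT x|lborel. h x * res 1 (x - y)) = rconv (res 1) h y" for y
      unfolding rconv_def by (intro Bochner_Integration.integral_cong refl) (simp add: k mult.commute)
    then show ?thesis by (simp add: mult.commute)
  qed
  finally show "(LINT x|lborel. h x * rconv (res 1) F x) = (LINT x|lborel. F x * rconv (res 1) h x)" .
qed

text \<open>
  Transposing the convolutions, which are symmetric, reduces both claims to the action of the kernel on
  test functions.
\<close>

theorem rconv_kernel_weak_solution:
  assumes \<psi>: "test_function \<psi>"
  shows "(LINT x|lborel. rconv kernel F x * pde_op \<psi> x) = (LINT x|lborel. F x * \<psi> x)"
    "(LINT x|lborel. rconv kernel F x * laplacian (laplacian \<psi>) x) = (LINT x|lborel. (F x - rconv (res 1) F x) * \<psi> x)"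
proof -
  have d: "CARD('d) > 2" using d5 by simp
  have t: "test_function (pde_op \<psi>)" "test_function (laplacian (laplacian \<psi>))"
    by (intro test_function_pde_op test_function_laplacian \<psi>)+
  show "(LINT x|lborel. rconv kernel F x * pde_op \<psi> x) = (LINT x|lborel. F x * \<psi> x)"
    by (simp add: integral_rconv_kernel_mult test_function_borel test_function_integrable t rconv_kernel_pde_op[OF \<psi> d])
  have i: "integrable lborel (\<lambda>x. F x * \<psi> x)"
    by (rule Cauchy_Schwarz_integral) (use \<psi> F_sq in \<open>auto intro: test_function_borel test_function_integrable\<close>)
  note r = integral_rconv_res_1_mult[OF test_function_borel[OF \<psi>] test_function_integrable(2)[OF \<psi>]]
  have i': "integrable lborel (\<lambda>x. F x * rconv (res 1) \<psi> x)"
  proof (rule Cauchy_Schwarz_integral)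
    show "integrable lborel (\<lambda>x. (rconv (res 1) \<psi> x)\<^sup>2)"
      using \<psi> by (intro rconv_res_1_square_le_form test_function_borel test_function_integrable)
  qed (use \<psi> F_sq in \<open>auto intro: test_function_borel\<close>)
  have "(LINT x|lborel. rconv kernel F x * laplacian (laplacian \<psi>) x) = (LINT x|lborel. F x * (\<psi> x - rconv (res 1) \<psi> x))"
    by (simp add: integral_rconv_kernel_mult test_function_borel test_function_integrable t rconv_kernel_bilaplacian[OF \<psi> d])
  also have "\<dots> = (LINT x|lborel. F x * \<psi> x) - (LINT x|lborel. \<psi> x * rconv (res 1) F x)"
    unfolding right_diff_distrib r(2) using i i' by simp
  also have "\<dots> = (LINT x|lborel. (F x - rconv (res 1) F x) * \<psi> x)"
    using i r(1) by (subst Bochner_Integration.integral_diff[symmetric]) (auto simp: algebra_simps)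
  finally show "(LINT x|lborel. rconv kernel F x * laplacian (laplacian \<psi>) x) = (LINT x|lborel. (F x - rconv (res 1) F x) * \<psi> x)" .
qed

end

text \<open>
  Write \<open>\<psi>\<close> as the convolution of \<open>kernel\<close> with \<open>pde_op \<psi>\<close>.  After Fubini's theorem \<open>u\<close> is paired with
  translates of \<open>pde_op \<psi>\<close>, and these are images of translated test functions, so every pairing is
  zero.
\<close>

theorem weak_solution_0_unique:
  fixes u :: "real^'d \<Rightarrow> real"
  assumes [measurable]: "u \<in> borel_measurable borel" and u: "integrable lborel (\<lambda>x. (u x)\<^sup>2)" and d5: "CARD('d) \<ge> 5"
    and 0: "\<And>\<psi>. test_function \<psi> \<Longrightarrow> (LINT x|lborel. u x * pde_op \<psi> x) = 0"
    and \<psi>: "test_function \<psi>"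
  shows "(LINT x|lborel. u x * \<psi> x) = 0"
proof -
  let ?h = "pde_op \<psi>"
  have h: "test_function ?h" by (rule test_function_pde_op[OF \<psi>])
  note [measurable] = test_function_borel[OF h]
  have k: "rconv kernel ?h x = (LINT y|lborel. ?h (x - y) * kernel y)" for x
    using integral_lborel_reflect(1)[of "\<lambda>y. kernel y * ?h (x - y)" x] by (simp add: rconv_def mult.commute)
  have "(\<integral>\<^sup>+x. nabs u x * nconv (nabs ?h) (nabs kernel) x \<partial>lborel) = (\<integral>\<^sup>+x. nabs u x * nconv (nabs kernel) (nabs ?h) x \<partial>lborel)"
    by (subst nconv_commute) auto
  also have "\<dots> \<le> (\<integral>\<^sup>+x. nabs u x * nconv (nres 0) (nabs ?h) x \<partial>lborel)"
    unfolding nconv_def by (intro nn_integral_mono mult_left_mono mult_right_mono nabs_kernel_le) auto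
  also have "\<dots> < \<infinity>"
    by (rule nn_integral_mult_finite) (use nn_integral_square_less_top[of u lborel] u
        nn_integral_nconv_nres_0_finite[OF _ test_function_integrable[OF h] d5] in auto)
  finally have fin: "(\<integral>\<^sup>+x. nabs u x * nconv (nabs ?h) (nabs kernel) x \<partial>lborel) < \<infinity>" .
  have "(LINT x|lborel. u x * \<psi> x) = (LINT x|lborel. u x * (LINT y|lborel. ?h (x - y) * kernel y))"
    using rconv_kernel_pde_op[OF \<psi>] d5 by (simp add: k)
  also have "\<dots> = (LINT y|lborel. (LINT x|lborel. u x * ?h (x - y)) * kernel y)"
    by (rule integral_kernel_swap(2)) (use fin in auto)
  also have "\<dots> = 0"
  proof -
    have "(LINT x|lborel. u x * ?h (x - y)) = 0" for y
    proof -
      have "pde_op (\<lambda>x. \<psi> (- y + x)) = (\<lambda>x. ?h (- y + x))"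
        unfolding pde_op_def[abs_def] laplacian_translate[OF \<psi>]
          laplacian_translate[OF test_function_laplacian[OF \<psi>]] ..
      then show ?thesis using 0[OF test_function_translate[OF \<psi>, of "- y"]] by simp
    qed
    then show ?thesis by simp
  qed
  finally show ?thesis .
qed

section \<open>Weak solutions and the fourth-order Sobolev norm\<close>

lemma borel_imp_lebesgue: "f \<in> borel_measurable borel \<Longrightarrow> f \<in> borel_measurable lebesgue"
  by (intro measurable_completion) simp

text \<open>
  Lebesgue measurable functions are replaced by Borel functions to which the convolution results apply.
\<close>

lemma lebesgue_borel_version:
  fixes f :: "'a::euclidean_space \<Rightarrow> real"
  assumes "f \<in> borel_measurable lebesgue"
  obtains f' where "f' \<in> borel_measurable borel" "AE x in lebesgue. f x = f' x"
  using completion_ex_borel_measurable_real[OF assms] by (auto simp: AE_completion_iff)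

lemma lebesgue_lborel:
  fixes f f' :: "'a::euclidean_space \<Rightarrow> real"
  assumes "f \<in> borel_measurable lebesgue" "f' \<in> borel_measurable borel" "AE x in lebesgue. f x = f' x"
  shows "integral\<^sup>L lebesgue f = integral\<^sup>L lborel f'" "integrable lebesgue f \<longleftrightarrow> integrable lborel f'"
proof -
  have f': "f' \<in> borel_measurable lebesgue" by (rule borel_imp_lebesgue[OF assms(2)])
  have "integral\<^sup>L lebesgue f = integral\<^sup>L lebesgue f'" by (rule integral_cong_AE[OF assms(1) f' assms(3)])
  then show "integral\<^sup>L lebesgue f = integral\<^sup>L lborel f'" using assms(2) by (simp add: integral_completion)
  have "integrable lebesgue f \<longleftrightarrow> integrable lebesgue f'" by (rule integrable_cong_AE[OF assms(1) f' assms(3)])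
  then show "integrable lebesgue f \<longleftrightarrow> integrable lborel f'" using assms(2) by (simp add: integrable_completion)
qed

lemma lebesgue_lborel_self:
  fixes f :: "'a::euclidean_space \<Rightarrow> real"
  assumes "f \<in> borel_measurable borel"
  shows "integral\<^sup>L lebesgue f = integral\<^sup>L lborel f" "integrable lebesgue f \<longleftrightarrow> integrable lborel f"
  using lebesgue_lborel[OF borel_imp_lebesgue[OF assms] assms] by auto

lemma L2_spaceD:
  assumes "\<phi> \<in> L2_space"
  shows "\<phi> \<in> borel_measurable lebesgue" "integrable lebesgue (\<lambda>x. (\<phi> x)\<^sup>2)"
  using assms by (auto simp: L2_space_def)

lemma L2_norm_nonneg [simp]: "L2_norm \<phi> \<ge> 0"
  by (simp add: L2_norm_def)

lemma L2_norm_square: "(L2_norm \<phi>)\<^sup>2 = (LINT x|lebesgue. (\<phi> x)\<^sup>2)"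
  by (simp add: L2_norm_def)

lemma L2_space_mult:
  assumes "f \<in> L2_space" "g \<in> L2_space"
  shows "integrable lebesgue (\<lambda>x. f x * g x)" "(LINT x|lebesgue. \<bar>f x * g x\<bar>) \<le> L2_norm f * L2_norm g"
  using Cauchy_Schwarz_integral[of f lebesgue g] L2_spaceD[OF assms(1)] L2_spaceD[OF assms(2)]
  by (auto simp: L2_norm_def)

lemma L2_space_add: 
  assumes "f \<in> L2_space" "g \<in> L2_space"
  shows "(\<lambda>x. f x + g x) \<in> L2_space" "L2_norm (\<lambda>x. f x + g x) \<le> L2_norm f + L2_norm g"
proof -
  note D = L2_spaceD[OF assms(1)] L2_spaceD[OF assms(2)]
  note m = L2_space_mult[OF assms]
  have e: "(f x + g x)\<^sup>2 = (f x)\<^sup>2 + 2 * (f x * g x) + (g x)\<^sup>2" for x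
    by (simp add: power2_eq_square algebra_simps)
  show "(\<lambda>x. f x + g x) \<in> L2_space"
    unfolding L2_space_def using D m(1) by (auto simp: e)
  have "(L2_norm (\<lambda>x. f x + g x))\<^sup>2 = (L2_norm f)\<^sup>2 + 2 * (LINT x|lebesgue. f x * g x) + (L2_norm g)\<^sup>2"
    unfolding L2_norm_square e using D m(1) by simp
  also have "\<dots> \<le> (L2_norm f)\<^sup>2 + 2 * (L2_norm f * L2_norm g) + (L2_norm g)\<^sup>2"
  proof -
    have "(LINT x|lebesgue. f x * g x) \<le> (LINT x|lebesgue. \<bar>f x * g x\<bar>)"
      using integral_abs_bound[of lebesgue "\<lambda>x. f x * g x"] by linarith
    then show ?thesis using m(2) by linarith
  qed
  also have "\<dots> = (L2_norm f + L2_norm g)\<^sup>2" by (simp add: power2_eq_square algebra_simps)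
  finally show "L2_norm (\<lambda>x. f x + g x) \<le> L2_norm f + L2_norm g"
    by (rule power2_le_imp_le) simp
qed

lemma L2_space_cmult:
  assumes "f \<in> L2_space"
  shows "(\<lambda>x. c * f x) \<in> L2_space" "L2_norm (\<lambda>x. c * f x) = \<bar>c\<bar> * L2_norm f"
proof -
  show "(\<lambda>x. c * f x) \<in> L2_space"
    using L2_spaceD[OF assms] by (auto simp: L2_space_def power_mult_distrib)
  show "L2_norm (\<lambda>x. c * f x) = \<bar>c\<bar> * L2_norm f"
    by (simp add: L2_norm_def power_mult_distrib real_sqrt_mult)
qed

lemma L2_space_diff:
  assumes "f \<in> L2_space" "g \<in> L2_space"
  shows "(\<lambda>x. f x - g x) \<in> L2_space"
  using L2_space_add(1)[OF assms(1) L2_space_cmult(1)[OF assms(2), of "-1"]] by simp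

lemma L2_cong_AE:
  assumes "f \<in> L2_space" "g \<in> borel_measurable lebesgue" "ae_eq f g"
  shows "g \<in> L2_space" "L2_norm g = L2_norm f"
proof -
  note D = L2_spaceD[OF assms(1)]
  have sq: "AE x in lebesgue. (g x)\<^sup>2 = (f x)\<^sup>2" using assms(3) by eventually_elim simp
  show "g \<in> L2_space" unfolding L2_space_def using D assms(2) integrable_cong_AE[OF _ _ sq] by simp
  show "L2_norm g = L2_norm f" unfolding L2_norm_def using integral_cong_AE[OF _ _ sq] D assms(2) by simp
qed

lemma L2_norm_eq_0:
  assumes "f \<in> L2_space" "L2_norm f = 0"
  shows "AE x in lebesgue. f x = 0"
proof -
  have "(LINT x|lebesgue. (f x)\<^sup>2) = 0" using assms(2) L2_norm_square[of f] by simp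
  then have "AE x in lebesgue. (f x)\<^sup>2 = 0"
    using integral_nonneg_eq_0_iff_AE[OF L2_spaceD(2)[OF assms(1)]] by simp
  then show ?thesis by simp
qed

lemma L2_borel_version:
  assumes "f \<in> L2_space"
  obtains f' where "f' \<in> borel_measurable borel" "ae_eq f f'" "integrable lborel (\<lambda>x. (f' x)\<^sup>2)"
    "(LINT x|lborel. (f' x)\<^sup>2) = (L2_norm f)\<^sup>2"
proof -
  note D = L2_spaceD[OF assms]
  obtain f' where f': "f' \<in> borel_measurable borel" "ae_eq f f'" using lebesgue_borel_version[OF D(1)] by metis
  have sq: "AE x in lebesgue. (f x)\<^sup>2 = (f' x)\<^sup>2" using f'(2) by eventually_elim simp
  note l = lebesgue_lborel[OF _ _ sq]
  show thesis
    using f' l D that by (simp add: L2_norm_square)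
qed

lemma L2_space_lborel:
  assumes "f \<in> borel_measurable borel" "integrable lborel (\<lambda>x. (f x)\<^sup>2)"
  shows "f \<in> L2_space" "(L2_norm f)\<^sup>2 = (LINT x|lborel. (f x)\<^sup>2)"
  using assms lebesgue_lborel_self[of "\<lambda>x. (f x)\<^sup>2"] borel_imp_lebesgue[OF assms(1)]
  by (auto simp: L2_space_def L2_norm_square)

lemma test_function_L2: "test_function h \<Longrightarrow> h \<in> L2_space"
  by (intro L2_space_lborel test_function_borel test_function_integrable)

lemma integral_mult_borel_version:
  fixes f f' h :: "'a::euclidean_space \<Rightarrow> real"
  assumes "f \<in> borel_measurable lebesgue" "f' \<in> borel_measurable borel" "AE x in lebesgue. f x = f' x" "h \<in> borel_measurable borel"
  shows "(LINT x|lebesgue. f x * h x) = (LINT x|lborel. f' x * h x)"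
proof (rule lebesgue_lborel(1))
  show "AE x in lebesgue. f x * h x = f' x * h x" using assms(3) by eventually_elim simp
qed (use assms borel_imp_lebesgue[OF assms(4)] in auto)

lemma set_integrable_L2:
  assumes "f \<in> L2_space"
  shows "set_integrable lebesgue (cbox a b) f"
proof -
  have "indicator (cbox a b) \<in> (L2_space :: (real^'a \<Rightarrow> real) set)"
  proof -
    have "(\<lambda>x. (indicator (cbox a b) x)\<^sup>2) = (indicator (cbox a b) :: real^'a \<Rightarrow> real)"
      by (auto simp: indicator_def fun_eq_iff)
    moreover have "integrable lebesgue (indicator (cbox a b) :: real^'a \<Rightarrow> real)"
      using emeasure_lborel_cbox_finite[of a b] by (intro integrable_real_indicator) auto
    ultimately show ?thesis by (simp add: L2_space_def)
  qed
  from L2_space_mult(1)[OF this assms] show ?thesis by (simp add: set_integrable_def)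
qed

lemma L2_weakly_0:
  assumes "f \<in> L2_space" "\<And>\<psi>. test_function \<psi> \<Longrightarrow> (LINT x|lebesgue. f x * \<psi> x) = 0"
  shows "AE x in lebesgue. f x = 0"
  by (rule fundamental_lemma[OF set_integrable_L2[OF assms(1)] assms(2)])

lemma H4_norm_nonneg [simp]: "H4_norm \<phi> \<ge> 0"
  by (simp add: H4_norm_def)

lemma H4_norm_square: "(H4_norm \<phi>)\<^sup>2 = (L2_norm \<phi>)\<^sup>2 + (L2_norm (weak_bilaplacian \<phi>))\<^sup>2"
  by (simp add: H4_norm_def)

text \<open>
  By the fundamental lemma any weak bilaplacian may be used in place of the chosen one.
\<close>

lemma H4_norm_eq:
  assumes "w \<in> L2_space" "has_weak_bilaplacian \<phi> w"
  shows "(H4_norm \<phi>)\<^sup>2 = (L2_norm \<phi>)\<^sup>2 + (L2_norm w)\<^sup>2"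
proof -
  let ?w = "weak_bilaplacian \<phi>"
  have w: "?w \<in> L2_space \<and> has_weak_bilaplacian \<phi> ?w"
    unfolding weak_bilaplacian_def
    by (rule someI[of "\<lambda>w. w \<in> L2_space \<and> has_weak_bilaplacian \<phi> w" w]) (use assms in blast)
  have "AE x in lebesgue. w x - ?w x = 0"
  proof (rule L2_weakly_0)
    fix \<psi> :: "real^'a \<Rightarrow> real" assume \<psi>: "test_function \<psi>"
    have "(LINT x|lebesgue. w x * \<psi> x) = (LINT x|lebesgue. ?w x * \<psi> x)"
      using assms(2) w \<psi> by (simp add: has_weak_bilaplacian_def)
    then show "(LINT x|lebesgue. (w x - ?w x) * \<psi> x) = 0"
      using L2_space_mult(1)[OF assms(1) test_function_L2[OF \<psi>]] L2_space_mult(1)[OF conjunct1[OF w] test_function_L2[OF \<psi>]]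
      by (simp add: left_diff_distrib)
  qed (intro L2_space_diff assms conjunct1[OF w])
  then have "ae_eq ?w w" by eventually_elim simp
  then have "L2_norm w = L2_norm ?w"
    by (rule L2_cong_AE(2)[OF conjunct1[OF w] L2_spaceD(1)[OF assms(1)]])
  then show ?thesis by (simp add: H4_norm_square)
qed

lemma locally_integrable_L1: "F \<in> L1_space \<Longrightarrow> locally_integrable F"
  unfolding locally_integrable_def set_integrable_def L1_space_def mem_Collect_eq
  by (intro allI impI integrable_mult_indicator lmeasurable_compact[THEN fmeasurableD])

lemma solves_PDE_iff:
  "solves_PDE u F \<longleftrightarrow> locally_integrable F \<and>
     (\<forall>\<psi>. test_function \<psi> \<longrightarrow> (LINT x|lebesgue. u x * pde_op \<psi> x) = (LINT x|lebesgue. F x * \<psi> x))"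
  by (simp add: solves_PDE_def pde_op_def)

lemma solution_unique:
  fixes u v :: "real^'d \<Rightarrow> real"
  assumes d: "CARD('d) \<ge> 5" and u: "u \<in> L2_space" "solves_PDE u F" and v: "v \<in> L2_space" "solves_PDE v F"
  shows "ae_eq u v"
proof -
  let ?w = "\<lambda>x. u x - v x"
  have w: "?w \<in> L2_space" by (intro L2_space_diff u v)
  obtain w' where w': "w' \<in> borel_measurable borel" "ae_eq ?w w'" "integrable lborel (\<lambda>x. (w' x)\<^sup>2)"
    by (rule L2_borel_version[OF w])
  have "AE x in lebesgue. ?w x = 0"
  proof (rule L2_weakly_0[OF w])
    fix \<psi> :: "real^'d \<Rightarrow> real" assume \<psi>: "test_function \<psi>"
    have "(LINT x|lborel. w' x * pde_op \<phi> x) = 0" if \<phi>: "test_function \<phi>" for \<phi>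
    proof -
      have t: "pde_op \<phi> \<in> L2_space" by (intro test_function_L2 test_function_pde_op \<phi>)
      have "(LINT x|lborel. w' x * pde_op \<phi> x) = (LINT x|lebesgue. ?w x * pde_op \<phi> x)"
        by (rule integral_mult_borel_version[symmetric, OF L2_spaceD(1)[OF w] w'(1,2) test_function_borel[OF test_function_pde_op[OF \<phi>]]])
      also have "\<dots> = (LINT x|lebesgue. u x * pde_op \<phi> x) - (LINT x|lebesgue. v x * pde_op \<phi> x)"
        using L2_space_mult(1)[OF u(1) t] L2_space_mult(1)[OF v(1) t] by (simp add: left_diff_distrib)
      also have "\<dots> = 0" using u(2) v(2) \<phi> by (simp add: solves_PDE_iff)
      finally show ?thesis .
    qed
    then have "(LINT x|lborel. w' x * \<psi> x) = 0"
      by (rule weak_solution_0_unique[OF w'(1,3) d _ \<psi>])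
    then show "(LINT x|lebesgue. ?w x * \<psi> x) = 0"
      using integral_mult_borel_version[OF L2_spaceD(1)[OF w] w'(1,2) test_function_borel[OF \<psi>]] by simp
  qed
  then show ?thesis by eventually_elim simp
qed

theorem solution_exists:
  fixes F :: "real^'d \<Rightarrow> real"
  assumes d: "CARD('d) \<ge> 5" and F: "F \<in> L1_space \<inter> L2_space"
  obtains u w where "u \<in> L2_space" "solves_PDE u F" "w \<in> L2_space" "has_weak_bilaplacian u w"
    "L2_norm w \<le> L2_norm F"
    "\<forall>T>0. (L2_norm u)\<^sup>2 \<le> T\<^sup>2 / 2 * (L2_norm F)\<^sup>2
       + (4 * pi) powr (- real CARD('d) / 2) * (T powr (2 - real CARD('d) / 2) / (real CARD('d) / 2 - 2)) * (L1_norm F)\<^sup>2"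
proof -
  have FL2: "F \<in> L2_space" and FL1: "integrable lebesgue F" using F by (auto simp: L1_space_def)
  note FD = L2_spaceD[OF FL2]
  obtain F' where F': "F' \<in> borel_measurable borel" "ae_eq F F'" "integrable lborel (\<lambda>x. (F' x)\<^sup>2)"
    "(LINT x|lborel. (F' x)\<^sup>2) = (L2_norm F)\<^sup>2"
    by (rule L2_borel_version[OF FL2])
  have F'1: "integrable lborel F'" using lebesgue_lborel(2)[OF FD(1) F'(1,2)] FL1 by simp
  have F'n: "(LINT x|lborel. \<bar>F' x\<bar>) = L1_norm F"
    unfolding L1_norm_def
  proof (rule lebesgue_lborel(1)[symmetric])
    show "AE x in lebesgue. \<bar>F x\<bar> = \<bar>F' x\<bar>" using F'(2) by eventually_elim simp
  qed (use FD(1) F'(1) in auto)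
  define u where "u = rconv kernel F'"
  define w where "w x = F' x - rconv (res 1) F' x" for x
  have [measurable]: "F' \<in> borel_measurable borel" by (rule F')
  have um: "u \<in> borel_measurable borel" and wm: "w \<in> borel_measurable borel"
    unfolding u_def w_def[abs_def] by measurable
  note uL = rconv_kernel_L2[OF F'(1) F'1 F'(3) d, folded u_def]
  note wL = rconv_res_1_complement_L2_le[OF F'(1) F'1 F'(3), folded w_def]
  note weak = rconv_kernel_weak_solution[OF F'(1) F'1 F'(3) d, folded u_def w_def]
  note uL2 = L2_space_lborel[OF um uL(1)[OF zero_less_one]] and wL2 = L2_space_lborel[OF wm wL(1)]
  have c: "(LINT x|lebesgue. f x * h x) = (LINT x|lborel. f x * h x)"
    if "f \<in> borel_measurable borel" "test_function h" for f h :: "real^'d \<Rightarrow> real"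
    by (rule lebesgue_lborel_self(1)) (use that test_function_borel[OF that(2)] in auto)
  have 1: "solves_PDE u F"
    unfolding solves_PDE_iff
  proof (intro conjI allI impI)
    fix \<psi> :: "real^'d \<Rightarrow> real" assume \<psi>: "test_function \<psi>"
    show "(LINT x|lebesgue. u x * pde_op \<psi> x) = (LINT x|lebesgue. F x * \<psi> x)"
      using weak(1)[OF \<psi>] c[OF um test_function_pde_op[OF \<psi>]]
        integral_mult_borel_version[OF FD(1) F'(1,2) test_function_borel[OF \<psi>]] by simp
  qed (use F locally_integrable_L1 in auto)
  have 2: "has_weak_bilaplacian u w"
    unfolding has_weak_bilaplacian_def
    using weak(2) c[OF um test_function_laplacian[OF test_function_laplacian]] c[OF wm] by simp
  have "(L2_norm w)\<^sup>2 \<le> (L2_norm F)\<^sup>2" using wL(2) F'(4) wL2(2) by simp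
  then have 3: "L2_norm w \<le> L2_norm F" by (rule power2_le_imp_le) simp
  show thesis
    using that[OF uL2(1) 1 wL2(1) 2 3] uL(2) unfolding uL2(2) F'(4) F'n by blast
qed

text \<open>
  Every solution in \<open>L\<^sup>2\<close> coincides with the constructed one and inherits its bounds.
\<close>

theorem solution_estimate:
  fixes u F :: "real^'d \<Rightarrow> real"
  assumes d: "CARD('d) \<ge> 5" and F: "F \<in> L1_space \<inter> L2_space" and u: "u \<in> L2_space" "solves_PDE u F"
  shows "u \<in> H4_space"
    "T > 0 \<Longrightarrow> (H4_norm u)\<^sup>2 \<le> T\<^sup>2 / 2 * (L2_norm F)\<^sup>2
       + (4 * pi) powr (- real CARD('d) / 2) * (T powr (2 - real CARD('d) / 2) / (real CARD('d) / 2 - 2)) * (L1_norm F)\<^sup>2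
       + (L2_norm F)\<^sup>2"
proof -
  obtain v w where v: "v \<in> L2_space" "solves_PDE v F" "w \<in> L2_space" "has_weak_bilaplacian v w"
    "L2_norm w \<le> L2_norm F"
    "\<forall>T>0. (L2_norm v)\<^sup>2 \<le> T\<^sup>2 / 2 * (L2_norm F)\<^sup>2
       + (4 * pi) powr (- real CARD('d) / 2) * (T powr (2 - real CARD('d) / 2) / (real CARD('d) / 2 - 2)) * (L1_norm F)\<^sup>2"
    by (rule solution_exists[OF d F])
  have uv: "ae_eq u v" by (rule solution_unique[OF d u v(1,2)])
  have vn: "L2_norm v = L2_norm u"
    using L2_cong_AE(2)[OF u(1) L2_spaceD(1)[OF v(1)] uv] .
  have uw: "has_weak_bilaplacian u w"
    unfolding has_weak_bilaplacian_def
  proof (intro allI impI)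
    fix \<psi> :: "real^'d \<Rightarrow> real" assume \<psi>: "test_function \<psi>"
    then have "laplacian (laplacian \<psi>) \<in> borel_measurable lebesgue"
      by (intro borel_imp_lebesgue test_function_borel test_function_laplacian)
    then have "(LINT x|lebesgue. u x * laplacian (laplacian \<psi>) x) = (LINT x|lebesgue. v x * laplacian (laplacian \<psi>) x)"
      using uv L2_spaceD(1)[OF u(1)] L2_spaceD(1)[OF v(1)] by (intro integral_cong_AE borel_measurable_times eventually_mono[OF uv]) auto
    then show "(LINT x|lebesgue. u x * laplacian (laplacian \<psi>) x) = (LINT x|lebesgue. w x * \<psi> x)"
      using v(4) \<psi> by (simp add: has_weak_bilaplacian_def)
  qed
  show "u \<in> H4_space" using u(1) v(3) uw by (auto simp: H4_space_def)
  assume T: "T > 0"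
  have "(L2_norm w)\<^sup>2 \<le> (L2_norm F)\<^sup>2" using v(5) by (intro power_mono) auto
  then show "(H4_norm u)\<^sup>2 \<le> T\<^sup>2 / 2 * (L2_norm F)\<^sup>2
       + (4 * pi) powr (- real CARD('d) / 2) * (T powr (2 - real CARD('d) / 2) / (real CARD('d) / 2 - 2)) * (L1_norm F)\<^sup>2
       + (L2_norm F)\<^sup>2"
    using add_mono[OF v(6)[rule_format, OF T]] unfolding H4_norm_eq[OF v(3) uw] vn by blast
qed

section \<open>Young inequalities for Lebesgue measurable functions\<close>

lemma AE_lebesgue_reflect:
  fixes P :: "'a::euclidean_space \<Rightarrow> bool"
  assumes "AE x in lebesgue. P x"
  shows "AE y in lebesgue. P (t - y)"
proof -
  have "AE x in lborel. P x" using assms by (simp add: AE_completion_iff)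
  then have "AE x in distr lborel borel (\<lambda>y. t - y). P x" unfolding distr_lborel_reflect .
  then have "AE y in lborel. P (t - y)" by (rule AE_distrD[rotated]) simp
  then show ?thesis by (simp add: AE_completion_iff)
qed

lemma L2_reflect:
  assumes "f \<in> L2_space"
  shows "(\<lambda>y. f (t - y)) \<in> L2_space"
proof -
  obtain f' where f': "f' \<in> borel_measurable borel" "ae_eq f f'" "integrable lborel (\<lambda>x. (f' x)\<^sup>2)"
    by (rule L2_borel_version[OF assms])
  note [measurable] = f'(1)
  have "(\<lambda>y. f' (t - y)) \<in> L2_space"
    using f'(3) integral_lborel_reflect(2)[of "\<lambda>x. (f' x)\<^sup>2" t] by (intro L2_space_lborel) auto
  moreover have ae: "AE y in lebesgue. f' (t - y) = f (t - y)"
    by (rule AE_lebesgue_reflect) (use f'(2) in \<open>eventually_elim, simp\<close>)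
  moreover have "(\<lambda>y. f (t - y)) \<in> borel_measurable lebesgue"
    by (rule borel_measurable_AE[OF _ ae]) (use borel_imp_lebesgue[of "\<lambda>y. f' (t - y)"] in simp)
  ultimately show ?thesis using L2_cong_AE(1) by blast
qed

text \<open>
  The convolution in the form in which it occurs in the system.
\<close>

definition lconv :: "(real^'d \<Rightarrow> real) \<Rightarrow> (real^'d \<Rightarrow> real) \<Rightarrow> real^'d \<Rightarrow> real" where
  "lconv H G x = (LINT y|lebesgue. H (x - y) * G y)"

text \<open>
  Equality holds at every point, not just almost everywhere, because translates and reflections of null
  sets are null.
\<close>

lemma lconv_eq_rconv:
  assumes H: "H \<in> L2_space" "H' \<in> borel_measurable borel" "ae_eq H H'"
    and G: "G \<in> L2_space" "G' \<in> borel_measurable borel" "ae_eq G G'"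
  shows "lconv H G = rconv H' G'"
proof
  fix x
  note [measurable] = H(2) G(2)
  show "lconv H G x = rconv H' G' x"
    unfolding lconv_def rconv_def
  proof (rule lebesgue_lborel(1))
    show "AE y in lebesgue. H (x - y) * G y = H' (x - y) * G' y"
      using AE_lebesgue_reflect[OF H(3), of x] G(3) by eventually_elim simp
  qed (use L2_spaceD(1)[OF L2_reflect[OF H(1)]] L2_spaceD(1)[OF G(1)] in auto)
qed

lemma lconv_diff:
  assumes "H \<in> L2_space" "G1 \<in> L2_space" "G2 \<in> L2_space"
  shows "lconv H (\<lambda>y. G1 y - G2 y) x = lconv H G1 x - lconv H G2 x"
  unfolding lconv_def
  using L2_space_mult(1)[OF L2_reflect[OF assms(1)] assms(2), of x] L2_space_mult(1)[OF L2_reflect[OF assms(1)] assms(3), of x]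
  by (simp add: right_diff_distrib)

lemma L1_norm_nonneg [simp]: "L1_norm f \<ge> 0"
  by (simp add: L1_norm_def)

lemma L1_borel_norm:
  assumes "f \<in> L1_space" "f' \<in> borel_measurable borel" "ae_eq f f'"
  shows "integrable lborel f'" "(\<integral>\<^sup>+x. nabs f' x \<partial>lborel) = ennreal (L1_norm f)"
proof -
  have i: "integrable lebesgue f" using assms(1) by (simp add: L1_space_def)
  have fm: "f \<in> borel_measurable lebesgue" using i by auto
  show i': "integrable lborel f'" using lebesgue_lborel(2)[OF fm assms(2,3)] i by simp
  have "L1_norm f = (LINT x|lborel. \<bar>f' x\<bar>)"
    unfolding L1_norm_def
  proof (rule lebesgue_lborel(1))
    show "AE x in lebesgue. \<bar>f x\<bar> = \<bar>f' x\<bar>" using assms(3) by eventually_elim simp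
  qed (use fm assms(2) in auto)
  then show "(\<integral>\<^sup>+x. nabs f' x \<partial>lborel) = ennreal (L1_norm f)"
    using i' by (simp add: nn_integral_eq_integral)
qed

text \<open>
  The three cases of Young's inequality that the a priori estimate uses; the last one exchanges the
  roles of \<open>H\<close> and \<open>G\<close>.
\<close>

theorem lconv_bounds:
  fixes H G :: "real^'d \<Rightarrow> real"
  assumes H: "H \<in> L1_space \<inter> L2_space" and G: "G \<in> L1_space \<inter> L2_space"
  shows "lconv H G \<in> L1_space \<inter> L2_space"
    "L1_norm (lconv H G) \<le> L1_norm H * L1_norm G"
    "L2_norm (lconv H G) \<le> L1_norm H * L2_norm G"
    "L2_norm (lconv H G) \<le> L2_norm H * L1_norm G"
proof -
  have H2: "H \<in> L2_space" and H1: "H \<in> L1_space" and G2: "G \<in> L2_space" and G1: "G \<in> L1_space" using H G by auto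
  obtain H' where H': "H' \<in> borel_measurable borel" "ae_eq H H'" "integrable lborel (\<lambda>x. (H' x)\<^sup>2)"
    "(LINT x|lborel. (H' x)\<^sup>2) = (L2_norm H)\<^sup>2"
    by (rule L2_borel_version[OF H2])
  obtain G' where G': "G' \<in> borel_measurable borel" "ae_eq G G'" "integrable lborel (\<lambda>x. (G' x)\<^sup>2)"
    "(LINT x|lborel. (G' x)\<^sup>2) = (L2_norm G)\<^sup>2"
    by (rule L2_borel_version[OF G2])
  note [measurable] = H'(1) G'(1)
  note nH = L1_borel_norm[OF H1 H'(1,2)] and nG = L1_borel_norm[OF G1 G'(1,2)]
  have e: "lconv H G = rconv H' G'" by (rule lconv_eq_rconv[OF H2 H'(1,2) G2 G'(1,2)])
  have n1: "(\<integral>\<^sup>+x. nabs (rconv H' G') x \<partial>lborel) \<le> ennreal (L1_norm H * L1_norm G)"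
  proof -
    have "(\<integral>\<^sup>+x. nabs (rconv H' G') x \<partial>lborel) \<le> (\<integral>\<^sup>+x. nconv (nabs H') (nabs G') x \<partial>lborel)"
      by (intro nn_integral_mono nabs_rconv_le) auto
    also have "\<dots> = ennreal (L1_norm H * L1_norm G)"
      by (simp add: nn_integral_nconv nH nG ennreal_mult)
    finally show ?thesis .
  qed
  have i: "integrable lborel (rconv H' G')"
    using n1 by (intro integrableI_bounded) (auto intro: le_less_trans)
  have l2: "integrable lborel (\<lambda>x. (rconv H' G' x)\<^sup>2)"
    "(LINT x|lborel. (rconv H' G' x)\<^sup>2) \<le> (L1_norm H)\<^sup>2 * (LINT x|lborel. (G' x)\<^sup>2)"
    using rconv_L2_le[OF H'(1) G'(1) _ _ G'(3), of "L1_norm H"] nH by auto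
  have c: "rconv H' G' = rconv G' H'"
  proof
    fix x
    show "rconv H' G' x = rconv G' H' x"
      using integral_lborel_reflect(1)[of "\<lambda>y. H' y * G' (x - y)" x] by (simp add: rconv_def mult.commute)
  qed
  have l2': "(LINT x|lborel. (rconv H' G' x)\<^sup>2) \<le> (L1_norm G)\<^sup>2 * (LINT x|lborel. (H' x)\<^sup>2)"
    using rconv_L2_le(2)[OF G'(1) H'(1) _ _ H'(3), of "L1_norm G"] nG unfolding c by auto
  note s = L2_space_lborel[OF borel_measurable_rconv[OF H'(1) G'(1)] l2(1)]
  show "lconv H G \<in> L1_space \<inter> L2_space"
    using s(1) i lebesgue_lborel_self(2)[OF borel_measurable_rconv[OF H'(1) G'(1)]] by (simp add: e L1_space_def)
  have "L1_norm (lconv H G) = (LINT x|lborel. \<bar>rconv H' G' x\<bar>)"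
    unfolding L1_norm_def e by (rule lebesgue_lborel_self) measurable
  also have "\<dots> \<le> L1_norm H * L1_norm G"
    using n1 i by (simp add: nn_integral_eq_integral)
  finally show "L1_norm (lconv H G) \<le> L1_norm H * L1_norm G" .
  have "(L2_norm (lconv H G))\<^sup>2 \<le> (L1_norm H * L2_norm G)\<^sup>2"
    using l2(2) by (simp add: e s(2) G'(4) power_mult_distrib)
  then show "L2_norm (lconv H G) \<le> L1_norm H * L2_norm G" by (rule power2_le_imp_le) simp
  have "(L2_norm (lconv H G))\<^sup>2 \<le> (L2_norm H * L1_norm G)\<^sup>2"
    using l2' by (simp add: e s(2) H'(4) power_mult_distrib mult.commute)
  then show "L2_norm (lconv H G) \<le> L2_norm H * L1_norm G" by (rule power2_le_imp_le) simp
qed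

section \<open>The nonlinearity on vector-valued functions\<close>

lemma abs_le_C_norm:
  assumes "compact S" "continuous_on S h" "z \<in> S"
  shows "\<bar>h z\<bar> \<le> C_norm S h"
proof -
  have "bounded (h ` S)" using assms compact_continuous_image compact_imp_bounded by blast
  then have "bdd_above ((\<lambda>z. \<bar>h z\<bar>) ` S)"
    by (auto simp: bounded_iff bdd_above_def)
  then show ?thesis unfolding C_norm_def using assms(3) by (rule cSUP_upper[rotated])
qed

lemma C_norm_nonneg:
  assumes "compact S" "continuous_on S h" "S \<noteq> {}"
  shows "C_norm S h \<ge> 0"
proof -
  obtain z where "z \<in> S" using assms(3) by blast
  then show ?thesis using abs_le_C_norm[OF assms(1,2)] by (meson abs_ge_zero order_trans)
qed

lemma abs_sum_component_mult_le:
  fixes v :: "real^'k"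
  assumes "\<And>i. \<bar>c i\<bar> \<le> B i"
  shows "\<bar>\<Sum>i\<in>UNIV. v $ i * c i\<bar> \<le> (\<Sum>i\<in>UNIV. B i) * norm v"
proof -
  have "\<bar>\<Sum>i\<in>UNIV. v $ i * c i\<bar> \<le> (\<Sum>i\<in>UNIV. \<bar>v $ i * c i\<bar>)" by (rule sum_abs)
  also have "\<dots> \<le> (\<Sum>i\<in>UNIV. norm v * B i)"
    unfolding abs_mult by (intro sum_mono mult_mono component_le_norm_cart assms) auto
  finally show ?thesis by (simp add: sum_distrib_left mult.commute)
qed

lemma C1_Lipschitz:
  fixes f :: "real^'k \<Rightarrow> real"
  assumes S: "compact S" "convex S" and f: "f differentiable_on S"
    and c: "\<And>i. continuous_on S (partial_deriv_on S i f)" and xy: "x \<in> S" "y \<in> S"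
  shows "\<bar>f x - f y\<bar> \<le> (\<Sum>i\<in>UNIV. C_norm S (partial_deriv_on S i f)) * norm (x - y)"
proof -
  have "norm (f x - f y) \<le> (\<Sum>i\<in>UNIV. C_norm S (partial_deriv_on S i f)) * norm (x - y)"
  proof (rule differentiable_bound[OF S(2) _ _ xy])
    fix z assume z: "z \<in> S"
    show "(f has_derivative (\<lambda>v. \<Sum>i\<in>UNIV. v $ i * partial_deriv_on S i f z)) (at z within S)"
      using f z by (intro has_derivative_partials) (auto simp: differentiable_on_def)
    show "onorm (\<lambda>v. \<Sum>i\<in>UNIV. v $ i * partial_deriv_on S i f z) \<le> (\<Sum>i\<in>UNIV. C_norm S (partial_deriv_on S i f))"
      unfolding real_norm_def
      by (rule onorm_le) (simp only: real_norm_def abs_sum_component_mult_le[OF abs_le_C_norm[OF S(1) c z]])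
  qed
  then show ?thesis by simp
qed

text \<open>
  The first bound integrates the gradient along the segment from \<open>y\<close> to \<open>x\<close>.  For the second, the
  gradient vanishes at the origin and is therefore at most \<open>A\<^sub>2 |z|\<close>; along the segment \<open>|z|\<close> is at most
  the linear interpolation of \<open>|y|\<close> and \<open>|x|\<close>, whose mean is \<open>(|x| + |y|)/2\<close>.
\<close>

lemma C2_increment_bounds:
  fixes h :: "real^'n \<Rightarrow> real"
  assumes r: "r > 0" and S: "S = cball 0 r" and h: "Ck_on 2 S h" and h0: "h 0 = 0" and g0: "GDERIV h 0 :> 0"
  obtains A1 A2 where "A1 \<ge> 0" "A2 \<ge> 0" "A1 + A2 \<le> C2_norm S h" "continuous_on S h"
    "\<forall>x\<in>S. \<forall>y\<in>S. \<bar>h x - h y\<bar> \<le> A1 * norm (x - y)"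
    "\<forall>x\<in>S. \<forall>y\<in>S. \<bar>h x - h y\<bar> \<le> A2 * (norm (x - y) * ((norm x + norm y) / 2))"
proof -
  let ?D = "partial_deriv_on S"
  have d1: "h differentiable_on S" and d2: "\<And>i. ?D i h differentiable_on S" and c2: "\<And>i j. continuous_on S (?D j (?D i h))"
    using h by (auto simp: numeral_2_eq_2)
  have c1: "continuous_on S (?D i h)" for i using d2 by (rule differentiable_imp_continuous_on)
  have c0: "continuous_on S h" using d1 by (rule differentiable_imp_continuous_on)
  have cS: "compact S" "convex S" "S \<noteq> {}" and zS: "0 \<in> S" using r by (auto simp: S)
  define A1 where "A1 = (\<Sum>i\<in>UNIV. C_norm S (?D i h))"
  define A2 where "A2 = (\<Sum>i\<in>UNIV. \<Sum>j\<in>UNIV. C_norm S (?D i (?D j h)))"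
  have A1: "A1 \<ge> 0" unfolding A1_def by (intro sum_nonneg C_norm_nonneg cS c1)
  have A2: "A2 \<ge> 0" unfolding A2_def by (intro sum_nonneg C_norm_nonneg cS c2)
  have A12: "A1 + A2 \<le> C2_norm S h"
    unfolding C2_norm_def A1_def[symmetric] A2_def[symmetric] using C_norm_nonneg[OF cS(1) c0 cS(3)] by simp
  have lip: "\<bar>h x - h y\<bar> \<le> A1 * norm (x - y)" if "x \<in> S" "y \<in> S" for x y
    unfolding A1_def by (rule C1_Lipschitz[OF cS(1,2) d1 c1 that])
  have D0: "?D i h 0 = 0" for i
  proof -
    have "at 0 within S = at 0" using r by (intro at_within_interior) (simp add: S)
    moreover have "(h has_derivative (\<lambda>v. 0)) (at 0)" using g0 by (simp add: gderiv_def)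
    ultimately show ?thesis
      unfolding partial_deriv_on_def using frechet_derivative_at by metis
  qed
  have grad: "\<bar>\<Sum>i\<in>UNIV. v $ i * ?D i h z\<bar> \<le> A2 * norm z * norm v" if z: "z \<in> S" for z v
  proof -
    have "\<bar>?D i h z\<bar> \<le> (\<Sum>j\<in>UNIV. C_norm S (?D j (?D i h))) * norm z" for i
      using C1_Lipschitz[OF cS(1,2) d2 c2 z zS, of i] by (simp add: D0)
    from abs_sum_component_mult_le[of "\<lambda>i. ?D i h z", OF this]
    have "\<bar>\<Sum>i\<in>UNIV. v $ i * ?D i h z\<bar> \<le> (\<Sum>i\<in>UNIV. (\<Sum>j\<in>UNIV. C_norm S (?D j (?D i h))) * norm z) * norm v" .
    also have "(\<Sum>i\<in>UNIV. (\<Sum>j\<in>UNIV. C_norm S (?D j (?D i h))) * norm z) = A2 * norm z"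
      unfolding A2_def by (subst sum.swap) (simp add: sum_distrib_right)
    finally show ?thesis .
  qed
  have quad: "\<bar>h x - h y\<bar> \<le> A2 * (norm (x - y) * ((norm x + norm y) / 2))" if xy: "x \<in> S" "y \<in> S" for x y
  proof -
    let ?p = "\<lambda>t. y + t *\<^sub>R (x - y)"
    let ?K = "A2 * norm (x - y)"
    have pS: "?p t \<in> S" if "0 \<le> t" "t \<le> 1" for t
    proof -
      have "?p t = (1 - t) *\<^sub>R y + t *\<^sub>R x" by (simp add: algebra_simps)
      then show ?thesis using cS(2) xy that by (simp add: convex_alt)
    qed
    have "norm (h (?p 1) - h (?p 0)) \<le> ?K * (1 * norm y - 1\<^sup>2 / 2 * norm y + 1\<^sup>2 / 2 * norm x) - ?K * (0 * norm y - 0\<^sup>2 / 2 * norm y + 0\<^sup>2 / 2 * norm x)"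
    proof (rule differentiable_bound_general[where f = "\<lambda>t. h (?p t)"
          and \<phi> = "\<lambda>t. ?K * (t * norm y - t\<^sup>2 / 2 * norm y + t\<^sup>2 / 2 * norm x)"
          and f' = "\<lambda>t. \<Sum>i\<in>UNIV. (x - y) $ i * ?D i h (?p t)" and \<phi>' = "\<lambda>t. ?K * ((1 - t) * norm y + t * norm x)"])
      show "continuous_on {0..1} (\<lambda>t. h (?p t))"
        by (rule continuous_on_compose2[OF c0]) (auto intro!: continuous_intros pS)
      show "continuous_on {0..1} (\<lambda>t. ?K * (t * norm y - t\<^sup>2 / 2 * norm y + t\<^sup>2 / 2 * norm x))"
        by (intro continuous_intros) auto
      fix t :: real assume t: "0 < t" "t < 1"
      have "(?p has_derivative (\<lambda>s. s *\<^sub>R (x - y))) (at t within {0..1})"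
        by (auto intro!: derivative_eq_intros)
      moreover have "(h has_derivative (\<lambda>v. \<Sum>i\<in>UNIV. v $ i * ?D i h (?p t))) (at (?p t) within ?p ` {0..1})"
        using d1 pS t by (intro has_derivative_subset[OF has_derivative_partials]) (auto simp: differentiable_on_def)
      ultimately have "((\<lambda>t. h (?p t)) has_derivative (\<lambda>s. \<Sum>i\<in>UNIV. (s *\<^sub>R (x - y)) $ i * ?D i h (?p t))) (at t within {0..1})"
        using has_derivative_in_compose by blast
      moreover have "at t within {0..1} = at t" using t by (intro at_within_interior) simp
      ultimately show "((\<lambda>t. h (?p t)) has_vector_derivative (\<Sum>i\<in>UNIV. (x - y) $ i * ?D i h (?p t))) (at t)"
        by (simp add: has_vector_derivative_def sum_distrib_left mult.assoc)
      show "((\<lambda>t. ?K * (t * norm y - t\<^sup>2 / 2 * norm y + t\<^sup>2 / 2 * norm x)) has_vector_derivative ?K * ((1 - t) * norm y + t * norm x)) (at t)"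
        by (auto intro!: derivative_eq_intros simp: algebra_simps simp flip: has_real_derivative_iff_has_vector_derivative)
      have "norm (\<Sum>i\<in>UNIV. (x - y) $ i * ?D i h (?p t)) \<le> A2 * norm (?p t) * norm (x - y)"
        using grad[OF pS, of t "x - y"] t by simp
      also have "norm (?p t) \<le> (1 - t) * norm y + t * norm x"
      proof -
        have "?p t = (1 - t) *\<^sub>R y + t *\<^sub>R x" by (simp add: algebra_simps)
        then show ?thesis using t norm_triangle_ineq[of "(1 - t) *\<^sub>R y" "t *\<^sub>R x"] by simp
      qed
      then have "A2 * norm (?p t) * norm (x - y) \<le> A2 * ((1 - t) * norm y + t * norm x) * norm (x - y)"
        using A2 by (intro mult_right_mono mult_left_mono) auto
      finally show "norm (\<Sum>i\<in>UNIV. (x - y) $ i * ?D i h (?p t)) \<le> ?K * ((1 - t) * norm y + t * norm x)"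
        by (simp add: mult_ac)
    qed simp
    then show ?thesis by (simp add: algebra_simps)
  qed
  show thesis by (rule that[OF A1 A2 A12 c0]) (use lip quad in auto)
qed

definition vec_L2 :: "(real^'d \<Rightarrow> real^'n) set" where
  "vec_L2 = {a. \<forall>m. (\<lambda>x. a x $ m) \<in> L2_space}"

definition vec_L2_norm :: "(real^'d \<Rightarrow> real^'n) \<Rightarrow> real" where
  "vec_L2_norm a = L2_set (\<lambda>m. L2_norm (\<lambda>x. a x $ m)) UNIV"

lemma vec_L2_norm_nonneg [simp]: "vec_L2_norm a \<ge> 0"
  by (simp add: vec_L2_norm_def L2_set_nonneg)

lemma vec_L2_component: "a \<in> vec_L2 \<Longrightarrow> (\<lambda>x. a x $ m) \<in> L2_space"
  by (simp add: vec_L2_def)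

lemma vec_L2_add:
  assumes "a \<in> vec_L2" "b \<in> vec_L2"
  shows "(\<lambda>x. a x + b x) \<in> vec_L2" "vec_L2_norm (\<lambda>x. a x + b x) \<le> vec_L2_norm a + vec_L2_norm b"
proof -
  show "(\<lambda>x. a x + b x) \<in> vec_L2" 
    unfolding vec_L2_def using L2_space_add(1)[OF vec_L2_component[OF assms(1)] vec_L2_component[OF assms(2)]] by simp
  have "vec_L2_norm (\<lambda>x. a x + b x) \<le> L2_set (\<lambda>m. L2_norm (\<lambda>x. a x $ m) + L2_norm (\<lambda>x. b x $ m)) UNIV"
    unfolding vec_L2_norm_def vector_add_component
    using L2_space_add(2)[OF vec_L2_component[OF assms(1)] vec_L2_component[OF assms(2)]] by (intro L2_set_mono) auto
  also have "\<dots> \<le> vec_L2_norm a + vec_L2_norm b"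
    unfolding vec_L2_norm_def by (rule L2_set_triangle_ineq)
  finally show "vec_L2_norm (\<lambda>x. a x + b x) \<le> vec_L2_norm a + vec_L2_norm b" .
qed

lemma vec_L2_cmult:
  assumes "a \<in> vec_L2"
  shows "(\<lambda>x. c *\<^sub>R a x) \<in> vec_L2" "vec_L2_norm (\<lambda>x. c *\<^sub>R a x) = \<bar>c\<bar> * vec_L2_norm a"
  using assms L2_space_cmult[of "\<lambda>x. a x $ _" c] by (auto simp: vec_L2_def vec_L2_norm_def L2_set_right_distrib)

lemma vec_L2_diff:
  assumes "a \<in> vec_L2" "b \<in> vec_L2"
  shows "(\<lambda>x. a x - b x) \<in> vec_L2" "vec_L2_norm (\<lambda>x. a x - b x) \<le> vec_L2_norm a + vec_L2_norm b"
  using vec_L2_add[OF assms(1) vec_L2_cmult(1)[OF assms(2), of "-1"]] vec_L2_cmult(2)[OF assms(2), of "-1"] by simp_all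

lemma vec_L2_0: "(\<lambda>_. 0) \<in> vec_L2" "vec_L2_norm (\<lambda>_. 0) = 0"
  by (simp_all add: vec_L2_def vec_L2_norm_def L2_space_def L2_norm_def L2_set_def)

lemma norm_square_cart: "(norm (v :: real^'n))\<^sup>2 = (\<Sum>m\<in>UNIV. (v $ m)\<^sup>2)"
  by (simp add: norm_vec_def L2_set_def sum_nonneg)

text \<open>
  The norm of a vector-valued function is passed to the pointwise Euclidean length, so that scalar
  inequalities apply.
\<close>

lemma norm_L2_space:
  assumes "a \<in> vec_L2"
  shows "(\<lambda>x. norm (a x)) \<in> L2_space" "L2_norm (\<lambda>x. norm (a x)) = vec_L2_norm a"
proof -
  note D = L2_spaceD[OF vec_L2_component[OF assms]]
  have i: "integrable lebesgue (\<lambda>x. (norm (a x))\<^sup>2)"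
    unfolding norm_square_cart using D(2) by (intro Bochner_Integration.integrable_sum)
  have "(\<lambda>x. sqrt (\<Sum>m\<in>UNIV. (a x $ m)\<^sup>2)) \<in> borel_measurable lebesgue"
    using D(1) by measurable
  then have "(\<lambda>x. norm (a x)) \<in> borel_measurable lebesgue"
    by (simp add: norm_vec_def L2_set_def)
  with i show "(\<lambda>x. norm (a x)) \<in> L2_space" by (simp add: L2_space_def)
  have "(LINT x|lebesgue. (norm (a x))\<^sup>2) = (\<Sum>m\<in>UNIV. (L2_norm (\<lambda>x. a x $ m))\<^sup>2)"
    unfolding norm_square_cart L2_norm_square using D(2) by (intro Bochner_Integration.integral_sum)
  then show "L2_norm (\<lambda>x. norm (a x)) = vec_L2_norm a"
    by (simp add: L2_norm_def[of "\<lambda>x. norm (a x)"] vec_L2_norm_def L2_set_def)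
qed

lemma vec_L2_norm_eq_0:
  assumes "a \<in> vec_L2" "vec_L2_norm a = 0"
  shows "AE x in lebesgue. a x = 0"
  using L2_norm_eq_0[OF norm_L2_space(1)[OF assms(1)]] norm_L2_space(2)[OF assms(1)] assms(2) by simp

lemma vec_L2_measurable:
  fixes a :: "real^'d \<Rightarrow> real^'n"
  assumes "a \<in> vec_L2"
  shows "a \<in> borel_measurable lebesgue"
proof (rule borel_measurable_euclidean_space[THEN iffD2], rule ballI)
  fix i :: "real^'n" assume "i \<in> Basis"
  then obtain m where "i = axis m 1" by (auto simp: Basis_vec_def)
  then show "(\<lambda>x. a x \<bullet> i) \<in> borel_measurable lebesgue"
    using L2_spaceD(1)[OF vec_L2_component[OF assms], of m] by (simp add: inner_axis)
qed

text \<open>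
  Only the restriction of \<open>h\<close> to \<open>S\<close> is known to be regular; extended by zero it is Borel measurable, and
  the composition changes on a null set only.
\<close>

lemma composition_measurable:
  fixes a :: "real^'d \<Rightarrow> real^'n" and h :: "real^'n \<Rightarrow> real"
  assumes "a \<in> vec_L2" "closed S" "continuous_on S h" "AE x in lebesgue. a x \<in> S"
  shows "(\<lambda>x. h (a x)) \<in> borel_measurable lebesgue"
proof -
  have "(\<lambda>z. indicator S z *\<^sub>R h z) \<in> borel_measurable borel"
    using assms by (intro borel_measurable_continuous_on_indicator) auto
  then have "(\<lambda>x. indicator S (a x) *\<^sub>R h (a x)) \<in> borel_measurable lebesgue"
    by (rule measurable_compose[OF vec_L2_measurable[OF assms(1)]])
  then show ?thesis
    by (rule borel_measurable_AE) (use assms(4) in \<open>eventually_elim, simp\<close>)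
qed

text \<open>
  The Lipschitz bound gives the \<open>L\<^sup>2\<close> estimate.  The quadratic bound gives the \<open>L\<^sup>1\<close> estimate by the
  Cauchy-Schwarz inequality.
\<close>

theorem composition_difference_bounds:
  fixes a b :: "real^'d \<Rightarrow> real^'n" and h :: "real^'n \<Rightarrow> real"
  assumes S: "closed S" "continuous_on S h"
    and a: "a \<in> vec_L2" "AE x in lebesgue. a x \<in> S" and b: "b \<in> vec_L2" "AE x in lebesgue. b x \<in> S"
    and A1: "A1 \<ge> 0" "\<And>x y. x \<in> S \<Longrightarrow> y \<in> S \<Longrightarrow> \<bar>h x - h y\<bar> \<le> A1 * norm (x - y)"
    and A2: "A2 \<ge> 0" "\<And>x y. x \<in> S \<Longrightarrow> y \<in> S \<Longrightarrow> \<bar>h x - h y\<bar> \<le> A2 * (norm (x - y) * ((norm x + norm y) / 2))"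
  defines "D \<equiv> \<lambda>x. h (a x) - h (b x)"
  shows "D \<in> L1_space \<inter> L2_space"
    "L1_norm D \<le> A2 * (vec_L2_norm (\<lambda>x. a x - b x) * ((vec_L2_norm a + vec_L2_norm b) / 2))"
    "L2_norm D \<le> A1 * vec_L2_norm (\<lambda>x. a x - b x)"
proof -
  have Dm: "D \<in> borel_measurable lebesgue"
    unfolding D_def by (intro borel_measurable_diff composition_measurable[OF a(1) S a(2)] composition_measurable[OF b(1) S b(2)])
  have ab: "(\<lambda>x. a x - b x) \<in> vec_L2" by (rule vec_L2_diff(1)[OF a(1) b(1)])
  note nab = norm_L2_space[OF ab] and na = norm_L2_space[OF a(1)] and nb = norm_L2_space[OF b(1)]
  have p1: "AE x in lebesgue. \<bar>D x\<bar> \<le> A1 * norm (a x - b x)"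
    using a(2) b(2) by eventually_elim (simp add: D_def A1)
  let ?q = "\<lambda>x. A2 * (norm (a x - b x) * ((norm (a x) + norm (b x)) / 2))"
  have p2: "AE x in lebesgue. \<bar>D x\<bar> \<le> ?q x"
    using a(2) b(2) by eventually_elim (use A2(2) in \<open>simp add: D_def\<close>)
  have sq: "AE x in lebesgue. (D x)\<^sup>2 \<le> A1\<^sup>2 * (norm (a x - b x))\<^sup>2"
    using p1
  proof eventually_elim
    case (elim x)
    then have "\<bar>D x\<bar>\<^sup>2 \<le> (A1 * norm (a x - b x))\<^sup>2" by (rule power_mono) simp
    then show ?case by (simp add: power_mult_distrib)
  qed
  have isq: "integrable lebesgue (\<lambda>x. A1\<^sup>2 * (norm (a x - b x))\<^sup>2)"
    using L2_spaceD(2)[OF nab(1)] by simp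
  have iD2: "integrable lebesgue (\<lambda>x. (D x)\<^sup>2)"
    by (rule Bochner_Integration.integrable_bound[OF isq]) (use Dm sq in auto)
  have s: "(\<lambda>x. norm (a x) + norm (b x)) \<in> L2_space" "L2_norm (\<lambda>x. norm (a x) + norm (b x)) \<le> vec_L2_norm a + vec_L2_norm b"
    using L2_space_add[OF na(1) nb(1)] na(2) nb(2) by auto
  note m = L2_space_mult[OF nab(1) s(1)]
  have iq: "integrable lebesgue ?q" using m(1) by (auto simp: mult_ac intro!: integrable_mult_right)
  have iD1: "integrable lebesgue D"
    by (rule Bochner_Integration.integrable_bound[OF iq]) (use Dm p2 in \<open>auto elim: eventually_mono\<close>)
  show "D \<in> L1_space \<inter> L2_space" using iD1 iD2 Dm by (simp add: L1_space_def L2_space_def)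
  have "L1_norm D \<le> (LINT x|lebesgue. ?q x)"
    unfolding L1_norm_def using iD1 iq p2 by (intro integral_mono_AE) auto
  also have "\<dots> = A2 * ((LINT x|lebesgue. \<bar>norm (a x - b x) * (norm (a x) + norm (b x))\<bar>) / 2)"
    by simp
  also have "\<dots> \<le> A2 * ((vec_L2_norm (\<lambda>x. a x - b x) * (vec_L2_norm a + vec_L2_norm b)) / 2)"
    using order_trans[OF m(2) mult_left_mono[OF s(2)]] nab(2) A2(1) by (intro mult_left_mono divide_right_mono) auto
  finally show "L1_norm D \<le> A2 * (vec_L2_norm (\<lambda>x. a x - b x) * ((vec_L2_norm a + vec_L2_norm b) / 2))"
    by simp
  have "(L2_norm D)\<^sup>2 \<le> (LINT x|lebesgue. A1\<^sup>2 * (norm (a x - b x))\<^sup>2)"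
    unfolding L2_norm_square by (rule integral_mono_AE[OF iD2 isq sq])
  also have "\<dots> = (A1 * vec_L2_norm (\<lambda>x. a x - b x))\<^sup>2"
    using nab(2) L2_norm_square[of "\<lambda>x. norm (a x - b x)"] by (simp add: power_mult_distrib)
  finally show "L2_norm D \<le> A1 * vec_L2_norm (\<lambda>x. a x - b x)"
    by (rule power2_le_imp_le) (use A1 in simp)
qed

section \<open>The a priori estimate and its constant\<close>

text \<open>
  The cone over the sphere is the closed unit ball without its centre.
\<close>

lemma sphere_measure_unit_sphere:
  "sphere_measure (sphere (0::real^'d) 1) = real CARD('d) * unit_ball_vol (real CARD('d))"
proof -
  have "{r *\<^sub>R \<omega> | r \<omega>. 0 < r \<and> r \<le> 1 \<and> \<omega> \<in> sphere (0::real^'d) 1} = cball 0 1 - {0}" (is "?A = ?B")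
  proof
    show "?A \<subseteq> ?B" by auto
    show "?B \<subseteq> ?A"
    proof
      fix x :: "real^'d" assume x: "x \<in> ?B"
      then have "x = norm x *\<^sub>R ((1 / norm x) *\<^sub>R x)" "0 < norm x" "norm x \<le> 1" "(1 / norm x) *\<^sub>R x \<in> sphere 0 1" by auto
      then show "x \<in> ?A" by blast
    qed
  qed
  then have "sphere_measure (sphere (0::real^'d) 1) = real CARD('d) * measure lebesgue (cball (0::real^'d) 1 - {0})"
    by (simp add: sphere_measure_def)
  also have "measure lebesgue (cball (0::real^'d) 1 - {0}) = measure lebesgue (cball (0::real^'d) 1)"
    by (rule measure_Diff_null_set) (auto simp flip: negligible_iff_null_sets)
  also have "\<dots> = unit_ball_vol (real CARD('d))"
    by (simp add: content_cball)
  finally show ?thesis .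
qed

text \<open>
  Raised to the power \<open>d\<close>, the claim compares powers of \<open>\<pi>\<close> with rational coefficients, and in the
  dimensions \<open>5\<close>, \<open>6\<close> and \<open>7\<close> nothing finer than \<open>\<pi> < 4\<close> is needed to decide it.
\<close>

lemma unit_sphere_area_bound:
  assumes d: "5 \<le> CARD('d)" "CARD('d) \<le> 7"
  shows "2 * pi\<^sup>2 \<le> real CARD('d) * (sphere_measure (sphere (0::real^'d) 1) / 4) powr (4 / real CARD('d))"
proof -
  define n where "n = CARD('d)"
  define V where "V = real n * unit_ball_vol (real n) / 4"
  have p4: "pi\<^sup>2 \<le> 16" using pi_less_4 pi_gt_zero power_mono[of pi 4 2] by simp
  have key: "(2 * pi\<^sup>2 / real n) ^ n \<le> V ^ 4"
  proof -
    consider "n = 5" | "n = 6" | "n = 7" using d unfolding n_def by linarith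
    then show ?thesis
    proof cases
      case 1
      have V: "V = 2 * pi\<^sup>2 / 3" unfolding V_def 1 by (simp add: eval_unit_ball_vol)
      have "(2 * pi\<^sup>2 / real n) ^ n = 32 / 3125 * pi ^ 8 * pi\<^sup>2" unfolding 1 by (simp add: power_divide power_mult_distrib flip: power_mult power_add)
      also have "\<dots> \<le> 32 / 3125 * pi ^ 8 * 16" by (intro mult_left_mono p4) auto
      also have "\<dots> \<le> 16 / 81 * pi ^ 8" by simp
      also have "\<dots> = V ^ 4" unfolding V by (simp add: power_divide power_mult_distrib flip: power_mult)
      finally show ?thesis .
    next
      case 2
      have V: "V = pi ^ 3 / 4" unfolding V_def 2 by (simp add: eval_unit_ball_vol)
      have "(2 * pi\<^sup>2 / real n) ^ n = 64 / 46656 * pi ^ 12" unfolding 2 by (simp add: power_divide power_mult_distrib flip: power_mult power_add)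
      also have "\<dots> \<le> 1 / 256 * pi ^ 12" by (intro mult_right_mono) auto
      also have "\<dots> = V ^ 4" unfolding V by (simp add: power_divide power_mult_distrib flip: power_mult)
      finally show ?thesis .
    next
      case 3
      have V: "V = 4 * pi ^ 3 / 15" unfolding V_def 3 by (simp add: eval_unit_ball_vol)
      have "(2 * pi\<^sup>2 / real n) ^ n = 128 / 823543 * pi ^ 12 * pi\<^sup>2" unfolding 3 by (simp add: power_divide power_mult_distrib flip: power_mult power_add)
      also have "\<dots> \<le> 128 / 823543 * pi ^ 12 * 16" by (intro mult_left_mono p4) auto
      also have "\<dots> \<le> 256 / 50625 * pi ^ 12" by simp
      also have "\<dots> = V ^ 4" unfolding V by (simp add: power_divide power_mult_distrib flip: power_mult)
      finally show ?thesis .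
    qed
  qed
  have n: "real n > 0" using d by (simp add: n_def)
  have V: "V > 0" unfolding V_def using n by simp
  have "2 * pi\<^sup>2 / real n = ((2 * pi\<^sup>2 / real n) ^ n) powr (1 / real n)"
  proof -
    have "(2 * pi\<^sup>2 / real n) ^ n = (2 * pi\<^sup>2 / real n) powr real n"
      using n by (intro powr_realpow[symmetric]) auto
    then show ?thesis using n by (simp add: powr_powr)
  qed
  also have "\<dots> \<le> (V ^ 4) powr (1 / real n)"
    using n by (intro powr_mono2 key) auto
  also have "\<dots> = V powr (4 / real n)"
  proof -
    have "V ^ 4 = V powr 4" using V by simp
    then show ?thesis unfolding powr_powr by (simp only: powr_powr) simp
  qed
  finally have "2 * pi\<^sup>2 \<le> real n * V powr (4 / real n)"
    using n by (simp add: field_simps)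
  then show ?thesis
    by (simp add: sphere_measure_unit_sphere V_def n_def)
qed

text \<open>
  The estimate that serves both claims about the solution map: with \<open>\<Delta> = X\<close> it shows that the ball is
  preserved, with \<open>\<Delta>\<close> the distance of two arguments it gives the contraction.  The two contributions
  to the \<open>L\<^sup>2\<close> norm of \<open>u\<close> contain \<open>A\<^sub>1\<^sup>2\<close> and \<open>A\<^sub>2\<^sup>2\<close> with comparable coefficients, hence only
  \<open>A\<^sub>1\<^sup>2 + A\<^sub>2\<^sup>2 \<le> M\<^sup>2\<close> enters.
\<close>

lemma solves_PDE_component_estimate:
  fixes u D K :: "real^'d \<Rightarrow> real"
  defines "d \<equiv> real CARD('d)"
  assumes dim: "5 \<le> CARD('d)" "CARD('d) \<le> 7"
    and K: "K \<in> L1_space \<inter> L2_space" and D: "D \<in> L1_space \<inter> L2_space"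
    and A: "0 \<le> A1" "0 \<le> A2" "A1 + A2 \<le> M"
    and L1: "L1_norm D \<le> A2 * (\<Delta> * X)" and L2: "L2_norm D \<le> A1 * \<Delta>"
    and pos: "\<Delta> \<ge> 0" "X > 0" and e: "0 \<le> e" "e \<le> \<epsilon>"
    and u: "u \<in> L2_space" "solves_PDE u (\<lambda>x. e * lconv K D x)"
  shows "u \<in> H4_space"
    "(H4_norm u)\<^sup>2 \<le> (\<epsilon> * M * X * \<Delta>)\<^sup>2 *
      ((L1_norm K)\<^sup>2 * (X powr (8 / d - 2) * (sphere_measure (sphere (0::real^'d) 1) / 4) powr (4 / d) * (d / ((d - 4) * (2 * pi) ^ 4)))
        + (L2_norm K)\<^sup>2)"
proof -
  let ?F = "\<lambda>x. e * lconv K D x"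
  note c = lconv_bounds[OF K D]
  have F: "?F \<in> L1_space \<inter> L2_space"
    using c(1) L2_space_cmult(1)[of "lconv K D" e] by (auto simp: L1_space_def)
  have F2: "L2_norm ?F = e * L2_norm (lconv K D)" using c(1) e L2_space_cmult(2)[of "lconv K D" e] by simp
  have F1: "L1_norm ?F = e * L1_norm (lconv K D)" using e by (simp add: L1_norm_def abs_mult)
  have d: "d \<ge> 5" "d \<le> 7" using dim by (simp_all add: d_def)
  show "u \<in> H4_space" by (rule solution_estimate(1)[OF dim(1) F u])
  define Y where "Y = X powr (8 / d - 2)"
  have Y: "Y > 0" using pos by (simp add: Y_def)
  \<comment> \<open>This choice of the splitting time balances the two terms up to constants.\<close>
  define T where "T = X powr (4 / d) / (4 * pi)"
  have T: "T > 0" using pos by (simp add: T_def)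
  have T1: "T\<^sup>2 / 2 = X\<^sup>2 * Y / (32 * pi\<^sup>2)"
  proof -
    have "(X powr (4 / d))\<^sup>2 = X powr (8 / d)" using pos by (simp add: powr_powr flip: powr_numeral)
    also have "\<dots> = X powr 2 * Y" unfolding Y_def by (simp flip: powr_add)
    finally show ?thesis using pos by (simp add: T_def power_divide power_mult_distrib)
  qed
  have T2: "(4 * pi) powr (- d / 2) * (T powr (2 - d / 2) / (d / 2 - 2)) = Y / (8 * pi\<^sup>2 * (d - 4))"
  proof -
    have inv: "(4 * pi) powr (- (2 - d / 2)) = 1 / (4 * pi) powr (2 - d / 2)" by (rule powr_minus_divide)
    have "T powr (2 - d / 2) = (X powr (4 / d)) powr (2 - d / 2) * (4 * pi) powr (- (2 - d / 2))"
      unfolding T_def inv by (subst powr_divide) (use pos in auto)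
    also have "(X powr (4 / d)) powr (2 - d / 2) = Y"
    proof -
      have "4 / d * (2 - d / 2) = 8 / d - 2" using d by (simp add: field_simps)
      then show ?thesis unfolding Y_def powr_powr by simp
    qed
    finally have "(4 * pi) powr (- d / 2) * T powr (2 - d / 2) = Y * ((4 * pi) powr (- d / 2) * (4 * pi) powr (- (2 - d / 2)))"
      by simp
    also have "(4 * pi) powr (- d / 2) * (4 * pi) powr (- (2 - d / 2)) = (4 * pi) powr (- 2)"
      by (simp flip: powr_add)
    also have "\<dots> = 1 / (16 * pi\<^sup>2)" by (simp add: powr_minus_divide power_mult_distrib)
    finally show ?thesis using d by (simp add: field_simps)
  qed
  define \<kappa> where "\<kappa> = (sphere_measure (sphere (0::real^'d) 1) / 4) powr (4 / d) * (d / ((d - 4) * (2 * pi) ^ 4))"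
  have \<kappa>: "1 / (8 * pi\<^sup>2 * (d - 4)) \<le> \<kappa>"
  proof -
    have "2 * pi\<^sup>2 \<le> d * (sphere_measure (sphere (0::real^'d) 1) / 4) powr (4 / d)"
      unfolding d_def by (rule unit_sphere_area_bound[OF dim])
    then have "2 * pi\<^sup>2 * (1 / ((d - 4) * (2 * pi) ^ 4)) \<le> d * (sphere_measure (sphere (0::real^'d) 1) / 4) powr (4 / d) * (1 / ((d - 4) * (2 * pi) ^ 4))"
      using d by (intro mult_right_mono) auto
    also have "2 * pi\<^sup>2 * (1 / ((d - 4) * (2 * pi) ^ 4)) = 1 / (8 * pi\<^sup>2 * (d - 4))"
      using d by (simp add: field_simps power_mult_distrib)
    finally show ?thesis by (simp add: \<kappa>_def mult_ac)
  qed
  have e\<epsilon>: "\<epsilon> \<ge> 0" using e by simp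
  have M0: "M \<ge> 0" "A2 \<le> M" using A by auto
  let ?k = "\<epsilon> * L1_norm K"
  have b1: "L1_norm ?F \<le> ?k * (A2 * (\<Delta> * X))"
    unfolding F1 mult.assoc using e e\<epsilon> by (intro mult_mono order_trans[OF c(2)] mult_left_mono L1) auto
  have b2: "L2_norm ?F \<le> ?k * (A1 * \<Delta>)"
    unfolding F2 mult.assoc using e e\<epsilon> by (intro mult_mono order_trans[OF c(3)] mult_left_mono L2) auto
  have b3: "L2_norm ?F \<le> \<epsilon> * L2_norm K * (M * (\<Delta> * X))"
  proof -
    have "L1_norm D \<le> M * (\<Delta> * X)"
      by (rule order_trans[OF L1 mult_right_mono[OF M0(2)]]) (use pos in auto)
    then show ?thesis
      unfolding F2 mult.assoc using e e\<epsilon> by (intro mult_mono order_trans[OF c(4)] mult_left_mono) auto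
  qed
  have n1: "L1_norm ?F \<ge> 0" "L2_norm ?F \<ge> 0" by auto
  have "(H4_norm u)\<^sup>2 \<le> T\<^sup>2 / 2 * (L2_norm ?F)\<^sup>2 + (4 * pi) powr (- d / 2) * (T powr (2 - d / 2) / (d / 2 - 2)) * (L1_norm ?F)\<^sup>2 + (L2_norm ?F)\<^sup>2"
    unfolding d_def by (rule solution_estimate(2)[OF dim(1) F u T])
  also have "\<dots> = X\<^sup>2 * Y / (32 * pi\<^sup>2) * (L2_norm ?F)\<^sup>2 + Y / (8 * pi\<^sup>2 * (d - 4)) * (L1_norm ?F)\<^sup>2 + (L2_norm ?F)\<^sup>2"
    unfolding T1 T2 ..
  also have "\<dots> \<le> X\<^sup>2 * Y / (8 * pi\<^sup>2 * (d - 4)) * (?k * (A1 * \<Delta>))\<^sup>2 + Y / (8 * pi\<^sup>2 * (d - 4)) * (?k * (A2 * (\<Delta> * X)))\<^sup>2 + (\<epsilon> * L2_norm K * (M * (\<Delta> * X)))\<^sup>2"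
  proof (intro add_mono mult_mono power_mono b1 b2 b3 n1 order_refl)
    show "X\<^sup>2 * Y / (32 * pi\<^sup>2) \<le> X\<^sup>2 * Y / (8 * pi\<^sup>2 * (d - 4))"
    proof (rule divide_left_mono)
      show "8 * pi\<^sup>2 * (d - 4) \<le> 32 * pi\<^sup>2" using d by simp
    qed (use d Y in auto)
  qed (use d Y in auto)
  also have "\<dots> = (\<epsilon> * X * \<Delta>)\<^sup>2 * ((L1_norm K)\<^sup>2 * (Y * (1 / (8 * pi\<^sup>2 * (d - 4)) * (A1\<^sup>2 + A2\<^sup>2))) + (L2_norm K)\<^sup>2 * M\<^sup>2)"
    using d by (simp add: power_mult_distrib divide_simps) (simp add: algebra_simps)
  also have "\<dots> \<le> (\<epsilon> * X * \<Delta>)\<^sup>2 * ((L1_norm K)\<^sup>2 * (Y * (\<kappa> * M\<^sup>2)) + (L2_norm K)\<^sup>2 * M\<^sup>2)"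
  proof -
    have "A1\<^sup>2 + A2\<^sup>2 \<le> (A1 + A2)\<^sup>2" using A by (simp add: power2_sum)
    also have "\<dots> \<le> M\<^sup>2" using A by (intro power_mono) auto
    finally have "A1\<^sup>2 + A2\<^sup>2 \<le> M\<^sup>2" .
    moreover have "0 \<le> 1 / (8 * pi\<^sup>2 * (d - 4))" using d by simp
    then have "\<kappa> \<ge> 0" using \<kappa> by (rule order_trans)
    ultimately show ?thesis
      using \<kappa> Y by (intro mult_left_mono add_right_mono mult_mono) auto
  qed
  also have "\<dots> = (\<epsilon> * M * X * \<Delta>)\<^sup>2 * ((L1_norm K)\<^sup>2 * (Y * \<kappa>) + (L2_norm K)\<^sup>2)"
    by (simp add: power_mult_distrib algebra_simps)
  finally show "(H4_norm u)\<^sup>2 \<le> (\<epsilon> * M * X * \<Delta>)\<^sup>2 *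
      ((L1_norm K)\<^sup>2 * (X powr (8 / d - 2) * (sphere_measure (sphere (0::real^'d) 1) / 4) powr (4 / d) * (d / ((d - 4) * (2 * pi) ^ 4)))
        + (L2_norm K)\<^sup>2)"
    by (simp add: Y_def \<kappa>_def mult.assoc)
qed

text \<open>
  Norm bounds pass to almost everywhere limits, by Fatou's lemma.
\<close>

lemma vec_L2_Fatou:
  fixes a :: "nat \<Rightarrow> real^'d \<Rightarrow> real^'n"
  assumes a: "\<And>k. a k \<in> vec_L2" "\<And>k. vec_L2_norm (a k) \<le> C" and m: "b \<in> borel_measurable lebesgue"
    and lim: "AE x in lebesgue. (\<lambda>k. a k x) \<longlonglongrightarrow> b x"
  shows "b \<in> vec_L2" "vec_L2_norm b \<le> C"
proof -
  have C: "C \<ge> 0" using a(2)[of 0] vec_L2_norm_nonneg order_trans by blast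
  have am: "a k \<in> borel_measurable lebesgue" for k by (rule vec_L2_measurable[OF a(1)])
  have nm: "(\<lambda>x. (norm (b x))\<^sup>2) \<in> borel_measurable lebesgue" using m by measurable
  have "(\<integral>\<^sup>+x. ennreal ((norm (b x))\<^sup>2) \<partial>lebesgue) = (\<integral>\<^sup>+x. liminf (\<lambda>k. ennreal ((norm (a k x))\<^sup>2)) \<partial>lebesgue)"
  proof (rule nn_integral_cong_AE)
    show "AE x in lebesgue. ennreal ((norm (b x))\<^sup>2) = liminf (\<lambda>k. ennreal ((norm (a k x))\<^sup>2))"
      using lim
    proof eventually_elim
      case (elim x)
      then have "(\<lambda>k. ennreal ((norm (a k x))\<^sup>2)) \<longlonglongrightarrow> ennreal ((norm (b x))\<^sup>2)"
        by (intro tendsto_ennrealI tendsto_power tendsto_norm)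
      then show ?case by (intro lim_imp_Liminf[symmetric]) auto
    qed
  qed
  also have "\<dots> \<le> liminf (\<lambda>k. \<integral>\<^sup>+x. ennreal ((norm (a k x))\<^sup>2) \<partial>lebesgue)"
  proof (rule nn_integral_liminf)
    fix k
    show "(\<lambda>x. ennreal ((norm (a k x))\<^sup>2)) \<in> borel_measurable lebesgue"
      using am[of k] by measurable
  qed
  also have "\<dots> \<le> ennreal (C\<^sup>2)"
  proof (rule Liminf_le[OF _ always_eventually, rule_format])
    fix k
    note n = norm_L2_space[OF a(1)[of k]]
    have "(\<integral>\<^sup>+x. ennreal ((norm (a k x))\<^sup>2) \<partial>lebesgue) = ennreal ((vec_L2_norm (a k))\<^sup>2)"
      using L2_spaceD(2)[OF n(1)] L2_norm_square[of "\<lambda>x. norm (a k x)"] n(2) by (subst nn_integral_eq_integral) auto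
    also have "\<dots> \<le> ennreal (C\<^sup>2)" using a(2)[of k] by (intro ennreal_leI power_mono) auto
    finally show "(\<integral>\<^sup>+x. ennreal ((norm (a k x))\<^sup>2) \<partial>lebesgue) \<le> ennreal (C\<^sup>2)" .
  qed simp
  finally have le: "(\<integral>\<^sup>+x. ennreal ((norm (b x))\<^sup>2) \<partial>lebesgue) \<le> ennreal (C\<^sup>2)" .
  have sq: "integrable lebesgue (\<lambda>x. (norm (b x))\<^sup>2)"
    using nm le_less_trans[OF le ennreal_less_top] by (intro integrableI_bounded) auto
  show bL: "b \<in> vec_L2"
    unfolding vec_L2_def
  proof (intro CollectI allI)
    fix i
    have cm: "(\<lambda>x. b x $ i) \<in> borel_measurable lebesgue" using m by measurable
    have "integrable lebesgue (\<lambda>x. (b x $ i)\<^sup>2)"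
    proof (rule Bochner_Integration.integrable_bound[OF sq])
      show "AE x in lebesgue. norm ((b x $ i)\<^sup>2) \<le> norm ((norm (b x))\<^sup>2)"
      proof (rule AE_I2)
        fix x
        show "norm ((b x $ i)\<^sup>2) \<le> norm ((norm (b x))\<^sup>2)"
          using power_mono[OF component_le_norm_cart[of "b x" i] abs_ge_zero, of 2] by simp
      qed
    qed (intro borel_measurable_power cm)
    with cm show "(\<lambda>x. b x $ i) \<in> L2_space" by (simp add: L2_space_def)
  qed
  have "(vec_L2_norm b)\<^sup>2 = (LINT x|lebesgue. (norm (b x))\<^sup>2)"
    using norm_L2_space(2)[OF bL] L2_norm_square[of "\<lambda>x. norm (b x)"] by simp
  also have "\<dots> \<le> C\<^sup>2"
    using le sq by (simp add: nn_integral_eq_integral)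
  finally show "vec_L2_norm b \<le> C" using C by (rule power2_le_imp_le)
qed

section \<open>Fixed points of contractions in the mean-square norm\<close>

lemma H4_vec_norm_eq_L2_set: "H4_vec_norm u = L2_set (\<lambda>m. H4_norm (\<lambda>x. u x $ m)) UNIV"
  by (simp add: H4_vec_norm_def L2_set_def)

lemma H4_vec_norm_nonneg [simp]: "H4_vec_norm u \<ge> 0"
  by (simp add: H4_vec_norm_eq_L2_set L2_set_nonneg)

lemma L2_norm_le_H4_norm: "L2_norm \<phi> \<le> H4_norm \<phi>"
  by (rule power2_le_imp_le) (simp_all add: H4_norm_square)

lemma vec_L2_norm_le_H4: "vec_L2_norm u \<le> H4_vec_norm u"
  unfolding vec_L2_norm_def H4_vec_norm_eq_L2_set by (intro L2_set_mono L2_norm_le_H4_norm) simp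

lemma H4_vec_space_vec_L2: "u \<in> H4_vec_space \<Longrightarrow> u \<in> vec_L2"
  by (simp add: H4_vec_space_def vec_L2_def H4_space_def)

text \<open>
  The Euclidean length on the left and the norm on the right are built in the same way from the
  components, so the scalar constant carries over.
\<close>

lemma sobolev_vec:
  fixes u :: "real^'d \<Rightarrow> real^'n"
  assumes c: "sobolev_constant TYPE('d) c" and u: "u \<in> H4_vec_space"
  shows "AE x in lebesgue. norm (u x) \<le> c * H4_vec_norm u"
proof -
  have c0: "c > 0" using c by (simp add: sobolev_constant_def)
  have "AE x in lebesgue. \<bar>u x $ m\<bar> \<le> c * H4_norm (\<lambda>x. u x $ m)" for m
  proof -
    have "esssup lebesgue (\<lambda>x. ereal \<bar>u x $ m\<bar>) \<le> ereal (c * H4_norm (\<lambda>x. u x $ m))"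
      using c u by (simp add: sobolev_constant_def H4_vec_space_def)
    moreover have "AE x in lebesgue. ereal \<bar>u x $ m\<bar> \<le> esssup lebesgue (\<lambda>x. ereal \<bar>u x $ m\<bar>)"
      by (rule esssup_AE)
    ultimately show ?thesis by (auto elim!: eventually_mono dest: order_trans)
  qed
  then have "AE x in lebesgue. \<forall>m\<in>UNIV. \<bar>u x $ m\<bar> \<le> c * H4_norm (\<lambda>x. u x $ m)"
    by (intro AE_finite_allI) auto
  then show ?thesis
  proof eventually_elim
    case (elim x)
    have "norm (u x) = L2_set (\<lambda>m. \<bar>u x $ m\<bar>) UNIV" by (simp add: norm_vec_def)
    also have "\<dots> \<le> L2_set (\<lambda>m. c * H4_norm (\<lambda>x. u x $ m)) UNIV"
      using elim by (intro L2_set_mono) auto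
    finally show ?case using c0 by (simp add: H4_vec_norm_eq_L2_set L2_set_right_distrib)
  qed
qed

lemma vec_L2_cong_AE:
  assumes "a \<in> vec_L2" "ae_eq a b"
  shows "b \<in> vec_L2" "vec_L2_norm b = vec_L2_norm a"
proof -
  have bm: "b \<in> borel_measurable lebesgue" using borel_measurable_AE[OF vec_L2_measurable[OF assms(1)] assms(2)] .
  have c: "ae_eq (\<lambda>x. a x $ m) (\<lambda>x. b x $ m)" for m using assms(2) by eventually_elim simp
  have m: "(\<lambda>x. b x $ m) \<in> borel_measurable lebesgue" for m using bm by measurable
  note L = L2_cong_AE[OF vec_L2_component[OF assms(1)] m c]
  show "b \<in> vec_L2" "vec_L2_norm b = vec_L2_norm a"
    using L by (simp_all add: vec_L2_def vec_L2_norm_def)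
qed

lemma vec_L2_norm_eq_0_ae_eq:
  assumes "a \<in> vec_L2" "b \<in> vec_L2" "vec_L2_norm (\<lambda>x. a x - b x) \<le> 0"
  shows "ae_eq a b"
proof -
  have "vec_L2_norm (\<lambda>x. a x - b x) = 0" using assms(3) vec_L2_norm_nonneg[of "\<lambda>x. a x - b x"] by simp
  from vec_L2_norm_eq_0[OF vec_L2_diff(1)[OF assms(1,2)] this] show ?thesis by simp
qed

lemma ae_eq_vec_L2_norm_0:
  assumes "a \<in> vec_L2" "ae_eq a b"
  shows "vec_L2_norm (\<lambda>x. a x - b x) = 0"
proof -
  have "ae_eq (\<lambda>_. 0) (\<lambda>x. a x - b x)" using assms(2) by eventually_elim simp
  from vec_L2_cong_AE(2)[OF vec_L2_0(1) this] show ?thesis by (simp add: vec_L2_0)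
qed

text \<open>
  The iteration takes place in the larger set \<open>B\<close>, which is described by mean-square norms and pointwise
  values alone.  Its iterates converge almost everywhere, since their differences are summable in the
  \<open>H\<^sup>4\<close> norm and hence in the supremum norm; the limit \<open>v\<close> lies in \<open>B\<close> by Fatou's lemma.  One more
  application of the solution map shows that \<open>v\<close> agrees with an element of \<open>H\<^sup>4\<close>, because the map is
  Lipschitz already for the mean-square norm. 
\<close>

lemma contraction_fixed_point:
  fixes P :: "(real^'d \<Rightarrow> real^'n) \<Rightarrow> (real^'d \<Rightarrow> real^'n) \<Rightarrow> bool"
  assumes B: "B = {v \<in> vec_L2. vec_L2_norm v \<le> \<rho> \<and> (AE x in lebesgue. u0 x + v x \<in> S)}" and S: "closed S"
    and zero: "(\<lambda>_. 0) \<in> B" and ball: "H4_ball \<rho> \<subseteq> B"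
    and ex: "\<And>v. v \<in> B \<Longrightarrow> \<exists>u\<in>H4_ball \<rho>. P v u"
    and contr: "\<And>v w u u'. \<lbrakk>v \<in> B; w \<in> B; u \<in> H4_ball \<rho>; u' \<in> H4_ball \<rho>; P v u; P w u'\<rbrakk> \<Longrightarrow>
        (\<lambda>x. u x - u' x) \<in> H4_vec_space \<and> H4_vec_norm (\<lambda>x. u x - u' x) \<le> q * vec_L2_norm (\<lambda>x. v x - w x)"
    and q: "0 \<le> q" "q < 1"
    and sob: "\<And>u :: real^'d \<Rightarrow> real^'n. u \<in> H4_vec_space \<Longrightarrow> AE x in lebesgue. norm (u x) \<le> c * H4_vec_norm u" and c: "c \<ge> 0"
    and cong: "\<And>v w u. \<lbrakk>v \<in> B; w \<in> B; ae_eq v w; P v u\<rbrakk> \<Longrightarrow> P w u"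
  obtains up where "up \<in> H4_ball \<rho>" "P up up"
proof -
  define T where "T v = (SOME u. u \<in> H4_ball \<rho> \<and> P v u)" for v
  have T: "T v \<in> H4_ball \<rho>" "P v (T v)" if "v \<in> B" for v
  proof -
    have "\<exists>u. u \<in> H4_ball \<rho> \<and> P v u" using ex[OF that] by blast
    from someI_ex[OF this] show "T v \<in> H4_ball \<rho>" "P v (T v)" by (simp_all add: T_def)
  qed
  have TB: "v \<in> B \<Longrightarrow> T v \<in> B" for v using T(1) ball by blast
  have BL: "v \<in> vec_L2" if "v \<in> B" for v using that by (simp add: B)
  define s where "s k = (T ^^ k) (\<lambda>_. 0)" for k
  have s0: "s 0 = (\<lambda>_. 0)" and sS: "s (Suc k) = T (s k)" for k by (simp_all add: s_def)
  have sB: "s k \<in> B" for k by (induction k) (use zero TB in \<open>simp_all add: s0 sS\<close>)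
  have sL: "s k \<in> vec_L2" for k by (rule BL[OF sB])
  define \<delta> where "\<delta> = vec_L2_norm (\<lambda>x. s 1 x - s 0 x)"
  have step: "(\<lambda>x. s (Suc (Suc k)) x - s (Suc k) x) \<in> H4_vec_space"
      "H4_vec_norm (\<lambda>x. s (Suc (Suc k)) x - s (Suc k) x) \<le> q * vec_L2_norm (\<lambda>x. s (Suc k) x - s k x)" for k
    using contr[OF sB[of "Suc k"] sB[of k] T(1)[OF sB[of "Suc k"]] T(1)[OF sB[of k]] T(2)[OF sB[of "Suc k"]] T(2)[OF sB[of k]]]
    by (simp_all add: sS)
  have inc: "vec_L2_norm (\<lambda>x. s (Suc k) x - s k x) \<le> q ^ k * \<delta>" for k
  proof (induction k)
    case 0
    show ?case by (simp add: \<delta>_def)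
  next
    case (Suc k)
    have "vec_L2_norm (\<lambda>x. s (Suc (Suc k)) x - s (Suc k) x) \<le> q * vec_L2_norm (\<lambda>x. s (Suc k) x - s k x)"
      using vec_L2_norm_le_H4 step(2) by (rule order_trans)
    also have "\<dots> \<le> q * (q ^ k * \<delta>)" using Suc q by (intro mult_left_mono)
    finally show ?case by (simp add: mult.assoc)
  qed
  have incH: "H4_vec_norm (\<lambda>x. s (Suc (Suc k)) x - s (Suc k) x) \<le> q ^ Suc k * \<delta>" for k
    using order_trans[OF step(2) mult_left_mono[OF inc q(1)]] by (simp add: mult.assoc)
  \<comment> \<open>The finite geometric sum, kept exact to make the induction work.\<close>
  have dist: "vec_L2_norm (\<lambda>x. s (k + j) x - s k x) \<le> \<delta> * q ^ k * (1 - q ^ j) / (1 - q)" for k j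
  proof (induction j)
    case 0
    show ?case by (simp add: vec_L2_0)
  next
    case (Suc j)
    have "vec_L2_norm (\<lambda>x. s (k + Suc j) x - s k x)
       = vec_L2_norm (\<lambda>x. (s (Suc (k + j)) x - s (k + j) x) + (s (k + j) x - s k x))" by simp
    also have "\<dots> \<le> vec_L2_norm (\<lambda>x. s (Suc (k + j)) x - s (k + j) x) + vec_L2_norm (\<lambda>x. s (k + j) x - s k x)"
      by (intro vec_L2_add(2) vec_L2_diff sL)
    also have "\<dots> \<le> q ^ (k + j) * \<delta> + \<delta> * q ^ k * (1 - q ^ j) / (1 - q)"
      by (intro add_mono inc Suc)
    also have "\<dots> = \<delta> * q ^ k * (1 - q ^ Suc j) / (1 - q)"
      using q(2) by (simp add: field_simps power_add)
    finally show ?case .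
  qed
  have \<delta>: "\<delta> \<ge> 0" by (simp add: \<delta>_def)
  have dist': "vec_L2_norm (\<lambda>x. s (k + j) x - s k x) \<le> \<delta> / (1 - q) * q ^ k" for k j
  proof -
    have "\<delta> * q ^ k * (1 - q ^ j) / (1 - q) \<le> \<delta> * q ^ k * 1 / (1 - q)"
      using q \<delta> by (intro divide_right_mono mult_left_mono) auto
    then show ?thesis using dist[of k j] by simp
  qed
  define v where "v x = lim (\<lambda>k. s k x)" for x
  have conv: "AE x in lebesgue. (\<lambda>k. s k x) \<longlonglongrightarrow> v x"
  proof -
    have "AE x in lebesgue. \<forall>k. norm (s (Suc (Suc k)) x - s (Suc k) x) \<le> c * (q ^ Suc k * \<delta>)"
    proof (subst AE_all_countable, rule allI)
      fix k
      show "AE x in lebesgue. norm (s (Suc (Suc k)) x - s (Suc k) x) \<le> c * (q ^ Suc k * \<delta>)"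
        using sob[OF step(1)[of k]]
        by eventually_elim (rule order_trans[OF _ mult_left_mono[OF incH c]])
    qed
    then show ?thesis
    proof eventually_elim
      case (elim x)
      have "summable (\<lambda>k. c * q * \<delta> * q ^ k)"
        using q by (intro summable_mult summable_geometric) auto
      then have "summable (\<lambda>k. s (Suc (Suc k)) x - s (Suc k) x)"
        by (rule summable_comparison_test'[where N = 0]) (use elim in \<open>simp add: mult_ac\<close>)
      then have "convergent (\<lambda>n. (\<Sum>k<n. s (Suc (Suc k)) x - s (Suc k) x) + s 1 x)"
        by (intro convergent_add convergent_const) (simp add: summable_iff_convergent)
      moreover have "(\<Sum>k<n. s (Suc (Suc k)) x - s (Suc k) x) + s 1 x = s (Suc n) x" for n
        using sum_lessThan_telescope[of "\<lambda>k. s (Suc k) x" n] by simp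
      ultimately have "convergent (\<lambda>n. s (Suc n) x)" by simp
      then have "convergent (\<lambda>n. s n x)" by (subst (asm) convergent_Suc_iff)
      then show ?case unfolding v_def by (simp add: convergent_LIMSEQ_iff)
    qed
  qed
  have vm: "v \<in> borel_measurable lebesgue"
    unfolding v_def[abs_def] by (rule borel_measurable_lim_metric) (rule vec_L2_measurable[OF sL])
  have vL: "v \<in> vec_L2" "vec_L2_norm v \<le> \<rho>"
    using vec_L2_Fatou[of s \<rho> v] sL sB vm conv by (auto simp: B)
  have vS: "AE x in lebesgue. u0 x + v x \<in> S"
  proof -
    have "AE x in lebesgue. \<forall>k. u0 x + s k x \<in> S"
      by (subst AE_all_countable) (use sB in \<open>auto simp: B\<close>)
    with conv show ?thesis
    proof eventually_elim
      case (elim x)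
      have "(\<lambda>k. u0 x + s k x) \<longlonglongrightarrow> u0 x + v x" by (intro tendsto_intros elim)
      then show ?case by (rule closed_sequentially[OF S, rotated]) (use elim(2) in blast)
    qed
  qed
  have vB: "v \<in> B" using vL vS by (simp add: B)
  \<comment> \<open>Let \<open>j\<close> tend to infinity in \<open>dist'\<close>.\<close>
  have tail: "vec_L2_norm (\<lambda>x. v x - s k x) \<le> \<delta> / (1 - q) * q ^ k" for k
  proof (rule vec_L2_Fatou(2)[where a = "\<lambda>j x. s (k + j) x - s k x"])
    show "(\<lambda>x. s (k + j) x - s k x) \<in> vec_L2" for j by (intro vec_L2_diff sL)
    show "(\<lambda>x. v x - s k x) \<in> borel_measurable lebesgue"
      by (intro borel_measurable_diff vm vec_L2_measurable sL)
    show "AE x in lebesgue. (\<lambda>j. s (k + j) x - s k x) \<longlonglongrightarrow> v x - s k x"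
      using conv
    proof eventually_elim
      case (elim x)
      have "(\<lambda>j. s (k + j) x) \<longlonglongrightarrow> v x" using LIMSEQ_ignore_initial_segment[OF elim, of k] by (simp add: add.commute)
      then show ?case by (intro tendsto_intros)
    qed
  qed (rule dist')
  let ?u = "T v"
  have uL: "?u \<in> vec_L2" by (rule BL[OF TB[OF vB]])
  have "vec_L2_norm (\<lambda>x. ?u x - v x) \<le> q * (\<delta> / (1 - q) * q ^ k) + \<delta> / (1 - q) * q ^ Suc k" for k
  proof -
    have "vec_L2_norm (\<lambda>x. ?u x - v x) = vec_L2_norm (\<lambda>x. (?u x - s (Suc k) x) - (v x - s (Suc k) x))" by simp
    also have "\<dots> \<le> vec_L2_norm (\<lambda>x. ?u x - s (Suc k) x) + vec_L2_norm (\<lambda>x. v x - s (Suc k) x)"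
      by (intro vec_L2_diff uL sL vL)
    also have "vec_L2_norm (\<lambda>x. ?u x - s (Suc k) x) \<le> q * vec_L2_norm (\<lambda>x. v x - s k x)"
      using contr[OF vB sB[of k] T(1)[OF vB] T(1)[OF sB[of k]] T(2)[OF vB] T(2)[OF sB[of k]]]
        vec_L2_norm_le_H4[of "\<lambda>x. ?u x - s (Suc k) x"] by (simp add: sS)
    also have "\<dots> \<le> q * (\<delta> / (1 - q) * q ^ k)" by (intro mult_left_mono tail q)
    finally show ?thesis using tail[of "Suc k"] by linarith
  qed
  moreover have "(\<lambda>k. q * (\<delta> / (1 - q) * q ^ k) + \<delta> / (1 - q) * q ^ Suc k) \<longlonglongrightarrow> q * (\<delta> / (1 - q) * 0) + \<delta> / (1 - q) * 0"
    using q by (intro tendsto_intros LIMSEQ_Suc LIMSEQ_realpow_zero) auto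
  ultimately have "vec_L2_norm (\<lambda>x. ?u x - v x) \<le> q * (\<delta> / (1 - q) * 0) + \<delta> / (1 - q) * 0"
    by (intro LIMSEQ_le_const[where X = "\<lambda>k. q * (\<delta> / (1 - q) * q ^ k) + \<delta> / (1 - q) * q ^ Suc k"]) auto
  then have ae: "ae_eq ?u v" by (intro vec_L2_norm_eq_0_ae_eq uL vL) simp
  have "P ?u ?u"
    by (rule cong[OF vB TB[OF vB] _ T(2)[OF vB]]) (use ae in \<open>eventually_elim, simp\<close>)
  with T(1)[OF vB] show thesis by (rule that)
qed

lemma solves_PDE_diff:
  assumes u: "u \<in> L2_space" "solves_PDE u F" and v: "v \<in> L2_space" "solves_PDE v G"
    and F: "F \<in> L1_space \<inter> L2_space" and G: "G \<in> L1_space \<inter> L2_space"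
  shows "solves_PDE (\<lambda>x. u x - v x) (\<lambda>x. F x - G x)"
proof -
  have "(\<lambda>x. F x - G x) \<in> L1_space" using F G by (simp add: L1_space_def)
  then have "locally_integrable (\<lambda>x. F x - G x)" by (rule locally_integrable_L1)
  moreover have "(LINT x|lebesgue. (u x - v x) * pde_op \<psi> x) = (LINT x|lebesgue. (F x - G x) * \<psi> x)"
    if \<psi>: "test_function \<psi>" for \<psi>
  proof -
    have t: "pde_op \<psi> \<in> L2_space" "\<psi> \<in> L2_space" by (intro test_function_L2 test_function_pde_op \<psi>)+
    have "(LINT x|lebesgue. (u x - v x) * pde_op \<psi> x) = (LINT x|lebesgue. u x * pde_op \<psi> x) - (LINT x|lebesgue. v x * pde_op \<psi> x)"
      using L2_space_mult(1)[OF u(1) t(1)] L2_space_mult(1)[OF v(1) t(1)] by (simp add: left_diff_distrib)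
    also have "\<dots> = (LINT x|lebesgue. F x * \<psi> x) - (LINT x|lebesgue. G x * \<psi> x)"
      using u(2) v(2) \<psi> by (simp add: solves_PDE_iff)
    also have "\<dots> = (LINT x|lebesgue. (F x - G x) * \<psi> x)"
      using F G L2_space_mult(1)[OF _ t(2), of F] L2_space_mult(1)[OF _ t(2), of G] by (simp add: left_diff_distrib)
    finally show ?thesis .
  qed
  ultimately show ?thesis by (simp add: solves_PDE_iff)
qed

section \<open>The contraction and its fixed point\<close>

theorem theorem1p3:
  fixes f H :: "'n::finite \<Rightarrow> real^'d \<Rightarrow> real"
    and \<epsilon>m :: "'n \<Rightarrow> real"
    and g :: "real^'n \<Rightarrow> real^'n"
    and u0 :: "real^'d \<Rightarrow> real^'n"
    and I :: "(real^'n) set"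
    and HH Q c_e M \<rho> \<epsilon> d S :: real
  assumes N: "CARD('n) \<ge> 2"
    and dim: "5 \<le> CARD('d)" "CARD('d) \<le> 7" "d = real CARD('d)"
    and f: "\<And>m. f m \<in> L1_space \<inter> L2_space"
    and f_nontrivial: "\<exists>m. \<not> ae_eq (f m) (\<lambda>_. 0)"
    and H: "\<And>m. H m \<in> L1_space \<inter> L2_space"
    and HH: "HH > 0" "HH\<^sup>2 = (\<Sum>m\<in>UNIV. (L1_norm (H m))\<^sup>2)"
    and Q: "Q > 0" "Q\<^sup>2 = (\<Sum>m\<in>UNIV. (L2_norm (H m))\<^sup>2)"
    and c_e: "sobolev_constant TYPE('d) c_e"
    and u0: "u0 \<in> H4_vec_space" "\<And>m. solves_PDE (\<lambda>x. u0 x $ m) (f m)"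
    and I: "I = {z. norm z \<le> c_e * H4_vec_norm u0 + c_e}"
    and M: "M > 0"
    and g0: "\<And>m. g 0 $ m = 0" "\<And>m. GDERIV (\<lambda>z. g z $ m) 0 :> 0"
    and g_C2: "\<And>m. Ck_on 2 I (\<lambda>z. g z $ m)" "C2_vec_norm I g \<le> M"
    and g_nontrivial: "\<exists>z\<in>I. g z \<noteq> 0"
    and S: "S = sphere_measure (sphere (0::real^'d) 1)"
    and \<epsilon>m: "\<And>m. \<epsilon>m m \<ge> 0" "\<epsilon> = Max (range \<epsilon>m)"
    and \<rho>: "0 < \<rho>" "\<rho> \<le> 1"
    and \<epsilon>: "0 < \<epsilon>"
      "\<epsilon> \<le> \<rho> / (M * (H4_vec_norm u0 + 1)\<^sup>2) *
        (HH\<^sup>2 * (H4_vec_norm u0 + 1) powr (8 / d - 2) * (S / 4) powr (4 / d) *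
           (d / ((d - 4) * (2 * pi) ^ 4)) + Q\<^sup>2) powr (- 1 / 2)"
  shows "\<exists>T.
    (\<forall>v\<in>H4_ball \<rho>. T v \<in> H4_ball \<rho> \<and> solves_system \<epsilon>m H g u0 v (T v) \<and>
        (\<forall>u\<in>H4_ball \<rho>. solves_system \<epsilon>m H g u0 v u \<longrightarrow> ae_eq u (T v))) \<and>
    (\<forall>v\<in>H4_ball \<rho>. \<forall>w\<in>H4_ball \<rho>. ae_eq v w \<longrightarrow> ae_eq (T v) (T w)) \<and>
    (\<exists>q. 0 \<le> q \<and> q < 1 \<and>
        (\<forall>v\<in>H4_ball \<rho>. \<forall>w\<in>H4_ball \<rho>.
          H4_vec_norm (\<lambda>x. T v x - T w x) \<le> q * H4_vec_norm (\<lambda>x. v x - w x))) \<and>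
    (\<exists>up\<in>H4_ball \<rho>. ae_eq (T up) up \<and>
        (\<forall>w\<in>H4_ball \<rho>. ae_eq (T w) w \<longrightarrow> ae_eq w up) \<and>
        solves_system \<epsilon>m H g u0 up up \<and>
        (\<forall>w\<in>H4_ball \<rho>. solves_system \<epsilon>m H g u0 w w \<longrightarrow> ae_eq w up))"
proof -
  define X where "X = H4_vec_norm u0 + 1"
  define r where "r = c_e * X"
  define \<kappa> where "\<kappa> = X powr (8 / d - 2) * (S / 4) powr (4 / d) * (d / ((d - 4) * (2 * pi) ^ 4))"
  define Br where "Br = HH\<^sup>2 * \<kappa> + Q\<^sup>2"
  \<comment> \<open>The domain of the iteration: it contains the ball, and only needs mean-square norms.\<close>
  define B where "B = {v \<in> (vec_L2 :: (real^'d \<Rightarrow> real^'n) set). vec_L2_norm v \<le> \<rho> \<and> (AE x in lebesgue. u0 x + v x \<in> I)}"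
  define P where "P = solves_system \<epsilon>m H g u0"
  have ce: "c_e > 0" using c_e by (simp add: sobolev_constant_def)
  have X1: "X \<ge> 1" by (simp add: X_def)
  have r: "r > 0" using ce X1 by (simp add: r_def)
  have Ir: "I = cball 0 r" unfolding I by (auto simp: r_def X_def algebra_simps)
  have clI: "closed I" by (simp add: Ir)
  have d5: "CARD('d) \<ge> 5" by (rule dim(1))
  have \<epsilon>m_le: "\<epsilon>m m \<le> \<epsilon>" for m unfolding \<epsilon>m(2) by (rule Max_ge) auto
  \<comment> \<open>The forcing is nontrivial, so \<open>u0\<close> is as well; this makes the contraction strict.\<close>
  have u0_pos: "H4_vec_norm u0 > 0"
  proof (rule ccontr)
    assume "\<not> H4_vec_norm u0 > 0"
    then have "vec_L2_norm u0 = 0"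
      using vec_L2_norm_le_H4[of u0] vec_L2_norm_nonneg[of u0] by linarith
    then have ae: "AE x in lebesgue. u0 x = 0"
      by (rule vec_L2_norm_eq_0[OF H4_vec_space_vec_L2[OF u0(1)]])
    have "ae_eq (f m) (\<lambda>_. 0)" for m
    proof (rule L2_weakly_0)
      show "f m \<in> L2_space" using f by simp
      fix \<psi> :: "real^'d \<Rightarrow> real" assume \<psi>: "test_function \<psi>"
      have "(LINT x|lebesgue. u0 x $ m * pde_op \<psi> x) = 0"
        by (rule integral_eq_zero_AE) (use ae in \<open>eventually_elim, simp\<close>)
      then show "(LINT x|lebesgue. f m x * \<psi> x) = 0"
        using u0(2)[of m] \<psi> by (simp add: solves_PDE_iff)
    qed
    then show False using f_nontrivial by blast
  qed
  define q where "q = \<rho> / X"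
  have q: "0 \<le> q" "q < 1" using u0_pos \<rho> by (auto simp: q_def X_def divide_simps)
  have "\<forall>m. \<exists>A. 0 \<le> fst A \<and> 0 \<le> snd A \<and> fst A + snd A \<le> M \<and> continuous_on I (\<lambda>z. g z $ m) \<and>
      (\<forall>x\<in>I. \<forall>y\<in>I. \<bar>g x $ m - g y $ m\<bar> \<le> fst A * norm (x - y)) \<and>
      (\<forall>x\<in>I. \<forall>y\<in>I. \<bar>g x $ m - g y $ m\<bar> \<le> snd A * (norm (x - y) * ((norm x + norm y) / 2)))"
  proof
    fix m
    have nonneg: "C2_norm I (\<lambda>z. g z $ l) \<ge> 0" for l
    proof -
      obtain A1 A2 where "A1 \<ge> 0" "A2 \<ge> 0" "A1 + A2 \<le> C2_norm I (\<lambda>z. g z $ l)"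
        by (rule C2_increment_bounds[OF r Ir g_C2(1)[of l] g0(1)[of l] g0(2)[of l]]) blast
      then show ?thesis by linarith
    qed
    have "C2_norm I (\<lambda>z. g z $ m) \<le> C2_vec_norm I g"
      unfolding C2_vec_norm_def by (rule member_le_sum) (use nonneg in auto)
    then have le: "C2_norm I (\<lambda>z. g z $ m) \<le> M" using g_C2(2) by (rule order_trans)
    obtain A1 A2 where A: "A1 \<ge> 0" "A2 \<ge> 0" "A1 + A2 \<le> C2_norm I (\<lambda>z. g z $ m)" "continuous_on I (\<lambda>z. g z $ m)"
      "\<forall>x\<in>I. \<forall>y\<in>I. \<bar>g x $ m - g y $ m\<bar> \<le> A1 * norm (x - y)"
      "\<forall>x\<in>I. \<forall>y\<in>I. \<bar>g x $ m - g y $ m\<bar> \<le> A2 * (norm (x - y) * ((norm x + norm y) / 2))"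
      by (rule C2_increment_bounds[OF r Ir g_C2(1)[of m] g0(1)[of m] g0(2)[of m]])
    show "\<exists>A. 0 \<le> fst A \<and> 0 \<le> snd A \<and> fst A + snd A \<le> M \<and> continuous_on I (\<lambda>z. g z $ m) \<and>
      (\<forall>x\<in>I. \<forall>y\<in>I. \<bar>g x $ m - g y $ m\<bar> \<le> fst A * norm (x - y)) \<and>
      (\<forall>x\<in>I. \<forall>y\<in>I. \<bar>g x $ m - g y $ m\<bar> \<le> snd A * (norm (x - y) * ((norm x + norm y) / 2)))"
      by (rule exI[of _ "(A1, A2)"]) (use A le in auto)
  qed
  from choice[OF this] obtain A where A:
    "\<And>m. 0 \<le> fst (A m)" "\<And>m. 0 \<le> snd (A m)" "\<And>m. fst (A m) + snd (A m) \<le> M"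
    "\<And>m. continuous_on I (\<lambda>z. g z $ m)"
    "\<And>m x y. x \<in> I \<Longrightarrow> y \<in> I \<Longrightarrow> \<bar>g x $ m - g y $ m\<bar> \<le> fst (A m) * norm (x - y)"
    "\<And>m x y. x \<in> I \<Longrightarrow> y \<in> I \<Longrightarrow> \<bar>g x $ m - g y $ m\<bar> \<le> snd (A m) * (norm (x - y) * ((norm x + norm y) / 2))"
    by blast
  have u0L: "u0 \<in> vec_L2" by (rule H4_vec_space_vec_L2[OF u0(1)])
  have u0n: "vec_L2_norm u0 \<le> X - 1" using vec_L2_norm_le_H4[of u0] by (simp add: X_def)
  define a where "a v x = u0 x + v x" for v :: "real^'d \<Rightarrow> real^'n" and x
  define G where "G v m x = g (a v x) $ m" for v m x
  have aB: "a v \<in> vec_L2" "vec_L2_norm (a v) \<le> X" "AE x in lebesgue. a v x \<in> I" if v: "v \<in> B" for v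
  proof -
    have v': "v \<in> vec_L2" "vec_L2_norm v \<le> 1" using v \<rho> by (auto simp: B_def)
    show "a v \<in> vec_L2" unfolding a_def[abs_def] by (rule vec_L2_add(1)[OF u0L v'(1)])
    show "vec_L2_norm (a v) \<le> X"
      unfolding a_def[abs_def] using vec_L2_add(2)[OF u0L v'(1)] u0n v'(2) by linarith
    show "AE x in lebesgue. a v x \<in> I" using v by (simp add: B_def a_def)
  qed
  have zeroI: "0 \<in> I" using r by (simp add: Ir)
  have zAE: "AE x in lebesgue. (0 :: real^'n) \<in> I" using zeroI by simp
  note diffG = composition_difference_bounds[OF clI A(4) aB(1,3) aB(1,3) A(1,5) A(2,6)]
  have G0: "G v m \<in> L1_space \<inter> L2_space" "L1_norm (G v m) \<le> snd (A m) * (X * X)" "L2_norm (G v m) \<le> fst (A m) * X"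
    if v: "v \<in> B" for v m
  proof -
    note b = composition_difference_bounds[OF clI A(4) aB(1,3)[OF v] vec_L2_0(1) zAE A(1,5) A(2,6), of m,
        unfolded vec_L2_0(2) g0(1) diff_0_right, folded G_def]
    show "G v m \<in> L1_space \<inter> L2_space" using b(1) by (simp add: G_def[abs_def])
    have "L1_norm (G v m) \<le> snd (A m) * (vec_L2_norm (a v) * ((vec_L2_norm (a v) + 0) / 2))"
      using b(2) by (simp add: G_def[abs_def])
    also have "\<dots> \<le> snd (A m) * (X * X)"
      using aB(2)[OF v] X1 vec_L2_norm_nonneg[of "a v"] by (intro mult_left_mono mult_mono A) auto
    finally show "L1_norm (G v m) \<le> snd (A m) * (X * X)" .
    have "L2_norm (G v m) \<le> fst (A m) * vec_L2_norm (a v)" using b(3) by (simp add: G_def[abs_def])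
    also have "\<dots> \<le> fst (A m) * X" by (intro mult_left_mono aB v A)
    finally show "L2_norm (G v m) \<le> fst (A m) * X" .
  qed
  have Gd: "(\<lambda>x. G v m x - G w m x) \<in> L1_space \<inter> L2_space"
    "L1_norm (\<lambda>x. G v m x - G w m x) \<le> snd (A m) * (vec_L2_norm (\<lambda>x. v x - w x) * X)"
    "L2_norm (\<lambda>x. G v m x - G w m x) \<le> fst (A m) * vec_L2_norm (\<lambda>x. v x - w x)"
    if v: "v \<in> B" and w: "w \<in> B" for v w m
  proof -
    note b = diffG[OF v v w w, of m, folded G_def]
    have e: "(\<lambda>x. a v x - a w x) = (\<lambda>x. v x - w x)" by (simp add: a_def)
    show "(\<lambda>x. G v m x - G w m x) \<in> L1_space \<inter> L2_space" by (rule b(1))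
    show "L2_norm (\<lambda>x. G v m x - G w m x) \<le> fst (A m) * vec_L2_norm (\<lambda>x. v x - w x)" using b(3) by (simp add: e)
    have "snd (A m) * (vec_L2_norm (\<lambda>x. v x - w x) * ((vec_L2_norm (a v) + vec_L2_norm (a w)) / 2))
      \<le> snd (A m) * (vec_L2_norm (\<lambda>x. v x - w x) * X)"
      using aB(2)[OF v] aB(2)[OF w] by (intro mult_left_mono A) auto
    with b(2) show "L1_norm (\<lambda>x. G v m x - G w m x) \<le> snd (A m) * (vec_L2_norm (\<lambda>x. v x - w x) * X)"
      unfolding e by (rule order_trans)
  qed
  have Piff: "P v u \<longleftrightarrow> (\<forall>m. solves_PDE (\<lambda>x. u x $ m) (\<lambda>x. \<epsilon>m m * lconv (H m) (G v m) x))" for v u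
    by (simp add: P_def solves_system_def lconv_def G_def a_def)
  have FL: "(\<lambda>x. \<epsilon>m m * lconv (H m) (G v m) x) \<in> L1_space \<inter> L2_space" if "v \<in> B" for v m
    using lconv_bounds(1)[OF H G0(1)[OF that]] L2_space_cmult(1)[of "lconv (H m) (G v m)" "\<epsilon>m m"]
    by (auto simp: L1_space_def)
  have Br: "Br > 0"
  proof -
    have "\<kappa> \<ge> 0" unfolding \<kappa>_def using dim by (intro mult_nonneg_nonneg divide_nonneg_nonneg) auto
    then show ?thesis unfolding Br_def using Q(1) by (intro add_nonneg_pos) auto
  qed
  \<comment> \<open>The smallness condition on \<open>\<epsilon>\<close>, squared and cleared of the negative power.\<close>
  have small: "(\<epsilon> * M * X * \<Delta>)\<^sup>2 * Br \<le> (q * \<Delta>)\<^sup>2" if \<Delta>: "\<Delta> \<ge> 0" for \<Delta>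
  proof -
    have "\<epsilon> \<le> \<rho> / (M * X\<^sup>2) * Br powr (- 1 / 2)"
      using \<epsilon>(2) by (simp add: Br_def \<kappa>_def X_def mult.assoc)
    then have "\<epsilon> * (M * X\<^sup>2) \<le> \<rho> / (M * X\<^sup>2) * Br powr (- 1 / 2) * (M * X\<^sup>2)"
      using M X1 by (intro mult_right_mono) auto
    also have "\<dots> = \<rho> * Br powr (- 1 / 2)" using M X1 by simp
    finally have "\<epsilon> * M * X \<le> q * Br powr (- 1 / 2)"
      using X1 by (simp add: q_def field_simps power2_eq_square)
    then have "\<epsilon> * M * X * \<Delta> \<le> q * Br powr (- 1 / 2) * \<Delta>" using \<Delta> by (rule mult_right_mono)
    then have "(\<epsilon> * M * X * \<Delta>)\<^sup>2 \<le> (q * Br powr (- 1 / 2) * \<Delta>)\<^sup>2"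
      using \<epsilon>(1) M X1 \<Delta> by (intro power_mono) auto
    then have "(\<epsilon> * M * X * \<Delta>)\<^sup>2 * Br \<le> (q * Br powr (- 1 / 2) * \<Delta>)\<^sup>2 * Br"
      using Br by (intro mult_right_mono) auto
    also have "\<dots> = (q * \<Delta>)\<^sup>2 * ((Br powr (- 1 / 2))\<^sup>2 * Br)"
      by (simp add: power_mult_distrib)
    also have "(Br powr (- 1 / 2))\<^sup>2 * Br = 1"
    proof -
      have "(Br powr (- 1 / 2))\<^sup>2 = Br powr (- 1 / 2 + - 1 / 2)" by (simp only: power2_eq_square powr_add)
      also have "\<dots> = inverse Br" using Br by (simp add: powr_minus)
      finally show ?thesis using Br by simp
    qed
    finally show ?thesis by simp
  qed
  \<comment> \<open>The contraction factor \<open>q = \<rho>/X\<close> arises from the smallness condition; \<open>\<Delta>\<close> is either \<open>X\<close> or the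
    distance of the two arguments.\<close>
  have estimate: "u \<in> H4_vec_space \<and> H4_vec_norm u \<le> q * \<Delta>"
    if u: "u \<in> vec_L2" and pde: "\<And>m. solves_PDE (\<lambda>x. u x $ m) (\<lambda>x. \<epsilon>m m * lconv (H m) (D m) x)"
      and D: "\<And>m. D m \<in> L1_space \<inter> L2_space" "\<And>m. L1_norm (D m) \<le> snd (A m) * (\<Delta> * X)" "\<And>m. L2_norm (D m) \<le> fst (A m) * \<Delta>"
      and \<Delta>: "\<Delta> \<ge> 0" for u :: "real^'d \<Rightarrow> real^'n" and D \<Delta>
  proof -
    have X0: "X > 0" using X1 by simp
    note e = solves_PDE_component_estimate[OF dim(1,2) H D(1) A(1,2,3) D(2,3) \<Delta> X0 \<epsilon>m(1) \<epsilon>m_le vec_L2_component[OF u] pde,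
        folded dim(3) S]
    have "(H4_vec_norm u)\<^sup>2 = (\<Sum>m\<in>UNIV. (H4_norm (\<lambda>x. u x $ m))\<^sup>2)"
      by (simp add: H4_vec_norm_def sum_nonneg)
    also have "\<dots> \<le> (\<Sum>m\<in>UNIV. (\<epsilon> * M * X * \<Delta>)\<^sup>2 * ((L1_norm (H m))\<^sup>2 * \<kappa> + (L2_norm (H m))\<^sup>2))"
      unfolding \<kappa>_def by (rule sum_mono) (rule e(2))
    also have "\<dots> = (\<epsilon> * M * X * \<Delta>)\<^sup>2 * Br"
      by (simp add: Br_def HH(2) Q(2) sum_distrib_left sum_distrib_right sum.distrib distrib_left)
    also have "\<dots> \<le> (q * \<Delta>)\<^sup>2" by (rule small[OF \<Delta>])
    finally have "H4_vec_norm u \<le> q * \<Delta>" by (rule power2_le_imp_le) (use q \<Delta> in simp)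
    with e(1) show ?thesis by (simp add: H4_vec_space_def)
  qed
  have ex: "\<exists>u\<in>H4_ball \<rho>. P v u" if v: "v \<in> B" for v
  proof -
    have "\<exists>u. u \<in> L2_space \<and> solves_PDE u (\<lambda>x. \<epsilon>m m * lconv (H m) (G v m) x)" for m
      by (rule solution_exists[OF d5 FL[OF v, of m]]) blast
    then obtain U where U: "\<And>m. U m \<in> L2_space" "\<And>m. solves_PDE (U m) (\<lambda>x. \<epsilon>m m * lconv (H m) (G v m) x)" by metis
    define u where "u x = (\<chi> m. U m x)" for x
    have uL: "u \<in> vec_L2" using U(1) by (simp add: vec_L2_def u_def)
    have pde: "solves_PDE (\<lambda>x. u x $ m) (\<lambda>x. \<epsilon>m m * lconv (H m) (G v m) x)" for m using U(2) by (simp add: u_def)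
    have "u \<in> H4_vec_space \<and> H4_vec_norm u \<le> q * X"
      by (rule estimate[OF uL pde G0[OF v]]) (use X1 in simp)
    moreover have "q * X = \<rho>" using X1 by (simp add: q_def)
    ultimately show ?thesis using pde by (auto simp: H4_ball_def Piff)
  qed
  have contr: "(\<lambda>x. u x - u' x) \<in> H4_vec_space \<and> H4_vec_norm (\<lambda>x. u x - u' x) \<le> q * vec_L2_norm (\<lambda>x. v x - w x)"
    if v: "v \<in> B" and w: "w \<in> B" and u: "u \<in> H4_ball \<rho>" and u': "u' \<in> H4_ball \<rho>" and Pu: "P v u" and Pu': "P w u'" for v w u u'
  proof -
    have uL: "u \<in> vec_L2" "u' \<in> vec_L2" using u u' by (auto simp: H4_ball_def intro: H4_vec_space_vec_L2)
    show ?thesis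
    proof (rule estimate[OF vec_L2_diff(1)[OF uL] _ Gd[OF v w]])
      fix m
      have "solves_PDE (\<lambda>x. u x $ m - u' x $ m) (\<lambda>x. \<epsilon>m m * lconv (H m) (G v m) x - \<epsilon>m m * lconv (H m) (G w m) x)"
        using Pu Pu' by (intro solves_PDE_diff vec_L2_component uL FL v w) (simp_all add: Piff)
      also have "(\<lambda>x. \<epsilon>m m * lconv (H m) (G v m) x - \<epsilon>m m * lconv (H m) (G w m) x)
         = (\<lambda>x. \<epsilon>m m * lconv (H m) (\<lambda>y. G v m y - G w m y) x)"
        using H G0(1)[OF v] G0(1)[OF w] by (simp add: lconv_diff right_diff_distrib)
      finally show "solves_PDE (\<lambda>x. (u x - u' x) $ m) (\<lambda>x. \<epsilon>m m * lconv (H m) (\<lambda>y. G v m y - G w m y) x)" by simp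
    qed simp
  qed
  have sob: "AE x in lebesgue. norm (u x) \<le> c_e * H4_vec_norm u" if "u \<in> H4_vec_space" for u :: "real^'d \<Rightarrow> real^'n"
    by (rule sobolev_vec[OF c_e that])
  have ball: "H4_ball \<rho> \<subseteq> B"
  proof
    fix v :: "real^'d \<Rightarrow> real^'n" assume "v \<in> H4_ball \<rho>"
    then have v: "v \<in> H4_vec_space" "H4_vec_norm v \<le> \<rho>" by (auto simp: H4_ball_def)
    have "AE x in lebesgue. u0 x + v x \<in> I"
      using sob[OF u0(1)] sob[OF v(1)]
    proof eventually_elim
      case (elim x)
      have "c_e * H4_vec_norm v \<le> c_e * 1" using ce v(2) \<rho>(2) by (intro mult_left_mono) auto
      then show ?case using elim norm_triangle_ineq[of "u0 x" "v x"] by (simp add: I)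
    qed
    then show "v \<in> B" using v vec_L2_norm_le_H4[of v] H4_vec_space_vec_L2 by (auto simp: B_def)
  qed
  have zero: "(\<lambda>_. 0) \<in> B"
  proof -
    have "AE x in lebesgue. u0 x \<in> I" using sob[OF u0(1)] by eventually_elim (use ce in \<open>simp add: I\<close>)
    then show ?thesis using \<rho> by (simp add: B_def vec_L2_0)
  qed
  have cong: "P w u" if v: "v \<in> B" and w: "w \<in> B" and ae: "ae_eq v w" and Pv: "P v u" for v w u
  proof -
    have "lconv (H m) (G v m) = lconv (H m) (G w m)" for m
    proof
      fix x
      have m: "(\<lambda>y. H m (x - y)) \<in> borel_measurable lebesgue"
        using H[of m] by (intro L2_spaceD(1) L2_reflect) simp
      have "G v m \<in> borel_measurable lebesgue" "G w m \<in> borel_measurable lebesgue"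
        using G0(1)[OF v] G0(1)[OF w] by (auto intro: L2_spaceD(1))
      then show "lconv (H m) (G v m) x = lconv (H m) (G w m) x"
        unfolding lconv_def
        by (intro integral_cong_AE borel_measurable_times m) (use ae in \<open>simp_all, eventually_elim, simp add: G_def a_def\<close>)
    qed
    then show ?thesis using Pv by (simp add: Piff)
  qed
  obtain up where up: "up \<in> H4_ball \<rho>" "P up up"
    by (rule contraction_fixed_point[OF B_def clI zero ball ex contr q sob _ cong]) (use ce in simp_all)
  have BL: "v \<in> vec_L2" if "v \<in> H4_ball \<rho>" for v :: "real^'d \<Rightarrow> real^'n" using that ball by (auto simp: B_def)
  define T where "T v = (SOME u. u \<in> H4_ball \<rho> \<and> P v u)" for v
  have T: "T v \<in> H4_ball \<rho>" "P v (T v)" if "v \<in> H4_ball \<rho>" for v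
  proof -
    have "\<exists>u. u \<in> H4_ball \<rho> \<and> P v u" using ex that ball by blast
    from someI_ex[OF this] show "T v \<in> H4_ball \<rho>" "P v (T v)" by (simp_all add: T_def)
  qed
  have contrN: "vec_L2_norm (\<lambda>x. u x - u' x) \<le> q * vec_L2_norm (\<lambda>x. v x - w x)"
    if "v \<in> H4_ball \<rho>" "w \<in> H4_ball \<rho>" "u \<in> H4_ball \<rho>" "u' \<in> H4_ball \<rho>" "P v u" "P w u'" for v w u u'
    by (rule order_trans[OF vec_L2_norm_le_H4])
      (rule conjunct2[OF contr[OF subsetD[OF ball that(1)] subsetD[OF ball that(2)] that(3-6)]])
  have cong_T: "ae_eq u u'"
    if "v \<in> H4_ball \<rho>" "w \<in> H4_ball \<rho>" "u \<in> H4_ball \<rho>" "u' \<in> H4_ball \<rho>" "P v u" "P w u'" "ae_eq v w" for v w u u'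
  proof (rule vec_L2_norm_eq_0_ae_eq[OF BL[OF that(3)] BL[OF that(4)]])
    show "vec_L2_norm (\<lambda>x. u x - u' x) \<le> 0"
      using contrN[OF that(1-6)] ae_eq_vec_L2_norm_0[OF BL[OF that(1)] that(7)] by simp
  qed
  have fixed_unique: "ae_eq w up" if w: "w \<in> H4_ball \<rho>" "u \<in> H4_ball \<rho>" "P w u" "ae_eq u w" for w u
  proof -
    let ?n = "vec_L2_norm (\<lambda>x. w x - up x)"
    have "vec_L2_norm (\<lambda>x. u x - up x) \<le> q * ?n" by (rule contrN[OF w(1) up(1) w(2) up(1) w(3) up(2)])
    moreover have "?n = vec_L2_norm (\<lambda>x. u x - up x)"
      by (rule vec_L2_cong_AE(2)[OF vec_L2_diff(1)[OF BL[OF w(2)] BL[OF up(1)]]]) (use w(4) in \<open>eventually_elim, simp\<close>)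
    ultimately have "(1 - q) * ?n \<le> 0" by (simp add: algebra_simps)
    then have "?n \<le> 0" using q by (simp add: mult_le_0_iff)
    then show ?thesis by (rule vec_L2_norm_eq_0_ae_eq[OF BL[OF w(1)] BL[OF up(1)]])
  qed
  show ?thesis
  proof (intro exI[of _ T] conjI ballI impI)
    fix v :: "real^'d \<Rightarrow> real^'n" assume v: "v \<in> H4_ball \<rho>"
    show "T v \<in> H4_ball \<rho>" by (rule T(1)[OF v])
    show "solves_system \<epsilon>m H g u0 v (T v)" using T(2)[OF v] by (simp add: P_def)
    fix u :: "real^'d \<Rightarrow> real^'n" assume "u \<in> H4_ball \<rho>" "solves_system \<epsilon>m H g u0 v u"
    then show "ae_eq u (T v)" by (intro cong_T[OF v v _ T(1)[OF v] _ T(2)[OF v]]) (auto simp: P_def)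
  next
    fix v w :: "real^'d \<Rightarrow> real^'n" assume v: "v \<in> H4_ball \<rho>" and w: "w \<in> H4_ball \<rho>" and ae: "ae_eq v w"
    show "ae_eq (T v) (T w)" by (rule cong_T[OF v w T(1)[OF v] T(1)[OF w] T(2)[OF v] T(2)[OF w] ae])
  next
    show "\<exists>q. 0 \<le> q \<and> q < 1 \<and> (\<forall>v\<in>H4_ball \<rho>. \<forall>w\<in>H4_ball \<rho>.
        H4_vec_norm (\<lambda>x. T v x - T w x) \<le> q * H4_vec_norm (\<lambda>x. v x - w x))"
    proof (intro exI[of _ q] conjI q ballI)
      fix v w :: "real^'d \<Rightarrow> real^'n" assume vw: "v \<in> H4_ball \<rho>" "w \<in> H4_ball \<rho>"
      have "H4_vec_norm (\<lambda>x. T v x - T w x) \<le> q * vec_L2_norm (\<lambda>x. v x - w x)"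
        by (rule conjunct2[OF contr[OF subsetD[OF ball vw(1)] subsetD[OF ball vw(2)] T(1)[OF vw(1)] T(1)[OF vw(2)] T(2)[OF vw(1)] T(2)[OF vw(2)]]])
      also have "\<dots> \<le> q * H4_vec_norm (\<lambda>x. v x - w x)"
        by (intro mult_left_mono vec_L2_norm_le_H4 q)
      finally show "H4_vec_norm (\<lambda>x. T v x - T w x) \<le> q * H4_vec_norm (\<lambda>x. v x - w x)" .
    qed
  next
    show "\<exists>up\<in>H4_ball \<rho>. ae_eq (T up) up \<and>
        (\<forall>w\<in>H4_ball \<rho>. ae_eq (T w) w \<longrightarrow> ae_eq w up) \<and>
        solves_system \<epsilon>m H g u0 up up \<and>
        (\<forall>w\<in>H4_ball \<rho>. solves_system \<epsilon>m H g u0 w w \<longrightarrow> ae_eq w up)"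
    proof (intro bexI[of _ up] conjI ballI impI)
      show "ae_eq (T up) up" by (rule cong_T[OF up(1) up(1) T(1)[OF up(1)] up(1) T(2)[OF up(1)] up(2)]) simp
      show "solves_system \<epsilon>m H g u0 up up" using up(2) by (simp add: P_def)
      fix w :: "real^'d \<Rightarrow> real^'n" assume w: "w \<in> H4_ball \<rho>"
      show "ae_eq w up" if "ae_eq (T w) w" by (rule fixed_unique[OF w T[OF w] that])
      show "ae_eq w up" if "solves_system \<epsilon>m H g u0 w w"
        by (rule fixed_unique[OF w w]) (use that in \<open>simp_all add: P_def\<close>)
    qed (rule up(1))
  qed
qed

end
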